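(* Let $0\le t<1$, let $\{a_i\}_{i\ge1}$, $\{b_j\}_{j\ge1}$ be positive reals with $a_ib_j<1$ for all $i,j$, let $\{\Lambda(i,j)\}_{i,j\ge0}$ be the Hall-Littlewood RSK field (defined in the context), and let $d_0(i,j)$, $d_1(i,j)$ be the numbers of coordinates of $\Lambda(i,j)$ equal to $0$ and $1$ respectively; put $h_0=d_0$, $h_1=d_0+d_1$. Then for $i,j\ge1$ the pair $(d_0(i,j),d_1(i,j))$ is determined by $(d_0,d_1)(i-1,j)$, $(d_0,d_1)(i,j-1)$, $(d_0,d_1)(i-1,j-1)$ in a Markovian way (i.e. its conditional law given $\Lambda(i-1,j-1),\Lambda(i,j-1),\Lambda(i-1,j)$ depends only on these three pairs), with the following transition probabilities. Put $a=a_i$, $b=b_j$, $k=d_1(i-1,j-1)$. Say that a black arrow (resp. red arrow) enters from the left, written BL (resp. RL), if $h_0(i-1,j)\neq h_0(i-1,j-1)$ (resp. the same with $h_1$); enters from below, BB (resp. RB), if $h_0(i,j-1)\ne h_0(i-1,j-1)$ (resp. $h_1$); exits upwards, BU (resp. RU), if $h_0(i,j)\neq h_0(i-1,j)$ (resp. $h_1$); exits to the right, BR (resp. RR), if $h_0(i,j)\ne h_0(i,j-1)$ (resp. $h_1$). All nonzero differences here equal $1$ in absolute value, with $h_0,h_1$ increasing in $j$ and decreasing in $i$, and the number of entering arrows of each colour equals the number of exiting arrows of that colour. Given the exact set of entering arrows, the sets of exiting arrows have probabilities (all others being zero): - none: none, probability $1$. - $\{BL,BB\}$: $\{BU,BR\}$,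 probability $1$. - $\{RL,RB\}$: $\{RU,RR\}$, probability $1$. - $\{BL,BB,RL,RB\}$: $\{BU,BR,RU,RR\}$, probability $1$. - $\{BL\}$: $\{BR\}$ with $\frac{1-ab}{1-tab}$; $\{BU\}$ with $\frac{(1-t)ab}{1-tab}$. - $\{RL\}$: $\{RR\}$ with $\frac{1-ab}{1-tab}$; $\{RU\}$ with $\frac{(1-t)ab}{1-tab}$. - $\{BL,RL,RB\}$: $\{BR,RU,RR\}$ with $\frac{1-ab}{1-tab}$; $\{BU,RU,RR\}$ with $\frac{(1-t)ab}{1-tab}$. - $\{BL,BB,RL\}$: $\{BU,BR,RR\}$ with $\frac{1-ab}{1-tab}$; $\{BU,BR,RU\}$ with $\frac{(1-t)ab}{1-tab}$. - $\{BB\}$: $\{BU\}$ with $\frac{t(1-ab)}{1-tab}$; $\{BR\}$ with $\frac{1-t}{1-tab}$. - $\{RB\}$: $\{RU\}$ with $\frac{t(1-ab)}{1-tab}$; $\{RR\}$ with $\frac{1-t}{1-tab}$. - $\{BB,RL,RB\}$: $\{BU,RU,RR\}$ with $\frac{t(1-ab)}{1-tab}$; $\{BR,RU,RR\}$ with $\frac{1-t}{1-tab}$. - $\{BL,BB,RB\}$: $\{BU,BR,RU\}$ with $\frac{t(1-ab)}{1-tab}$; $\{BU,BR,RR\}$ with $\frac{1-t}{1-tab}$. - $\{BB,RB\}$: $\{BU,RU\}$ with $\frac{t(1-ab)}{1-tab}$; $\{BR,RR\}$ with $\frac{1-t}{1-tab}$. - $\{BB,RL\}$: $\{BU,RR\}$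 with $\frac{t(1-ab)}{1-tab}$; $\{BR,RU\}$ with $\frac{1-t}{1-tab}$. - $\{BL,RB\}$: $\{BR,RR\}$ with $\frac{1-ab}{1-tab}\cdot\frac{1-t}{1-t^k}$; $\{BR,RU\}$ with $\frac{1-ab}{1-tab}\cdot\frac{t-t^k}{1-t^k}$; $\{BU,RR\}$ with $\frac{(1-t)ab}{1-tab}$. - $\{BL,RL\}$: $\{BR,RR\}$ with $\frac{1-ab}{1-tab}$; $\{BU,RR\}$ with $\frac{(1-t)ab(1-ab)}{1-tab}$; $\{BU,RU\}$ with $\frac{(1-t)a^2b^2}{1-tab}$.
   Context: A signature of length $N$ is a sequence of integers $\lambda_1\ge\dots\ge\lambda_N$; $\mathrm{Sig}_N$ is the set of these ($\mathrm{Sig}_0=\{\varnothing\}$), $|\lambda|=\sum\lambda_i$. For $\lambda,\mu\in\mathrm{Sig}_N$ write $\lambda\prec\mu$ if $\mu_1\ge\lambda_1\ge\mu_2\ge\dots\ge\mu_N\ge\lambda_N$; for $\lambda\in\mathrm{Sig}_{N-1}$, $\mu\in\mathrm{Sig}_N$ write $\lambda\prec\mu$ if $\mu_1\ge\lambda_1\ge\dots\ge\lambda_{N-1}\ge\mu_N$. A signature is viewed as particles on $\mathbb Z$ at the positions of its coordinates; moving a particle at position $k$ by $+1$ means replacing one coordinate equal to $k$ by $k+1$ (and reordering). Definition of $U(\mu\to\rho\mid\lambda\to\nu)$ for $\lambda,\mu,\nu,\rho\in\mathrm{Sig}_N$. It is $0$ unless $\lambda\prec\mu\prec\rho$, $\lambda\prec\nu\prec\rho$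 and $|\nu|-|\lambda|=|\rho|-|\mu|$. Otherwise put $m=|\nu|-|\lambda|$, $n=|\mu|-|\lambda|$, and consider functions $L:\{0,\dots,m\}\times\{0,\dots,n\}\to\mathrm{Sig}_N$ with $L(0,0)=\lambda$, $L(m,0)=\nu$, $L(0,n)=\mu$, $L(m,n)=\rho$ such that: $L(i+1,j)$ is obtained from $L(i,j)$ by moving one particle, at position denoted $h_{i,j}$, by $+1$; $L(i,j+1)$ is obtained from $L(i,j)$ by moving one particle, at position denoted $v_{i,j}$, by $+1$; $h_{i,j}<h_{i+1,j}$ and $v_{i,j}<v_{i,j+1}$ whenever defined; and whenever $h_{i,j}=v_{i,j}=k$ (with $0\le i<m$, $0\le j<n$), one has $h_{i,j+1}=v_{i+1,j}\in\{k,k+1\}$. At most one such $L$ exists. If none exists, $U:=0$. If it exists, let $\mathsf b_{i,j}$ ($0\le i<m$, $0\le j<n$) be the unit box with south-west corner $(i,j)$. It is a zero-box if $h_{i,j}=v_{i,j}=h_{i,j+1}=v_{i+1,j}$; a one-box if $h_{i,j}=v_{i,j}=h_{i,j+1}-1=v_{i+1,j}-1$; and otherwise trivial. Boxes outside the rectangle are trivial, and $h_{-1,j}=v_{i,-1}=-\infty$. For a zero-box or one-box $B=\mathsf b_{i,j}$ put $r(B)=h_{i,j}=v_{i,j}$, $\bar r(B)=h_{i,j+1}=v_{i+1,j}$, $c(B)=t^{\#}$, where $\#$ is the number of coordinates of $L(i,j)$ equal to $r(B)$. The weight $w(B)$ of $B=\mathsf b_{i,j}$ is: (1) $1$ if $B$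 is trivial; or $B$ is a one-box and at least one of $\mathsf b_{i-1,j},\mathsf b_{i,j-1}$ is a one-box; or $B$ is a one-box and $\mathsf b_{i-1,j-1}$ is a one-box with $\bar r(\mathsf b_{i-1,j-1})=r(B)-1$; or $B$ is a zero-box and $\mathsf b_{i-1,j-1}$ is a zero-box with $\bar r(\mathsf b_{i-1,j-1})=r(B)-1$; (2) $t$ if $B$ is a zero-box and exactly one of $h_{i-1,j},v_{i,j-1}$ equals $r(B)-1$; (3) $1-t$ if $B$ is a one-box, $\mathsf b_{i-1,j},\mathsf b_{i,j-1}$ are trivial, and exactly one of $h_{i-1,j},v_{i,j-1}$ equals $r(B)-1$; (4) $\frac{t-c(B)}{1-c(B)}$ if $B$ is a zero-box and $h_{i-1,j},v_{i,j-1}<r(B)-1$; (5) $\frac{1-t}{1-c(B)}$ if $B$ is a one-box and $h_{i-1,j},v_{i,j-1}<r(B)-1$; (6) $0$ if $B$ is a one-box and $\mathsf b_{i-1,j-1}$ is a zero-box with $\bar r(\mathsf b_{i-1,j-1})=r(B)-1$, or $B$ is a zero-box and $\mathsf b_{i-1,j-1}$ is a one-box with $\bar r(\mathsf b_{i-1,j-1})=r(B)-1$. Then $U(\mu\to\rho\mid\lambda\to\nu):=\prod_{i=0}^{m-1}\prod_{j=0}^{n-1}w(\mathsf b_{i,j})$. HL-RSK with input: for $\lambda,\nu\in\mathrm{Sig}_{N-1}$, $\mu,\rho\in\mathrm{Sig}_N$, $\lambda\prec\mu$, $\lambda\prec\nu$ and an integer $r\ge0$, choose an integer $-V$ strictly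 smaller than all coordinates of $\mu$ and $\nu$, let $\tilde\nu=(\nu_1,\dots,\nu_{N-1},-V)$, $\tilde\lambda=(\lambda_1,\dots,\lambda_{N-1},-V-r)$, and set $U^r(\mu\to\rho\mid\lambda\to\nu):=U(\mu\to\rho\mid\tilde\lambda\to\tilde\nu)$ (independent of $V$). For fixed $\lambda,\mu,\nu,r$ this is a probability distribution in $\rho$. Hall-Littlewood RSK field: the random array $\Lambda(i,j)\in\mathrm{Sig}_j$, $i,j\ge0$, with $\Lambda(i,0)=\varnothing$, $\Lambda(0,j)=(0,\dots,0)\in\mathrm{Sig}_j$, built as follows. Let $r_{i,j}$, $i,j\ge1$, be independent with $\mathrm{Prob}(r_{i,j}=d)=(1-t\mathbf 1_{d\ge1})(a_ib_j)^d\frac{1-a_ib_j}{1-ta_ib_j}$, $d=0,1,2,\dots$. Successively for $i+j=2,3,\dots$ ($i,j\ge1$), given $\lambda=\Lambda(i-1,j-1)$, $\nu=\Lambda(i,j-1)$, $\mu=\Lambda(i-1,j)$ and $r=r_{i,j}$, set $\Lambda(i,j)=\rho$ with probability $U^r(\mu\to\rho\mid\lambda\to\nu)$, independently for distinct $(i,j)$. *)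

theory Defs
  imports "HOL-Probability.Probability" "HOL-Library.Multiset"
begin

section \<open>Signatures\<close>

definition Sig :: "nat \<Rightarrow> int list set" where
  "Sig N = {l. length l = N \<and> sorted_wrt (\<ge>) l}"

text \<open>One relation covers both kinds of interlacing: \<open>m\<close> has either the length of \<open>l\<close> or one
  coordinate more.  Coordinates are indexed from 0.\<close>

definition interlaces :: "int list \<Rightarrow> int list \<Rightarrow> bool" (infix "\<prec>s" 50) where
  "l \<prec>s m \<longleftrightarrow> (length m = length l \<or> length m = Suc (length l)) \<and>
     (\<forall>i < length l. l ! i \<le> m ! i) \<and>
     (\<forall>i. Suc i < length m \<longrightarrow> m ! Suc i \<le> l ! i)"

definition moves :: "int \<Rightarrow> int list \<Rightarrow> int list \<Rightarrow> bool" where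
  "moves k l l' \<longleftrightarrow> k \<in> set l \<and> mset l' = add_mset (k + 1) (mset l - {#k#})"


section \<open>The weights \<open>U\<close>\<close>

text \<open>\<open>hpos L i j\<close> and \<open>vpos L i j\<close> are the positions of the particle moved along the edge from
  \<open>(i, j)\<close> to \<open>(i + 1, j)\<close> and to \<open>(i, j + 1)\<close>.\<close>

definition hpos :: "(nat \<Rightarrow> nat \<Rightarrow> int list) \<Rightarrow> nat \<Rightarrow> nat \<Rightarrow> int" where
  "hpos L i j = (THE k. moves k (L i j) (L (Suc i) j))"

definition vpos :: "(nat \<Rightarrow> nat \<Rightarrow> int list) \<Rightarrow> nat \<Rightarrow> nat \<Rightarrow> int" where
  "vpos L i j = (THE k. moves k (L i j) (L i (Suc j)))"

definition growth_diagram ::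
  "nat \<Rightarrow> nat \<Rightarrow> int list \<Rightarrow> int list \<Rightarrow> int list \<Rightarrow> int list \<Rightarrow> (nat \<Rightarrow> nat \<Rightarrow> int list) \<Rightarrow> bool" where
  "growth_diagram m n lam mu nu rho L \<longleftrightarrow>
     (\<forall>i \<le> m. \<forall>j \<le> n. L i j \<in> Sig (length lam)) \<and>
     L 0 0 = lam \<and> L m 0 = nu \<and> L 0 n = mu \<and> L m n = rho \<and>
     (\<forall>i < m. \<forall>j \<le> n. \<exists>k. moves k (L i j) (L (Suc i) j)) \<and>
     (\<forall>i \<le> m. \<forall>j < n. \<exists>k. moves k (L i j) (L i (Suc j))) \<and>
     (\<forall>i j. Suc i < m \<and> j \<le> n \<longrightarrow> hpos L i j < hpos L (Suc i) j) \<and>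
     (\<forall>i j. i \<le> m \<and> Suc j < n \<longrightarrow> vpos L i j < vpos L i (Suc j)) \<and>
     (\<forall>i < m. \<forall>j < n. hpos L i j = vpos L i j \<longrightarrow>
        hpos L i (Suc j) = vpos L (Suc i) j \<and>
        hpos L i (Suc j) \<in> {hpos L i j, hpos L i j + 1})"

definition zero_box :: "(nat \<Rightarrow> nat \<Rightarrow> int list) \<Rightarrow> nat \<Rightarrow> nat \<Rightarrow> bool" where
  "zero_box L i j \<longleftrightarrow> hpos L i j = vpos L i j \<and> vpos L i j = hpos L i (Suc j) \<and>
     hpos L i (Suc j) = vpos L (Suc i) j"

definition one_box :: "(nat \<Rightarrow> nat \<Rightarrow> int list) \<Rightarrow> nat \<Rightarrow> nat \<Rightarrow> bool" where
  "one_box L i j \<longleftrightarrow> hpos L i j = vpos L i j \<and> vpos L i j = hpos L i (Suc j) - 1 \<and>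
     hpos L i (Suc j) - 1 = vpos L (Suc i) j - 1"

text \<open>The weight of the box with south-west corner \<open>(i, j)\<close>.  The guards \<open>0 < i\<close>, \<open>i = 0\<close> etc.
  encode that boxes outside the rectangle are trivial and that \<open>h\<close> and \<open>v\<close> are \<open>-\<infinity>\<close> at
  index \<open>-1\<close>.  In a growth diagram the diagonal predecessor, if it is a zero-box or a one-box, has
  upper position \<open>hpos L (i - 1) j\<close>.  The listed cases are mutually exclusive and exhaustive except
  for that of a box whose diagonal predecessor is adjacent and of the opposite kind, which has
  weight 0.\<close>

definition box_weight :: "real \<Rightarrow> (nat \<Rightarrow> nat \<Rightarrow> int list) \<Rightarrow> nat \<Rightarrow> nat \<Rightarrow> real" where
  "box_weight t L i j =
    (let r = hpos L i j;
         c = t ^ count_list (L i j) r;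
         h_adj = (0 < i \<and> hpos L (i - 1) j = r - 1);
         v_adj = (0 < j \<and> vpos L i (j - 1) = r - 1);
         h_far = (i = 0 \<or> hpos L (i - 1) j < r - 1);
         v_far = (j = 0 \<or> vpos L i (j - 1) < r - 1);
         left_one = (0 < i \<and> one_box L (i - 1) j);
         below_one = (0 < j \<and> one_box L i (j - 1));
         left_trivial = (i = 0 \<or> \<not> zero_box L (i - 1) j \<and> \<not> one_box L (i - 1) j);
         below_trivial = (j = 0 \<or> \<not> zero_box L i (j - 1) \<and> \<not> one_box L i (j - 1));
         diag_zero = (0 < i \<and> 0 < j \<and> zero_box L (i - 1) (j - 1) \<and> hpos L (i - 1) j = r - 1);
         diag_one = (0 < i \<and> 0 < j \<and> one_box L (i - 1) (j - 1) \<and> hpos L (i - 1) j = r - 1)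
     in
      if \<not> zero_box L i j \<and> \<not> one_box L i j then 1
      else if one_box L i j \<and> (left_one \<or> below_one) then 1
      else if one_box L i j \<and> diag_one then 1
      else if zero_box L i j \<and> diag_zero then 1
      else if zero_box L i j \<and> (h_adj \<noteq> v_adj) then t
      else if one_box L i j \<and> left_trivial \<and> below_trivial \<and> (h_adj \<noteq> v_adj) then 1 - t
      else if zero_box L i j \<and> h_far \<and> v_far then (t - c) / (1 - c)
      else if one_box L i j \<and> h_far \<and> v_far then (1 - t) / (1 - c)
      else 0)"

text \<open>\<open>hlU t mu rho lam nu\<close> is \<open>U(mu \<rightarrow> rho | lam \<rightarrow> nu)\<close>.  On the rectangle a growth diagram is
  determined by its corners, so the product does not depend on the choice of \<open>L\<close>.\<close>

definition hlU :: "real \<Rightarrow> int list \<Rightarrow> int list \<Rightarrow> int list \<Rightarrow> int list \<Rightarrow> real" where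
  "hlU t mu rho lam nu =
    (if {lam, mu, nu, rho} \<subseteq> Sig (length lam) \<and>
        lam \<prec>s mu \<and> mu \<prec>s rho \<and> lam \<prec>s nu \<and> nu \<prec>s rho \<and>
        sum_list nu - sum_list lam = sum_list rho - sum_list mu
     then let m = nat (sum_list nu - sum_list lam);
              n = nat (sum_list mu - sum_list lam)
          in if \<exists>L. growth_diagram m n lam mu nu rho L
             then let L = (SOME L. growth_diagram m n lam mu nu rho L)
                  in \<Prod>i<m. \<Prod>j<n. box_weight t L i j
             else 0
     else 0)"

text \<open>The version with input \<open>r\<close>.  The auxiliary coordinate can be any integer below all
  coordinates of \<open>mu\<close> and \<open>nu\<close>; we take the largest.\<close>

definition hlU_input :: "real \<Rightarrow> nat \<Rightarrow> int list \<Rightarrow> int list \<Rightarrow> int list \<Rightarrow> int list \<Rightarrow> real" where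
  "hlU_input t r mu rho lam nu =
    (let z = Min (set mu \<union> set nu) - 1 in hlU t mu rho (lam @ [z - int r]) (nu @ [z]))"


section \<open>The Hall-Littlewood RSK field\<close>

text \<open>The last assumption describes how the anti-diagonal \<open>i + j = n\<close> is sampled: conditionally on
  the earlier part of the array and on the inputs (up to an arbitrary level \<open>m \<ge> n\<close>), its entries
  are independent with laws given by \<open>hlU_input\<close>.\<close>

definition antidiag :: "nat \<Rightarrow> (nat \<times> nat) set" where
  "antidiag n = {(i, j). 1 \<le> i \<and> 1 \<le> j \<and> i + j = n}"

locale HL_RSK_field = prob_space M
  for t :: real and a b :: "nat \<Rightarrow> real" and M :: "'w measure"
    and r :: "nat \<Rightarrow> nat \<Rightarrow> 'w \<Rightarrow> nat" and \<Lambda> :: "nat \<Rightarrow> nat \<Rightarrow> 'w \<Rightarrow> int list" +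
  assumes inputs_indep:
      "indep_vars (\<lambda>_. count_space UNIV) (\<lambda>(i, j). r i j) ({1..} \<times> {1..})"
    and inputs_law: "\<And>i j d. 1 \<le> i \<Longrightarrow> 1 \<le> j \<Longrightarrow>
      \<P>(\<omega> in M. r i j \<omega> = d) =
        (1 - t * (if 1 \<le> d then 1 else 0)) * (a i * b j) ^ d * ((1 - a i * b j) / (1 - t * a i * b j))"
    and field_measurable: "\<And>i j. \<Lambda> i j \<in> measurable M (count_space UNIV)"
    and field_bottom: "\<And>i \<omega>. \<omega> \<in> space M \<Longrightarrow> \<Lambda> i 0 \<omega> = []"
    and field_left: "\<And>j \<omega>. \<omega> \<in> space M \<Longrightarrow> \<Lambda> 0 j \<omega> = replicate j 0"
    and field_step: "\<And>n m s l.
      n \<le> m \<Longrightarrow>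
      \<P>(\<omega> in M. (\<forall>i j. i + j < n \<longrightarrow> \<Lambda> i j \<omega> = l i j) \<and>
                (\<forall>i j. 1 \<le> i \<and> 1 \<le> j \<and> i + j \<le> m \<longrightarrow> r i j \<omega> = s i j)) > 0 \<Longrightarrow>
      \<P>(\<omega> in M. (\<forall>(i, j) \<in> antidiag n. \<Lambda> i j \<omega> = l i j) \<bar>
                (\<forall>i j. i + j < n \<longrightarrow> \<Lambda> i j \<omega> = l i j) \<and>
                (\<forall>i j. 1 \<le> i \<and> 1 \<le> j \<and> i + j \<le> m \<longrightarrow> r i j \<omega> = s i j)) =
      (\<Prod>(i, j) \<in> antidiag n.
        hlU_input t (s i j) (l (i - 1) j) (l i j) (l (i - 1) (j - 1)) (l i (j - 1)))"


section \<open>The vertex model of the two lowest levels\<close>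

definition d0 :: "int list \<Rightarrow> nat" where "d0 l = count_list l 0"
definition d1 :: "int list \<Rightarrow> nat" where "d1 l = count_list l 1"
definition h0 :: "int list \<Rightarrow> nat" where "h0 l = d0 l"
definition h1 :: "int list \<Rightarrow> nat" where "h1 l = d0 l + d1 l"

datatype in_arrow = BL | BB | RL | RB
datatype out_arrow = BU | BR | RU | RR

text \<open>Arguments: \<open>lam = \<Lambda>(i-1, j-1)\<close>, \<open>nu = \<Lambda>(i, j-1)\<close>, \<open>mu = \<Lambda>(i-1, j)\<close>, \<open>rho = \<Lambda>(i, j)\<close>.\<close>

definition entering :: "int list \<Rightarrow> int list \<Rightarrow> int list \<Rightarrow> in_arrow set" where
  "entering lam nu mu = {x.
     x = BL \<and> h0 mu \<noteq> h0 lam \<or> x = RL \<and> h1 mu \<noteq> h1 lam \<or>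
     x = BB \<and> h0 nu \<noteq> h0 lam \<or> x = RB \<and> h1 nu \<noteq> h1 lam}"

definition exiting :: "int list \<Rightarrow> int list \<Rightarrow> int list \<Rightarrow> out_arrow set" where
  "exiting nu mu rho = {x.
     x = BU \<and> h0 rho \<noteq> h0 mu \<or> x = RU \<and> h1 rho \<noteq> h1 mu \<or>
     x = BR \<and> h0 rho \<noteq> h0 nu \<or> x = RR \<and> h1 rho \<noteq> h1 nu}"

definition lookup_prob :: "('a \<times> real) list \<Rightarrow> 'a \<Rightarrow> real" where
  "lookup_prob ps X = (case map_of ps X of None \<Rightarrow> 0 | Some p \<Rightarrow> p)"

text \<open>\<open>vertex_prob t x k E X\<close>, with \<open>x = a b\<close>, is the probability that \<open>X\<close> is the set of exiting
  arrows when \<open>E\<close> is the set of entering arrows.\<close>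

definition vertex_prob :: "real \<Rightarrow> real \<Rightarrow> nat \<Rightarrow> in_arrow set \<Rightarrow> out_arrow set \<Rightarrow> real" where
  "vertex_prob t x k E = lookup_prob (
    if E = {} then [({}, 1)]
    else if E = {BL, BB} then [({BU, BR}, 1)]
    else if E = {RL, RB} then [({RU, RR}, 1)]
    else if E = {BL, BB, RL, RB} then [({BU, BR, RU, RR}, 1)]
    else if E = {BL} then
      [({BR}, (1 - x) / (1 - t * x)), ({BU}, (1 - t) * x / (1 - t * x))]
    else if E = {RL} then
      [({RR}, (1 - x) / (1 - t * x)), ({RU}, (1 - t) * x / (1 - t * x))]
    else if E = {BL, RL, RB} then
      [({BR, RU, RR}, (1 - x) / (1 - t * x)), ({BU, RU, RR}, (1 - t) * x / (1 - t * x))]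
    else if E = {BL, BB, RL} then
      [({BU, BR, RR}, (1 - x) / (1 - t * x)), ({BU, BR, RU}, (1 - t) * x / (1 - t * x))]
    else if E = {BB} then
      [({BU}, t * (1 - x) / (1 - t * x)), ({BR}, (1 - t) / (1 - t * x))]
    else if E = {RB} then
      [({RU}, t * (1 - x) / (1 - t * x)), ({RR}, (1 - t) / (1 - t * x))]
    else if E = {BB, RL, RB} then
      [({BU, RU, RR}, t * (1 - x) / (1 - t * x)), ({BR, RU, RR}, (1 - t) / (1 - t * x))]
    else if E = {BL, BB, RB} then
      [({BU, BR, RU}, t * (1 - x) / (1 - t * x)), ({BU, BR, RR}, (1 - t) / (1 - t * x))]
    else if E = {BB, RB} then
      [({BU, RU}, t * (1 - x) / (1 - t * x)), ({BR, RR}, (1 - t) / (1 - t * x))]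
    else if E = {BB, RL} then
      [({BU, RR}, t * (1 - x) / (1 - t * x)), ({BR, RU}, (1 - t) / (1 - t * x))]
    else if E = {BL, RB} then
      [({BR, RR}, (1 - x) / (1 - t * x) * ((1 - t) / (1 - t ^ k))),
       ({BR, RU}, (1 - x) / (1 - t * x) * ((t - t ^ k) / (1 - t ^ k))),
       ({BU, RR}, (1 - t) * x / (1 - t * x))]
    else \<comment> \<open>\<open>E = {BL, RL}\<close>\<close>
      [({BR, RR}, (1 - x) / (1 - t * x)),
       ({BU, RR}, (1 - t) * x * (1 - x) / (1 - t * x)),
       ({BU, RU}, (1 - t) * x ^ 2 / (1 - t * x))])"

end

theory Submission
  imports Defs
begin

text \<open>
All coordinates are nonnegative, so \<open>h0\<close> and \<open>h1\<close> count the coordinates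
that are at most 0 and at most 1. Signatures are therefore studied through the function \<open>below
l\<close> with \<open>below l k\<close> the number of coordinates at most \<open>k\<close>. Moving a
particle at position \<open>k\<close> lowers \<open>below\<close> at \<open>k\<close> by one and
changes nothing else. Two interlacing signatures of equal length thus differ by a set of positions,
and an arrow is present or absent according to whether 0 or 1 is in such a set.

A growth diagram is a system of lines: in each column a line runs upwards, in each row a line runs
to the right, and every edge is labelled by the position that it moves. Lines with different labels
cross. Lines of equal label \<open>k\<close> that meet either both stay at \<open>k\<close>
(zero-box) or are both bumped to \<open>k + 1\<close> (one-box). Given the labels on the bottom and
on the left side, the diagram is coded by the set \<open>S\<close> of its one-boxes. The weights of
the two possibilities at a meeting add up to one, so the product of all weights is the probability
of \<open>S\<close> when the boxes are decided one after another from the south-west to the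
north-east. The corners determine the code (\<open>growth_unique\<close>), and hence the weight
\<open>hlU\<close> is the law of the north-east corner (\<open>hlU_eq_sum\<close>).

Which lines of label \<open>k\<close> leave through the top depends only on which lines of label
\<open>k\<close> enter, on whether there is a bump at \<open>k - 1\<close>, and on whether two lines
stay at \<open>k\<close> (\<open>top_iff_stay\<close>, \<open>top_iff_bump\<close>,
\<open>top_if_bottom_only\<close>). If all coordinates exceed 1, there are no arrows. Otherwise,
only the auxiliary particle is ever found below position 0, and an input \<open>d\<close> causes
exactly \<open>d\<close> bumps from \<open>- 1\<close> to 0. A bump into a label excludes a stay at
this label, and the remaining alternatives have weight 0, so a positive input settles everything
that happens at the positions 0 and 1. For \<open>d = 0\<close> at most one meeting is undecided,
the one of the two lines with the smallest label that occurs both on the bottom and on the left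
side, and its chance to stay is known in advance (\<open>first_weight\<close>). This yields the law
of the exiting arrows for a given input (\<open>exit_sum\<close>). It depends on \<open>d\<close>
only through the alternatives \<open>d = 0\<close>, \<open>d = 1\<close>, \<open>d \<ge> 2\<close>,
and averaging over these gives the table of transition probabilities
(\<open>vertex_prob_average\<close>).

For the random field, the joint probability of an initial part and of the inputs is the probability
of the inputs times weights that do not involve later inputs (\<open>past_inputs\<close>). So the
input of a cell is independent of the earlier signatures (\<open>past_indep_input\<close>), and
conditionally on these and on the inputs the cell has the law \<open>hlU_input\<close>, because the
other cells of its antidiagonal contribute total mass one (\<open>atom_law\<close>). The pair
\<open>(d0, d1)\<close> is a function of the exiting arrows and of its value at the upper left
corner, which makes it Markovian.
\<close>

section \<open>Signatures through their counting functions\<close>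

text \<open>A move changes this function at one place only, and interlacing is a pointwise bound on it.\<close>

definition below :: "int list \<Rightarrow> int \<Rightarrow> nat" where
  "below l k = length (filter (\<lambda>x. x \<le> k) l)"

lemma below_mono: "k \<le> k' \<Longrightarrow> below l k \<le> below l k'"
  unfolding below_def by (induction l) auto

lemma below_pred: "below l k = below l (k - 1) + count_list l k"
  unfolding below_def by (induction l) auto

lemma mem_iff_below: "k \<in> set l \<longleftrightarrow> below l (k - 1) < below l k"
  using below_pred[of l k] count_list_0_iff[of l k] by linarith

lemma below_append: "below (l @ l') k = below l k + below l' k"
  by (simp add: below_def)

lemma below_mset: "below l k = size (filter_mset (\<lambda>x. x \<le> k) (mset l))"
  by (simp add: below_def flip: mset_filter)

text \<open>The coordinates that are at most \<open>k\<close> occupy the last places of the list, so their number tells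
where they begin.\<close>

lemma nth_le_iff_below:
  assumes "l \<in> Sig N" "i < N"
  shows "l ! i \<le> k \<longleftrightarrow> N \<le> i + below l k"
proof -
  have len: "length l = N" and srt: "sorted_wrt (\<ge>) l"
    using assms by (auto simp: Sig_def)
  have split: "below l k = below (take i l) k + below (drop i l) k"
    using below_append[of "take i l" "drop i l" k] by simp
  show ?thesis
  proof
    assume le: "l ! i \<le> k"
    have "\<forall>x \<in> set (drop i l). x \<le> k"
    proof
      fix x assume "x \<in> set (drop i l)"
      then obtain p where "p < length (drop i l)" "x = drop i l ! p"
        by (auto simp: in_set_conv_nth)
      then have p: "x = l ! (i + p)" "i + p < N" using len by auto
      then have "x \<le> l ! i"
        using srt len by (cases "p = 0") (auto simp: sorted_wrt_iff_nth_less)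
      then show "x \<le> k" using le by simp
    qed
    then have "below (drop i l) k = N - i"
      unfolding below_def using len by (simp add: filter_True)
    then show "N \<le> i + below l k" using split by simp
  next
    assume ge: "N \<le> i + below l k"
    show "l ! i \<le> k"
    proof (rule ccontr)
      assume gt: "\<not> l ! i \<le> k"
      have "\<forall>x \<in> set (take (Suc i) l). \<not> x \<le> k"
      proof
        fix x assume "x \<in> set (take (Suc i) l)"
        then obtain p where "p < length (take (Suc i) l)" "x = take (Suc i) l ! p"
          by (auto simp: in_set_conv_nth)
        then have "x = l ! p" "p \<le> i" by auto
        then have "x \<ge> l ! i"
          using srt len assms(2) by (cases "p = i") (auto simp: sorted_wrt_iff_nth_less)
        then show "\<not> x \<le> k" using gt by simp
      qed
      then have "below (take (Suc i) l) k = 0"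
        unfolding below_def by (simp add: filter_empty_conv)
      moreover have "below (drop (Suc i) l) k \<le> N - Suc i"
        unfolding below_def using len by (metis length_drop length_filter_le)
      moreover have "below l k = below (take (Suc i) l) k + below (drop (Suc i) l) k"
        using below_append[of "take (Suc i) l" "drop (Suc i) l" k] by simp
      ultimately show False using ge assms(2) by linarith
    qed
  qed
qed

lemma Sig_eqI:
  assumes "l \<in> Sig N" "l' \<in> Sig N" "\<And>k. below l k = below l' k"
  shows "l = l'"
proof (rule nth_equalityI)
  show "length l = length l'" using assms by (simp add: Sig_def)
  fix i assume "i < length l"
  then have "i < N" using assms by (simp add: Sig_def)
  then have "\<And>k. l ! i \<le> k \<longleftrightarrow> l' ! i \<le> k"
    using nth_le_iff_below assms by metis
  then show "l ! i = l' ! i" by (meson order_antisym order_refl)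
qed

lemma moves_below:
  assumes "moves k l l'"
  shows "below l x = below l' x + of_bool (x = k)"
proof -
  have "mset l = add_mset k (mset l - {#k#})" "mset l' = add_mset (k + 1) (mset l - {#k#})"
    using assms by (auto simp: moves_def)
  then have "filter_mset (\<lambda>y. y \<le> x) (mset l) = filter_mset (\<lambda>y. y \<le> x) (add_mset k (mset l - {#k#}))"
    "filter_mset (\<lambda>y. y \<le> x) (mset l') = filter_mset (\<lambda>y. y \<le> x) (add_mset (k + 1) (mset l - {#k#}))"
    by metis+
  then show ?thesis unfolding below_mset by (auto simp del: filter_diff_mset)
qed

definition move_up :: "int \<Rightarrow> int list \<Rightarrow> int list" where
  "move_up k l = rev (sorted_list_of_multiset (add_mset (k + 1) (mset l - {#k#})))"

lemma mset_move_up: "mset (move_up k l) = add_mset (k + 1) (mset l - {#k#})"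
  by (simp add: move_up_def)

lemma moves_move_up: "k \<in> set l \<Longrightarrow> moves k l (move_up k l)"
  by (simp add: moves_def mset_move_up)

lemma move_up_Sig:
  assumes "l \<in> Sig N" "k \<in> set l"
  shows "move_up k l \<in> Sig N"
proof -
  have "size (mset (move_up k l)) = length l"
    unfolding mset_move_up using assms
    by (simp add: size_Diff_singleton_if) (metis Suc_pred length_pos_if_in_set)
  moreover have "sorted_wrt (\<ge>) (move_up k l)"
    using sorted_sorted_list_of_multiset by (metis move_up_def sorted_wrt_rev rev_rev_ident)
  ultimately show ?thesis using assms by (simp add: Sig_def)
qed

lemma below_move_up: "k \<in> set l \<Longrightarrow> below l x = below (move_up k l) x + of_bool (x = k)"
  by (rule moves_below) (rule moves_move_up)

text \<open>That a particle is available at \<open>k\<close> follows from the counts, since those of \<open>l'\<close> are monotone.\<close>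

lemma moves_iff_below:
  assumes "l \<in> Sig N" "l' \<in> Sig N"
  shows "moves k l l' \<longleftrightarrow> (\<forall>x. below l x = below l' x + of_bool (x = k))"
proof
  assume "moves k l l'" then show "\<forall>x. below l x = below l' x + of_bool (x = k)"
    using moves_below by blast
next
  assume *: "\<forall>x. below l x = below l' x + of_bool (x = k)"
  have "below l (k - 1) < below l k"
    using *[rule_format, of "k - 1"] *[rule_format, of k] below_mono[of "k - 1" k l'] by simp
  then have k: "k \<in> set l" by (simp add: mem_iff_below)
  have "l' = move_up k l"
    by (rule Sig_eqI[of _ N]) (use assms * k move_up_Sig below_move_up[OF k] in auto)
  then show "moves k l l'" using moves_move_up[OF k] by simp
qed

lemma moves_unique: "moves k l l' \<Longrightarrow> moves k' l l' \<Longrightarrow> k' = k"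
  using moves_below[of k l l' k] moves_below[of k' l l' k] by (auto simp: of_bool_def split: if_splits)

lemma the_moves: "moves k l l' \<Longrightarrow> (THE k. moves k l l') = k"
  using moves_unique by blast

lemma moves_mem: "moves k l l' \<Longrightarrow> k \<in> set l"
  by (simp add: moves_def)

lemma moves_sum_list: "moves k l l' \<Longrightarrow> sum_list l' = sum_list l + 1"
proof -
  assume m: "moves k l l'"
  then have "mset l = add_mset k (mset l - {#k#})" by (simp add: moves_def)
  then have "sum_mset (mset l) = k + sum_mset (mset l - {#k#})"
    by (metis sum_mset.add_mset)
  moreover have "sum_mset (mset l') = k + 1 + sum_mset (mset l - {#k#})"
    using m by (simp add: moves_def)
  ultimately show ?thesis by (simp add: sum_mset_sum_list)
qed

text \<open>Read through \<open>nth_le_iff_below\<close>, the lower bounds \<open>l ! i \<le> l' ! i\<close> and the upper bounds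
\<open>l' ! Suc i \<le> l ! i\<close> become one bound on the counts each.\<close>

lemma interlaces_iff_below:
  assumes "l \<in> Sig N" "l' \<in> Sig N"
  shows "l \<prec>s l' \<longleftrightarrow> (\<forall>k. below l' k \<le> below l k \<and> below l k \<le> below l' k + 1)"
proof
  have len: "length l = N" "length l' = N" using assms by (auto simp: Sig_def)
  have lt: "below l k \<le> N" "below l' k \<le> N" for k
    using len length_filter_le by (auto simp: below_def) (metis length_filter_le)+
  {
    assume il: "l \<prec>s l'"
    show "\<forall>k. below l' k \<le> below l k \<and> below l k \<le> below l' k + 1"
    proof (intro allI conjI)
      fix k
      show "below l' k \<le> below l k"
      proof (cases "below l' k = 0")
        case False
        define i where "i = N - below l' k"
        have i: "i < N" "N \<le> i + below l' k" using False lt[of k] by (auto simp: i_def)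
        then have "l' ! i \<le> k" using nth_le_iff_below[OF assms(2)] by simp
        then have "l ! i \<le> k" using il i len by (force simp: interlaces_def)
        then show ?thesis using nth_le_iff_below[OF assms(1) i(1)] lt[of k] i_def by simp
      qed simp
      show "below l k \<le> below l' k + 1"
      proof (cases "below l k \<le> 1")
        case False
        define i where "i = N - below l k"
        have i: "Suc i < N" "N \<le> i + below l k" using False lt[of k] by (auto simp: i_def)
        then have "l ! i \<le> k" using nth_le_iff_below[OF assms(1), of i k] by simp
        then have "l' ! Suc i \<le> k" using il i len by (force simp: interlaces_def)
        then show ?thesis using nth_le_iff_below[OF assms(2) i(1)] lt[of k] i_def by simp
      qed simp
    qed
  next
    assume *: "\<forall>k. below l' k \<le> below l k \<and> below l k \<le> below l' k + 1"
    show "l \<prec>s l'"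
      unfolding interlaces_def
    proof (intro conjI allI impI)
      fix i assume i: "i < length l"
      have "N \<le> i + below l' (l' ! i)" using nth_le_iff_below[OF assms(2), of i "l' ! i"] i len by simp
      then have "N \<le> i + below l (l' ! i)" using * by (meson add_left_mono le_trans)
      then show "l ! i \<le> l' ! i" using nth_le_iff_below[OF assms(1)] i len by simp
    next
      fix i assume i: "Suc i < length l'"
      have "N \<le> i + below l (l ! i)" using nth_le_iff_below[OF assms(1), of i "l ! i"] i len by simp
      also have "\<dots> \<le> Suc i + below l' (l ! i)" using *[rule_format, of "l ! i"] by simp
      finally show "l' ! Suc i \<le> l ! i" using nth_le_iff_below[OF assms(2)] i len by simp
    qed (simp add: len)
  }
qed

section \<open>Lines and their meetings\<close>

text \<open>The labels of a growth diagram without its signatures: \<open>H i j\<close> belongs to the edge from \<open>(i, j)\<close>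
to the right, \<open>V i j\<close> to the edge upwards. Fixing \<open>i\<close> in \<open>H\<close> gives the successive labels of the
line in column \<open>i\<close>, fixing \<open>j\<close> in \<open>V\<close> those of the line in row \<open>j\<close>. The assumptions are symmetric
in the two directions, so that each fact has a transposed version.\<close>

locale label_array =
  fixes m n :: nat and H V :: "nat \<Rightarrow> nat \<Rightarrow> int"
  assumes H_step: "Suc i < m \<Longrightarrow> j \<le> n \<Longrightarrow> H i j < H (Suc i) j"
    and V_step: "i \<le> m \<Longrightarrow> Suc j < n \<Longrightarrow> V i j < V i (Suc j)"
    and pass: "i < m \<Longrightarrow> j < n \<Longrightarrow> H i j \<noteq> V i j \<Longrightarrow> H i (Suc j) = H i j \<and> V (Suc i) j = V i j"
    and meet: "i < m \<Longrightarrow> j < n \<Longrightarrow> H i j = V i j \<Longrightarrow>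
      H i (Suc j) = V (Suc i) j \<and> H i (Suc j) \<in> {H i j, H i j + 1}"
begin

definition stays :: "nat \<Rightarrow> nat \<Rightarrow> int \<Rightarrow> bool" where
  "stays i j k \<longleftrightarrow> i < m \<and> j < n \<and> H i j = k \<and> V i j = k \<and> H i (Suc j) = k \<and> V (Suc i) j = k"

definition bumps :: "nat \<Rightarrow> nat \<Rightarrow> int \<Rightarrow> bool" where
  "bumps i j k \<longleftrightarrow> i < m \<and> j < n \<and> H i j = k \<and> V i j = k \<and>
     H i (Suc j) = k + 1 \<and> V (Suc i) j = k + 1"

abbreviation "bottom \<equiv> (\<lambda>i. H i 0) ` {..<m}"
abbreviation "top_row \<equiv> (\<lambda>i. H i n) ` {..<m}"
abbreviation "left_col \<equiv> (\<lambda>j. V 0 j) ` {..<n}"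

lemma not_bottom: "k \<notin> bottom \<Longrightarrow> i < m \<Longrightarrow> H i 0 \<noteq> k"
  by blast

lemma not_left_col: "k \<notin> left_col \<Longrightarrow> j < n \<Longrightarrow> V 0 j \<noteq> k"
  by blast

lemma transpose: "label_array n m (\<lambda>i j. V j i) (\<lambda>i j. H j i)"
  by unfold_locales (metis H_step V_step pass meet insert_iff singletonD)+

lemma stays_transpose:
  "label_array.stays n m (\<lambda>i j. V j i) (\<lambda>i j. H j i) j i k \<longleftrightarrow> stays i j k"
  unfolding stays_def label_array.stays_def[OF transpose] by auto

lemma bumps_transpose:
  "label_array.bumps n m (\<lambda>i j. V j i) (\<lambda>i j. H j i) j i k \<longleftrightarrow> bumps i j k"
  unfolding bumps_def label_array.bumps_def[OF transpose] by auto

lemma meet_cases: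
  assumes "i < m" "j < n" "H i j = V i j"
  shows "stays i j (H i j) \<or> bumps i j (H i j)"
  using meet[OF assms] assms by (auto simp: stays_def bumps_def)

lemma H_strict: "i < i' \<Longrightarrow> i' < m \<Longrightarrow> j \<le> n \<Longrightarrow> H i j < H i' j"
proof (induction i')
  case (Suc i')
  then show ?case using H_step[of i' j] by (cases "i = i'") auto
qed simp

lemma H_up: "i < m \<Longrightarrow> j < n \<Longrightarrow> H i j \<le> H i (Suc j) \<and> H i (Suc j) \<le> H i j + 1"
  using pass[of i j] meet[of i j] by (cases "H i j = V i j") auto

lemma H_mono: "i < m \<Longrightarrow> j \<le> j' \<Longrightarrow> j' \<le> n \<Longrightarrow> H i j \<le> H i j'"
proof (induction j')
  case (Suc j')
  then show ?case using H_up[of i j'] by (cases "j = Suc j'") auto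
qed simp

lemmas V_strict = label_array.H_strict[OF transpose]
lemmas V_mono = label_array.H_mono[OF transpose]

text \<open>Labels of a line grow by unit steps, so they cannot get past \<open>k\<close> without a bump at \<open>k\<close>.\<close>

lemma H_crossing:
  assumes "i < m" "j' \<le> n" "H i j \<le> k" "k < H i j'" "j \<le> j'"
  shows "\<exists>p. j \<le> p \<and> p < j' \<and> bumps i p k"
  using assms
proof (induction j')
  case (Suc j')
  show ?case
  proof (cases "k < H i j'")
    case True
    then show ?thesis using Suc by (cases "j = Suc j'") force+
  next
    case False
    have j: "j \<le> j'" using Suc.prems by (cases "j = Suc j'") auto
    have "H i j' = k" "H i (Suc j') = k + 1"
      using False Suc.prems H_up[of i j'] by auto
    moreover from this have "H i j' = V i j'" using pass[of i j'] Suc.prems by auto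
    ultimately have "bumps i j' k" using meet[of i j'] Suc.prems by (auto simp: bumps_def)
    then show ?thesis using j by auto
  qed
qed simp

lemma V_crossing:
  assumes "j < n" "i' \<le> m" "V i j \<le> k" "k < V i' j" "i \<le> i'"
  shows "\<exists>p. i \<le> p \<and> p < i' \<and> bumps p j k"
  using label_array.H_crossing[OF transpose assms] by (simp add: bumps_transpose)

text \<open>After a stay at \<open>k\<close> the rows further up have labels above \<open>k\<close> in this column, and there is nothing
that could bump the line.\<close>

lemma stays_no_later_crossing:
  assumes "stays i j k" "j < j'" "j' \<le> n"
  shows "H i j' = k"
proof (rule ccontr)
  assume "H i j' \<noteq> k"
  then have "k < H i j'" using assms H_mono[of i "Suc j" j'] by (force simp: stays_def)
  then obtain p where "Suc j \<le> p" "p < j'" "bumps i p k"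
    using H_crossing[of i j' "Suc j" k] assms by (auto simp: stays_def)
  then show False using assms V_strict[of j p i] by (auto simp: stays_def bumps_def)
qed

lemma stays_not_bumps_right:
  assumes "stays i j k" "bumps i' j' k" "i' < i" shows False
proof (cases "j' < j")
  case True
  then show False using assms H_mono[of i' "Suc j'" j] H_strict[of i' i j]
    by (auto simp: stays_def bumps_def)
next
  case False
  then show False
    using assms H_strict[of i' i j] H_strict[of i' i j'] stays_no_later_crossing[of i j k j']
    by (cases "j = j'") (auto simp: stays_def bumps_def)
qed

text \<open>By strict monotonicity a bump at the label of a stay could only be north-west or south-east of it.
There one of the two staying lines would have to be bumped after all.\<close>

lemma stays_not_bumps:
  assumes "stays i j k" "bumps i' j' k" shows False
proof -
  consider "i' < i" | "j' < j" | "i' = i" "j' = j" | "i' > i" "j' \<ge> j" | "i' = i" "j' > j"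
    by linarith
  then show False
  proof cases
    case 1 then show ?thesis using stays_not_bumps_right assms by blast
  next
    case 2 then show ?thesis
      using label_array.stays_not_bumps_right[OF transpose, of j i k j' i'] assms
      by (simp add: stays_transpose bumps_transpose)
  next
    case 3 then show ?thesis using assms by (auto simp: stays_def bumps_def)
  next
    case 4 then show ?thesis using assms H_mono[of i' j j'] H_strict[of i i' j]
      by (auto simp: stays_def bumps_def)
  next
    case 5 then show ?thesis using assms V_strict[of j j' i]
      by (auto simp: stays_def bumps_def)
  qed
qed

lemma stays_not_bumps_below_right:
  assumes "stays i j k" "bumps i' j' (k - 1)" "i' < i" shows False
proof (cases "j' < j")
  case True
  then show False using assms H_mono[of i' "Suc j'" j] H_strict[of i' i j]
    by (auto simp: stays_def bumps_def)
next
  case False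
  then show False
    using assms H_strict[of i' i "Suc j'"] stays_no_later_crossing[of i j k "Suc j'"]
    by (auto simp: stays_def bumps_def)
qed

text \<open>A bump at \<open>k - 1\<close> creates a horizontal and a vertical line of label \<open>k\<close>, which strict monotonicity
forbids next to the two lines that stay.\<close>

lemma stays_not_bumps_below:
  assumes "stays i j k" "bumps i' j' (k - 1)" shows False
proof -
  consider "i' < i" | "j' < j" | "i' \<ge> i" "j' \<ge> j"
    by linarith
  then show False
  proof cases
    case 1 then show ?thesis using stays_not_bumps_below_right assms by blast
  next
    case 2 then show ?thesis
      using label_array.stays_not_bumps_below_right[OF transpose, of j i k j' i'] assms
      by (simp add: stays_transpose bumps_transpose)
  next
    case 3 then show ?thesis
      using assms H_mono[of i' j j'] H_strict[of i i' j] by (cases "i = i'") (auto simp: stays_def bumps_def)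
  qed
qed

lemma stays_boundary:
  assumes "stays i j k"
  shows "H i 0 = k" "H i n = k" "V 0 j = k" "V m j = k"
proof -
  show "H i n = k" using stays_no_later_crossing[of i j k n] assms by (auto simp: stays_def)
  show "V m j = k" using label_array.stays_no_later_crossing[OF transpose, of j i k m] assms
    by (auto simp: stays_def stays_transpose)
  show "H i 0 = k"
  proof (rule ccontr)
    assume "H i 0 \<noteq> k"
    then have "H i 0 \<le> k - 1" using assms H_mono[of i 0 j] by (auto simp: stays_def)
    then show False
      using H_crossing[of i j 0 "k - 1"] stays_not_bumps_below[OF assms] assms by (auto simp: stays_def)
  qed
  show "V 0 j = k"
  proof (rule ccontr)
    assume "V 0 j \<noteq> k"
    then have "V 0 j \<le> k - 1" using assms V_mono[of j 0 i] by (auto simp: stays_def)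
    then show False
      using V_crossing[of j i 0 "k - 1"] stays_not_bumps_below[OF assms] assms by (auto simp: stays_def)
  qed
qed

text \<open>In the row that starts with label \<open>k\<close>, the line that leaves at \<open>k\<close> has this label already: to be
raised to \<open>k\<close> there or later it would have to meet a line of label \<open>k - 1\<close>, but these rows start with
labels at least \<open>k\<close>. So two lines of label \<open>k\<close> meet, and they are not bumped because one of them
leaves with label \<open>k\<close>.\<close>

lemma stays_if_left_top:
  assumes "k \<in> left_col" "k \<in> top_row"
  shows "\<exists>i j. stays i j k"
proof -
  obtain j i where j: "j < n" "V 0 j = k" and i: "i < m" "H i n = k"
    using assms by auto
  have Hk: "H i j = k"
  proof (rule ccontr)
    assume "H i j \<noteq> k"
    then have "H i j \<le> k - 1" using H_mono[of i j n] i j by auto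
    then obtain p where p: "j \<le> p" "p < n" "bumps i p (k - 1)"
      using H_crossing[of i n j "k - 1"] i j by auto
    have "V i p \<ge> V 0 p" using V_mono[of p 0 i] p i by auto
    moreover have "V 0 p \<ge> V 0 j" using V_strict[of j p 0] p by (cases "p = j") auto
    ultimately show False using p j by (auto simp: bumps_def)
  qed
  have Vk: "V i j = k"
  proof (rule ccontr)
    assume "V i j \<noteq> k"
    then have "k < V i j" using V_mono[of j 0 i] i j by auto
    then obtain p where "p < i" "bumps p j k"
      using V_crossing[of j i 0 k] i j by auto
    then show False using H_strict[of p i j] Hk i j by (auto simp: bumps_def)
  qed
  have "H i (Suc j) \<le> k" using H_mono[of i "Suc j" n] i j by auto
  then show ?thesis using meet_cases[of i j] i j Hk Vk by (auto simp: bumps_def)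
qed

text \<open>In the leftmost column where a bump produces label \<open>k\<close>, the line keeps this label: a second bump
would need a vertical line of label \<open>k\<close>, and this would have been produced still further left.\<close>

lemma top_if_bumps_below:
  assumes "k \<notin> left_col" "bumps i0 j0 (k - 1)"
  shows "k \<in> top_row"
proof -
  \<comment> \<open>The leftmost column with a bump at \<open>k - 1\<close>.\<close>
  define P where "P = (\<lambda>i. \<exists>j. bumps i j (k - 1))"
  define i where "i = (LEAST i. P i)"
  have "P i0" using assms by (auto simp: P_def)
  then have "P i" unfolding i_def by (rule LeastI)
  then obtain j where j: "bumps i j (k - 1)" by (auto simp: P_def)
  have "H i n = k"
  proof (rule ccontr)
    assume "H i n \<noteq> k"
    then have "k < H i n" using H_mono[of i "Suc j" n] j by (auto simp: bumps_def)
    then obtain p where p: "Suc j \<le> p" "p < n" "bumps i p k"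
      using H_crossing[of i n "Suc j" k] j by (auto simp: bumps_def)
    have "V 0 p \<noteq> k" using assms(1) p(2) by (rule not_left_col)
    moreover have "V 0 p \<le> k" using V_mono[of p 0 i] p by (auto simp: bumps_def)
    ultimately have "V 0 p \<le> k - 1" by simp
    then obtain q where "q < i" "bumps q p (k - 1)"
      using V_crossing[of p i 0 "k - 1"] p by (auto simp: bumps_def)
    then show False using not_less_Least[of q P] by (auto simp: i_def P_def)
  qed
  then show ?thesis using j by (auto simp: bumps_def)
qed

lemma bumps_below_if_top:
  assumes "k \<notin> bottom" "k \<in> top_row"
  shows "\<exists>i j. bumps i j (k - 1)"
proof -
  obtain i where i: "i < m" "H i n = k" using assms by auto
  have "H i 0 \<noteq> k" using assms(1) i(1) by (rule not_bottom)
  then have "H i 0 \<le> k - 1" using H_mono[of i 0 n] i by auto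
  then show ?thesis using H_crossing[of i n 0 "k - 1"] i by auto
qed

text \<open>The bumps at \<open>k\<close> are the only way in which the number of lines with label at most \<open>k\<close> decreases.\<close>

lemma ex_bumps_iff_card:
  "(\<exists>i j. bumps i j k) \<longleftrightarrow> card {x \<in> bottom. x \<le> k} \<noteq> card {x \<in> top_row. x \<le> k}"
proof -
  have inj: "inj_on (\<lambda>i. H i j) {..<m}" if "j \<le> n" for j
    by (rule inj_onI) (metis H_strict lessThan_iff less_irrefl linorder_neqE_nat that)
  have eq: "card {x \<in> (\<lambda>i. H i j) ` {..<m}. x \<le> k} = card {i. i < m \<and> H i j \<le> k}" if "j \<le> n" for j
  proof -
    have "{x \<in> (\<lambda>i. H i j) ` {..<m}. x \<le> k} = (\<lambda>i. H i j) ` {i. i < m \<and> H i j \<le> k}" by auto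
    then show ?thesis using inj[OF that] by (auto simp: card_image inj_on_def)
  qed
  have sub: "{i. i < m \<and> H i n \<le> k} \<subseteq> {i. i < m \<and> H i 0 \<le> k}"
    using H_mono[of _ 0 n] order_trans by fastforce
  have fin: "finite {i. i < m \<and> H i 0 \<le> k}" by simp
  have iff: "(\<exists>i j. bumps i j k) \<longleftrightarrow> {i. i < m \<and> H i n \<le> k} \<noteq> {i. i < m \<and> H i 0 \<le> k}"
  proof
    assume "\<exists>i j. bumps i j k"
    then obtain i j where b: "bumps i j k" by auto
    then have "H i 0 \<le> k" "k < H i n" "i < m"
      using H_mono[of i 0 j] H_mono[of i "Suc j" n] by (auto simp: bumps_def)
    then have "i \<in> {i. i < m \<and> H i 0 \<le> k}" "i \<notin> {i. i < m \<and> H i n \<le> k}" by auto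
    then show "{i. i < m \<and> H i n \<le> k} \<noteq> {i. i < m \<and> H i 0 \<le> k}" by blast
  next
    assume "{i. i < m \<and> H i n \<le> k} \<noteq> {i. i < m \<and> H i 0 \<le> k}"
    then obtain i where "i < m" "H i 0 \<le> k" "k < H i n" using sub by force
    then show "\<exists>i j. bumps i j k" using H_crossing[of i n 0 k] by auto
  qed
  have card_eq: "card A = card B \<longleftrightarrow> A = B" if "A \<subseteq> B" "finite B" for A B :: "nat set"
    using card_subset_eq[OF that(2,1)] by blast
  show ?thesis
    unfolding eq[OF le0] eq[OF order_refl] iff using card_eq[OF sub fin] by argo
qed

text \<open>Both lines of label \<open>k - 1\<close> that leave stem from bumps at \<open>k - 2\<close>, since none enters. They are the
neighbours of the staying lines, and one box must have produced them both.\<close>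

lemma stays_above_bumps:
  assumes st: "stays i j k" and b: "bumps i0 j0 (k - 2)"
    and nb: "k - 1 \<notin> bottom" and nl: "k - 1 \<notin> left_col"
  shows "0 < i \<and> 0 < j \<and> H (i - 1) j = k - 1 \<and> V i (j - 1) = k - 1 \<and> bumps (i - 1) (j - 1) (k - 2)"
proof -
  have b1: "bumps i0 j0 (k - 1 - 1)" using b by (simp add: algebra_simps)
  obtain p where p: "p < m" "H p n = k - 1"
    using top_if_bumps_below[OF nl b1] by auto
  obtain q where q: "q < n" "V m q = k - 1"
    using label_array.top_if_bumps_below[OF transpose nb, of j0 i0] b1
    by (auto simp: bumps_transpose)
  have ij: "i < m" "j < n" "H i j = k" "V i j = k" using st by (auto simp: stays_def)
  have sb: "H i n = k" "V m j = k" using stays_boundary[OF st] by auto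
  have "p < i" using p ij sb H_strict[of i p n] by (cases "p = i"; cases "p < i") auto
  moreover have "\<not> Suc p < i" using H_strict[of p "Suc p" n] H_strict[of "Suc p" i n] p ij sb by auto
  ultimately have pi: "i = Suc p" by simp
  have "q < j" using q ij sb V_strict[of j q m] by (cases "q = j"; cases "q < j") auto
  moreover have "\<not> Suc q < j" using V_strict[of q "Suc q" m] V_strict[of "Suc q" j m] q ij sb by auto
  ultimately have qj: "j = Suc q" by simp
  have "H p 0 \<noteq> k - 1" using nb p(1) by (rule not_bottom)
  then have "H p 0 \<le> k - 2" using H_mono[of p 0 n] p by auto
  then obtain j' where j': "j' < n" "bumps p j' (k - 2)" using H_crossing[of p n 0 "k - 2"] p by auto
  have "V 0 q \<noteq> k - 1" using nl q(1) by (rule not_left_col)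
  then have "V 0 q \<le> k - 2" using V_mono[of q 0 m] q by auto
  then obtain i' where i': "i' < m" "bumps i' q (k - 2)" using V_crossing[of q m 0 "k - 2"] q by auto
  have "V i j' = k - 1" using j' pi by (simp add: bumps_def)
  then have jj: "j' < j" using ij V_strict[of j j' i] j' by (cases "j' = j"; cases "j' < j") auto
  have "H i' j = k - 1" using i' qj by (simp add: bumps_def)
  then have ii: "i' < i" using ij H_strict[of i i' j] i' by (cases "i' = i"; cases "i' < i") auto
  have hp: "H p j = k - 1"
    using H_mono[of p "Suc j'" j] H_mono[of p j n] jj j' p ij by (auto simp: bumps_def)
  have "i' = p"
  proof (rule ccontr)
    assume "i' \<noteq> p"
    then have "i' < p" using ii pi by simp
    then show False using H_strict[of i' p j] p ij hp \<open>H i' j = k - 1\<close> by auto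
  qed
  then have "bumps p q (k - 2)" using i' by simp
  then show ?thesis using pi qj hp by (auto simp: bumps_def)
qed

text \<open>No line passes \<open>k\<close>, so the lines bumped at \<open>k + 1\<close> enter with this label. They are therefore the
direct neighbours of the lines that stay at \<open>k\<close>.\<close>

lemma bumps_above_stays:
  assumes st: "stays i j k" and b: "bumps i' j' (k + 1)"
  shows "i' = Suc i \<and> j' = Suc j"
proof -
  have nb: "\<not> bumps p q k" for p q using stays_not_bumps[OF st] by blast
  have ij: "i < m" "j < n" and ij': "i' < m" "j' < n" "H i' j' = k + 1" "V i' j' = k + 1"
    using st b by (auto simp: stays_def bumps_def)
  have sb: "H i 0 = k" "V 0 j = k" using stays_boundary[OF st] by auto
  have "H i' 0 = k + 1"
    using H_crossing[of i' j' 0 k] H_mono[of i' 0 j'] nb ij' by force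
  then have "i < i'" using sb H_strict[of i' i 0] ij by (cases "i = i'"; cases "i < i'") auto
  moreover have "\<not> Suc i < i'"
    using H_strict[of i "Suc i" 0] H_strict[of "Suc i" i' 0] \<open>H i' 0 = k + 1\<close> sb ij' by auto
  moreover have "V 0 j' = k + 1"
    using V_crossing[of j' i' 0 k] V_mono[of j' 0 i'] nb ij' by force
  then have "j < j'" using sb V_strict[of j' j 0] ij by (cases "j = j'"; cases "j < j'") auto
  moreover have "\<not> Suc j < j'"
    using V_strict[of j "Suc j" 0] V_strict[of "Suc j" j' 0] \<open>V 0 j' = k + 1\<close> sb ij' by auto
  ultimately show ?thesis by simp
qed

end

section \<open>Strips as sequences of moves\<close>

text \<open>The columns of the horizontal strip between two partitions, shifted by one: a particle at \<open>k\<close> adds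
a box in column \<open>k + 1\<close>.\<close>

definition strip_cols :: "int list \<Rightarrow> int list \<Rightarrow> int set" where
  "strip_cols l l' = {k. below l' k \<noteq> below l k}"

definition strip_col :: "int list \<Rightarrow> int list \<Rightarrow> nat \<Rightarrow> int" where
  "strip_col l l' i = sorted_list_of_set (strip_cols l l') ! i"

primrec move_seq :: "int list \<Rightarrow> (nat \<Rightarrow> int) \<Rightarrow> nat \<Rightarrow> int list" where
  "move_seq l ks 0 = l"
| "move_seq l ks (Suc i) = move_up (ks i) (move_seq l ks i)"

lemma below_Sig_extreme:
  assumes "l \<in> Sig N"
  shows "\<exists>a b. (\<forall>k<a. below l k = 0) \<and> (\<forall>k\<ge>b. below l k = N)"
proof -
  define a b where "a = Min (set l)" and "b = Max (set l)"
  then have a: "x \<in> set l \<Longrightarrow> a \<le> x" and b: "x \<in> set l \<Longrightarrow> x \<le> b" for x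
    by simp_all
  have "below l k = 0" if "k < a" for k
    using a that unfolding below_def by (force simp: filter_empty_conv)
  moreover have "below l k = N" if "k \<ge> b" for k
  proof -
    have "filter (\<lambda>x. x \<le> k) l = l" using b that by (force simp: filter_id_conv)
    then show ?thesis using assms by (simp add: below_def Sig_def)
  qed
  ultimately show ?thesis by blast
qed

lemma finite_strip_cols:
  assumes "l \<in> Sig N" "l' \<in> Sig N"
  shows "finite (strip_cols l l')"
proof -
  obtain a b where ab: "\<forall>k<a. below l k = 0" "\<forall>k\<ge>b. below l k = N"
    using below_Sig_extreme[OF assms(1)] by blast
  obtain a' b' where ab': "\<forall>k<a'. below l' k = 0" "\<forall>k\<ge>b'. below l' k = N"
    using below_Sig_extreme[OF assms(2)] by blast
  have "strip_cols l l' \<subseteq> {min a a'..max b b'}"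
  proof
    fix k assume "k \<in> strip_cols l l'"
    then have "\<not> (k < a \<and> k < a')" "\<not> (k \<ge> b \<and> k \<ge> b')" using ab ab' by (auto simp: strip_cols_def)
    then show "k \<in> {min a a'..max b b'}" by (auto simp: min_def max_def)
  qed
  then show ?thesis using finite_subset by blast
qed

lemma below_strip:
  assumes "l \<in> Sig N" "l' \<in> Sig N" "l \<prec>s l'"
  shows "below l k = below l' k + of_bool (k \<in> strip_cols l l')"
  using interlaces_iff_below[OF assms(1,2)] assms(3) unfolding strip_cols_def
  by (auto simp: of_bool_def) (metis Suc_eq_plus1 le_SucE le_antisym)

lemma strip_col_less:
  assumes "finite (strip_cols l l')" "i < j" "j < card (strip_cols l l')"
  shows "strip_col l l' i < strip_col l l' j"
  using assms strict_sorted_list_of_set[of "strip_cols l l'"]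
  by (simp add: strip_col_def sorted_wrt_nth_less)

lemma strip_col_image:
  assumes "finite (strip_cols l l')"
  shows "strip_col l l' ` {..<card (strip_cols l l')} = strip_cols l l'"
proof -
  have "strip_col l l' ` {..<card (strip_cols l l')} = set (sorted_list_of_set (strip_cols l l'))"
    by (auto simp: strip_col_def set_conv_nth)
  then show ?thesis using assms by simp
qed

lemma of_bool_image_Suc:
  assumes "g i \<notin> g ` {..<i}"
  shows "of_bool (x \<in> g ` {..<Suc i}) = of_bool (x \<in> g ` {..<i}) + (of_bool (x = g i) :: nat)"
proof (cases "x = g i")
  case True
  then show ?thesis using assms by (simp add: lessThan_Suc)
qed (simp add: lessThan_Suc)

text \<open>Moving the particles from left to right never fails. When position \<open>k\<close> is due, the count at
\<open>k - 1\<close> has reached its final value, which is at most the final value at \<open>k\<close>, and hence is smaller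
than the present count at \<open>k\<close>.\<close>

lemma strip_path:
  assumes l: "l \<in> Sig N" "l' \<in> Sig N" "l \<prec>s l'"
  defines "ks \<equiv> strip_col l l'" and "c \<equiv> card (strip_cols l l')"
  shows "i \<le> c \<Longrightarrow> move_seq l ks i \<in> Sig N"
    and "i \<le> c \<Longrightarrow> below l x = below (move_seq l ks i) x + of_bool (x \<in> ks ` {..<i})"
    and "i < c \<Longrightarrow> moves (ks i) (move_seq l ks i) (move_seq l ks (Suc i))"
    and "move_seq l ks c = l'"
proof -
  have fin: "finite (strip_cols l l')" using finite_strip_cols l by blast
  have img: "ks ` {..<c} = strip_cols l l'" using strip_col_image[OF fin] by (simp add: ks_def c_def)
  have less: "ks i < ks j" if "i < j" "j < c" for i j
    using strip_col_less[OF fin] that by (simp add: ks_def c_def)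
  have main: "move_seq l ks i \<in> Sig N \<and>
      (\<forall>x. below l x = below (move_seq l ks i) x + of_bool (x \<in> ks ` {..<i}))" if "i \<le> c" for i
    using that
  proof (induction i)
    case (Suc i)
    then have IH: "move_seq l ks i \<in> Sig N"
      "\<And>x. below l x = below (move_seq l ks i) x + of_bool (x \<in> ks ` {..<i})" by auto
    have mem: "ks i \<in> set (move_seq l ks i)"
    proof -
      let ?k = "ks i"
      have k: "?k \<in> strip_cols l l'" using img Suc.prems by (metis Suc_le_lessD imageI lessThan_iff)
      have "?k \<notin> ks ` {..<i}" using less Suc.prems by fastforce
      then have "below (move_seq l ks i) ?k = below l ?k" using IH(2)[of ?k] by simp
      also have "\<dots> = below l' ?k + 1" using below_strip[OF l, of ?k] k by simp
      finally have 1: "below (move_seq l ks i) ?k = below l' ?k + 1" .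
      have "?k - 1 \<in> ks ` {..<i}" if kk: "?k - 1 \<in> strip_cols l l'"
      proof -
        obtain p where p: "p < c" "ks p = ?k - 1" using kk unfolding img[symmetric] by auto
        then have "p < i" using less[of i p] Suc.prems by (cases "p = i"; cases "p < i") auto
        then have "ks p \<in> ks ` {..<i}" by auto
        then show ?thesis using p(2) by simp
      qed
      then have "below (move_seq l ks i) (?k - 1) \<le> below l' (?k - 1)"
        using below_strip[OF l, of "?k - 1"] IH(2)[of "?k - 1"] by (auto simp: of_bool_def split: if_splits)
      then have "below (move_seq l ks i) (?k - 1) < below (move_seq l ks i) ?k"
        using 1 below_mono[of "?k - 1" ?k l'] by simp
      then show ?thesis by (simp add: mem_iff_below)
    qed
    have "ks i \<notin> ks ` {..<i}" using less Suc.prems by fastforce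
    then have "below l x = below (move_seq l ks (Suc i)) x + of_bool (x \<in> ks ` {..<Suc i})" for x
      using IH(2)[of x] below_move_up[OF mem, of x] of_bool_image_Suc[of ks i x] by simp
    then show ?case using move_up_Sig[OF IH(1) mem] by simp
  qed (use l in simp)
  show 1: "move_seq l ks i \<in> Sig N"
    and 2: "below l x = below (move_seq l ks i) x + of_bool (x \<in> ks ` {..<i})" if "i \<le> c" for i x
    using main[OF that] by blast+
  show "moves (ks i) (move_seq l ks i) (move_seq l ks (Suc i))" if "i < c" for i
  proof -
    have "ks i \<notin> ks ` {..<i}" using less that by fastforce
    then have "below (move_seq l ks i) x = below (move_seq l ks (Suc i)) x + of_bool (x = ks i)" for x
      using 2[of i x] 2[of "Suc i" x] that of_bool_image_Suc[of ks i x] by linarith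
    then show ?thesis using moves_iff_below 1[of i] 1[of "Suc i"] that by simp
  qed
  show "move_seq l ks c = l'"
    by (rule Sig_eqI[of _ N]) (use 1[of c] l 2[of c] below_strip[OF l] img in auto)
qed

lemma strip_path_sum:
  assumes l: "l \<in> Sig N" "l' \<in> Sig N" "l \<prec>s l'"
  shows "sum_list l' - sum_list l = int (card (strip_cols l l'))"
proof -
  have "sum_list (move_seq l (strip_col l l') i) = sum_list l + int i" if "i \<le> card (strip_cols l l')" for i
    using that
  proof (induction i)
    case (Suc i)
    then show ?case using moves_sum_list[OF strip_path(3)[OF l, of i]] by simp
  qed simp
  from this[OF order_refl] show ?thesis using strip_path(4)[OF l] by simp
qed

text \<open>The positions are distinct and each move lowers the count at its position only, so they are exactly
the places where the counts of the two ends differ.\<close>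

lemma move_seq_unique:
  assumes sig: "\<And>i. i \<le> c \<Longrightarrow> p i \<in> Sig N"
    and mv: "\<And>i. i < c \<Longrightarrow> moves (g i) (p i) (p (Suc i))"
    and inc: "\<And>i. Suc i < c \<Longrightarrow> g i < g (Suc i)"
  shows "p 0 \<prec>s p c" "g ` {..<c} = strip_cols (p 0) (p c)" "card (strip_cols (p 0) (p c)) = c"
    "i < c \<Longrightarrow> strip_col (p 0) (p c) i = g i"
    "i \<le> c \<Longrightarrow> p i = move_seq (p 0) g i"
proof -
  have less: "i < j \<Longrightarrow> j < c \<Longrightarrow> g i < g j" for i j
  proof (induction j)
    case (Suc j)
    then show ?case using inc[of j] by (cases "i = j") auto
  qed simp
  have bel: "below (p 0) x = below (p i) x + of_bool (x \<in> g ` {..<i})" if "i \<le> c" for i x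
    using that
  proof (induction i)
    case (Suc i)
    have "g i \<notin> g ` {..<i}" using less Suc.prems by fastforce
    then show ?case using Suc moves_below[OF mv[of i], of x] of_bool_image_Suc[of g i x] by simp
  qed simp
  show "p 0 \<prec>s p c"
    using interlaces_iff_below[OF sig[of 0] sig[of c]] bel[of c] by (auto simp: of_bool_def)
  show img: "g ` {..<c} = strip_cols (p 0) (p c)"
    unfolding strip_cols_def using bel[of c] by (auto simp: of_bool_def split: if_splits)
  have srt: "sorted_wrt (<) (map g [0..<c])"
    by (auto simp: sorted_wrt_iff_nth_less less)
  have lst: "sorted_list_of_set (strip_cols (p 0) (p c)) = map g [0..<c]"
    unfolding img[symmetric] using srt
    by (metis atLeast_upt image_set sorted_list_of_set.idem_if_sorted_distinct strict_sorted_iff)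
  then show "card (strip_cols (p 0) (p c)) = c"
    by (metis length_map length_sorted_list_of_set length_upt diff_zero)
  show "i < c \<Longrightarrow> strip_col (p 0) (p c) i = g i"
    using lst by (simp add: strip_col_def)
  show "i \<le> c \<Longrightarrow> p i = move_seq (p 0) g i"
  proof (induction i)
    case (Suc i)
    have m: "moves (g i) (p i) (p (Suc i))" by (rule mv) (use Suc.prems in simp)
    have e: "p i = move_seq (p 0) g i" using Suc by simp
    have "p (Suc i) = move_up (g i) (p i)"
      by (rule Sig_eqI[of _ N])
        (use sig[of i] sig[of "Suc i"] Suc.prems move_up_Sig moves_mem[OF m] below_move_up[OF moves_mem[OF m]]
          moves_below[OF m] in auto)
    then show ?case using e by simp
  qed simp
qed

text \<open>The labels that arise from \<open>hs\<close> on the bottom and \<open>vs\<close> on the left side if \<open>S\<close> is the set of boxes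
at which meeting lines are bumped.\<close>

function line_h :: "(nat \<Rightarrow> int) \<Rightarrow> (nat \<Rightarrow> int) \<Rightarrow> (nat \<times> nat) set \<Rightarrow> nat \<Rightarrow> nat \<Rightarrow> int"
  and line_v :: "(nat \<Rightarrow> int) \<Rightarrow> (nat \<Rightarrow> int) \<Rightarrow> (nat \<times> nat) set \<Rightarrow> nat \<Rightarrow> nat \<Rightarrow> int" where
  "line_h hs vs S i 0 = hs i"
| "line_h hs vs S i (Suc j) = line_h hs vs S i j +
     of_bool (line_h hs vs S i j = line_v hs vs S i j \<and> (i, j) \<in> S)"
| "line_v hs vs S 0 j = vs j"
| "line_v hs vs S (Suc i) j = line_v hs vs S i j +
     of_bool (line_h hs vs S i j = line_v hs vs S i j \<and> (i, j) \<in> S)"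
  by pat_completeness auto
termination
  by (relation "Wellfounded.measure (\<lambda>x. case x of Inl (_, _, _, i, j) \<Rightarrow> i + j | Inr (_, _, _, i, j) \<Rightarrow> i + j)") auto

text \<open>One path is chosen to each vertex, along the bottom and then upwards. For codes that occur, all
paths lead to the same signature.\<close>

primrec diagram :: "(nat \<Rightarrow> int) \<Rightarrow> (nat \<Rightarrow> int) \<Rightarrow> int list \<Rightarrow> (nat \<times> nat) set \<Rightarrow> nat \<Rightarrow> nat \<Rightarrow> int list" where
  "diagram hs vs l S i 0 = move_seq l hs i"
| "diagram hs vs l S i (Suc j) = move_up (line_v hs vs S i j) (diagram hs vs l S i j)"

text \<open>The weight of the box as a zero-box, \<open>l\<close> being the signature at its south-west corner. As a one-box
it has the complementary weight, so this is the probability that two meeting lines keep their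
label. Lines that do not meet count as staying. After a bump directly to the left or below, staying
would produce equal labels on neighbouring edges, whence the 0.\<close>

definition stay_prob ::
  "real \<Rightarrow> (nat \<Rightarrow> nat \<Rightarrow> int) \<Rightarrow> (nat \<Rightarrow> nat \<Rightarrow> int) \<Rightarrow> (nat \<times> nat) set \<Rightarrow> int list \<Rightarrow> nat \<Rightarrow> nat \<Rightarrow> real" where
  "stay_prob t H V S l i j =
    (let k = H i j;
         h_adj = (0 < i \<and> H (i - 1) j = k - 1);
         v_adj = (0 < j \<and> V i (j - 1) = k - 1)
     in if H i j \<noteq> V i j then 1
        else if 0 < i \<and> (i - 1, j) \<in> S \<or> 0 < j \<and> (i, j - 1) \<in> S then 0
        else if h_adj \<and> v_adj then (if (i - 1, j - 1) \<in> S then 0 else 1)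
        else if h_adj \<or> v_adj then t
        else (t - t ^ count_list l k) / (1 - t ^ count_list l k))"

definition choice_weight ::
  "real \<Rightarrow> (nat \<Rightarrow> int) \<Rightarrow> (nat \<Rightarrow> int) \<Rightarrow> int list \<Rightarrow> (nat \<times> nat) set \<Rightarrow> nat \<times> nat \<Rightarrow> real" where
  "choice_weight t hs vs l S = (\<lambda>(i, j).
     let q = stay_prob t (line_h hs vs S) (line_v hs vs S) S (diagram hs vs l S i j) i j
     in if (i, j) \<in> S then 1 - q else q)"

lemma lines_cong:
  assumes "\<And>i' j'. i' + j' < i + j \<Longrightarrow> (i', j') \<in> S \<longleftrightarrow> (i', j') \<in> S'"
  shows "line_h hs vs S i j = line_h hs vs S' i j" "line_v hs vs S i j = line_v hs vs S' i j"
proof -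
  have "line_h hs vs S i j = line_h hs vs S' i j \<and> line_v hs vs S i j = line_v hs vs S' i j"
    using assms
  proof (induction "i + j" arbitrary: i j rule: less_induct)
    case less
    have h: "line_h hs vs S i j = line_h hs vs S' i j"
    proof (cases j)
      case (Suc j')
      then show ?thesis using less.hyps[of i j'] less.prems[of i j'] less.prems by simp
    qed simp
    have "line_v hs vs S i j = line_v hs vs S' i j"
    proof (cases i)
      case (Suc i')
      then show ?thesis using less.hyps[of i' j] less.prems[of i' j] less.prems by simp
    qed simp
    then show ?case using h by simp
  qed
  then show "line_h hs vs S i j = line_h hs vs S' i j" "line_v hs vs S i j = line_v hs vs S' i j" by auto
qed

lemma diagram_cong:
  assumes "\<And>i' j'. i' + j' < i + j \<Longrightarrow> (i', j') \<in> S \<longleftrightarrow> (i', j') \<in> S'"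
  shows "diagram hs vs l S i j = diagram hs vs l S' i j"
  using assms
proof (induction j)
  case (Suc j)
  then show ?case using lines_cong[of i j S S' hs vs] by simp
qed simp

lemma stay_prob_cong:
  assumes "\<And>i' j'. i' + j' < i + j \<Longrightarrow> (i', j') \<in> S \<longleftrightarrow> (i', j') \<in> S'"
  shows "stay_prob t (line_h hs vs S) (line_v hs vs S) S (diagram hs vs l S i j) i j =
    stay_prob t (line_h hs vs S') (line_v hs vs S') S' (diagram hs vs l S' i j) i j"
proof -
  have "line_h hs vs S (i - 1) j = line_h hs vs S' (i - 1) j" if "0 < i"
    by (rule lines_cong) (use assms that in auto)
  moreover have "line_v hs vs S i (j - 1) = line_v hs vs S' i (j - 1)" if "0 < j"
    by (rule lines_cong) (use assms that in auto)
  ultimately show ?thesis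
    using lines_cong[of i j S S' hs vs, OF assms] diagram_cong[of i j S S' hs vs l, OF assms]
      assms[of "i - 1" j] assms[of i "j - 1"] assms[of "i - 1" "j - 1"]
    unfolding stay_prob_def Let_def by (cases "0 < i"; cases "0 < j") simp_all
qed

section \<open>Growth diagrams and their codes\<close>

text \<open>One growth problem with the corners \<open>lam\<close>, \<open>nu\<close>, \<open>mu\<close>. For a code \<open>S\<close>, the labels \<open>Hl S\<close> and
\<open>Vl S\<close>, the signatures \<open>Dg S\<close> and the box weights \<open>cw S\<close> are those reconstructed from \<open>S\<close>.\<close>

locale growth_data =
  fixes t :: real and N :: nat and lam mu nu :: "int list"
  assumes t0: "0 \<le> t" and t1: "t < 1"
    and sigs: "lam \<in> Sig N" "mu \<in> Sig N" "nu \<in> Sig N"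
    and strips: "lam \<prec>s mu" "lam \<prec>s nu"
begin

abbreviation "hcols \<equiv> strip_cols lam nu"
abbreviation "vcols \<equiv> strip_cols lam mu"
abbreviation "hcol \<equiv> strip_col lam nu"
abbreviation "vcol \<equiv> strip_col lam mu"
definition "m = card hcols"
definition "n = card vcols"
abbreviation "boxes \<equiv> {..<m} \<times> {..<n}"
abbreviation "Hl \<equiv> line_h hcol vcol"
abbreviation "Vl \<equiv> line_v hcol vcol"
abbreviation "Dg \<equiv> diagram hcol vcol lam"
abbreviation "target S \<equiv> Dg S m n"
abbreviation "cw \<equiv> choice_weight t hcol vcol lam"
definition "weight S = (\<Prod>p\<in>boxes. cw S p)"
abbreviation "growth \<equiv> growth_diagram m n lam mu nu"
definition "ones L = {(i, j). i < m \<and> j < n \<and> one_box L i j}"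

lemma length_lam: "length lam = N"
  using sigs by (simp add: Sig_def)

lemma growth_Sig: "growth rho L \<Longrightarrow> i \<le> m \<Longrightarrow> j \<le> n \<Longrightarrow> L i j \<in> Sig N"
  unfolding growth_diagram_def length_lam by blast

lemma growth_hmoves:
  assumes "growth rho L" "i < m" "j \<le> n"
  shows "moves (hpos L i j) (L i j) (L (Suc i) j)"
proof -
  obtain k where "moves k (L i j) (L (Suc i) j)" using assms unfolding growth_diagram_def by blast
  then show ?thesis using the_moves unfolding hpos_def by metis
qed

lemma growth_vmoves:
  assumes "growth rho L" "i \<le> m" "j < n"
  shows "moves (vpos L i j) (L i j) (L i (Suc j))"
proof -
  obtain k where "moves k (L i j) (L i (Suc j))" using assms unfolding growth_diagram_def by blast
  then show ?thesis using the_moves unfolding vpos_def by metis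
qed

text \<open>The two ways around a box lead to the same signature, so they move the same multiset of positions.\<close>

lemma growth_label_array:
  assumes g: "growth rho L"
  shows "label_array m n (hpos L) (vpos L)"
proof
  show "hpos L i j < hpos L (Suc i) j" if "Suc i < m" "j \<le> n" for i j
    using g that unfolding growth_diagram_def by blast
  show "vpos L i j < vpos L i (Suc j)" if "i \<le> m" "Suc j < n" for i j
    using g that unfolding growth_diagram_def by blast
  fix i j assume ij: "i < m" "j < n"
  have eq: "of_bool (x = hpos L i j) + of_bool (x = vpos L (Suc i) j) =
      of_bool (x = vpos L i j) + (of_bool (x = hpos L i (Suc j)) :: nat)" for x
    using moves_below[OF growth_hmoves[OF g, of i j], of x] moves_below[OF growth_vmoves[OF g, of "Suc i" j], of x]
      moves_below[OF growth_hmoves[OF g, of i "Suc j"], of x] moves_below[OF growth_vmoves[OF g, of i j], of x] ij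
    by simp
  show "hpos L i (Suc j) = hpos L i j \<and> vpos L (Suc i) j = vpos L i j" if "hpos L i j \<noteq> vpos L i j"
    using eq[of "hpos L i j"] eq[of "vpos L i j"] that by (auto simp: of_bool_def split: if_splits)
  show "hpos L i (Suc j) = vpos L (Suc i) j \<and> hpos L i (Suc j) \<in> {hpos L i j, hpos L i j + 1}"
    if "hpos L i j = vpos L i j"
    using g that ij unfolding growth_diagram_def by blast
qed

lemma growth_bottom:
  assumes g: "growth rho L"
  shows "i < m \<Longrightarrow> hpos L i 0 = hcol i"
    and "i \<le> m \<Longrightarrow> L i 0 = move_seq lam hcol i"
    and "(\<lambda>i. hpos L i 0) ` {..<m} = hcols"
proof -
  interpret label_array m n "hpos L" "vpos L" using growth_label_array[OF g] .
  have c: "L 0 0 = lam" "L m 0 = nu" using g by (auto simp: growth_diagram_def)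
  note u = move_seq_unique[of m "\<lambda>i. L i 0" N "\<lambda>i. hpos L i 0", unfolded c,
    OF growth_Sig[OF g _ le0] growth_hmoves[OF g _ le0] H_step[OF _ le0]]
  show a: "i < m \<Longrightarrow> hpos L i 0 = hcol i" for i using u(4)[of i] by simp
  show "(\<lambda>i. hpos L i 0) ` {..<m} = hcols" using u(2) by simp
  have "i \<le> m \<Longrightarrow> move_seq lam (\<lambda>i. hpos L i 0) i = move_seq lam hcol i" for i
    using a by (induction i) auto
  then show "i \<le> m \<Longrightarrow> L i 0 = move_seq lam hcol i" using u(5)[of i] by simp
qed

lemma growth_left:
  assumes g: "growth rho L"
  shows "j < n \<Longrightarrow> vpos L 0 j = vcol j"
    and "(\<lambda>j. vpos L 0 j) ` {..<n} = vcols"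
proof -
  interpret label_array m n "hpos L" "vpos L" using growth_label_array[OF g] .
  have c: "L 0 0 = lam" "L 0 n = mu" using g by (auto simp: growth_diagram_def)
  note u = move_seq_unique[of n "\<lambda>j. L 0 j" N "\<lambda>j. vpos L 0 j", unfolded c,
    OF growth_Sig[OF g le0] growth_vmoves[OF g le0] V_step[OF le0]]
  show a: "j < n \<Longrightarrow> vpos L 0 j = vcol j" for j using u(4)[of j] by simp
  show "(\<lambda>j. vpos L 0 j) ` {..<n} = vcols" using u(2) by simp
qed

lemma growth_top:
  assumes g: "growth rho L"
  shows "mu \<prec>s rho" "(\<lambda>i. hpos L i n) ` {..<m} = strip_cols mu rho" "rho \<in> Sig N"
proof -
  interpret label_array m n "hpos L" "vpos L" using growth_label_array[OF g] .
  have c: "L 0 n = mu" "L m n = rho" using g by (auto simp: growth_diagram_def)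
  note u = move_seq_unique[of m "\<lambda>i. L i n" N "\<lambda>i. hpos L i n", unfolded c,
    OF growth_Sig[OF g _ order_refl] growth_hmoves[OF g _ order_refl] H_step[OF _ order_refl]]
  show "mu \<prec>s rho" "(\<lambda>i. hpos L i n) ` {..<m} = strip_cols mu rho" using u(1,2) by simp_all
  show "rho \<in> Sig N" using growth_Sig[OF g, of m n] c by simp
qed

lemma growth_right:
  assumes g: "growth rho L"
  shows "nu \<prec>s rho" "(\<lambda>j. vpos L m j) ` {..<n} = strip_cols nu rho"
proof -
  interpret label_array m n "hpos L" "vpos L" using growth_label_array[OF g] .
  have c: "L m 0 = nu" "L m n = rho" using g by (auto simp: growth_diagram_def)
  note u = move_seq_unique[of n "\<lambda>j. L m j" N "\<lambda>j. vpos L m j", unfolded c,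
    OF growth_Sig[OF g order_refl] growth_vmoves[OF g order_refl] V_step[OF order_refl]]
  show "nu \<prec>s rho" "(\<lambda>j. vpos L m j) ` {..<n} = strip_cols nu rho" using u(1,2) by simp_all
qed

lemma growth_sum:
  assumes g: "growth rho L"
  shows "sum_list nu - sum_list lam = sum_list rho - sum_list mu"
proof -
  have "sum_list (L i j) = sum_list (L 0 j) + int i" if "i \<le> m" "j \<le> n" for i j
    using that
  proof (induction i)
    case (Suc i)
    then show ?case using moves_sum_list[OF growth_hmoves[OF g, of i j]] by simp
  qed simp
  from this[of m 0] this[of m n] show ?thesis using g by (simp add: growth_diagram_def)
qed

lemma growth_bumps_iff:
  assumes g: "growth rho L" and "i < m" "j < n"
  shows "one_box L i j \<longleftrightarrow> label_array.bumps m n (hpos L) (vpos L) i j (hpos L i j)"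
    and "zero_box L i j \<longleftrightarrow> label_array.stays m n (hpos L) (vpos L) i j (hpos L i j)"
proof -
  interpret label_array m n "hpos L" "vpos L" using growth_label_array[OF g] .
  show "one_box L i j \<longleftrightarrow> bumps i j (hpos L i j)" "zero_box L i j \<longleftrightarrow> stays i j (hpos L i j)"
    using assms unfolding one_box_def zero_box_def bumps_def stays_def by auto
qed

lemma growth_lines:
  assumes g: "growth rho L"
  shows "i < m \<Longrightarrow> j \<le> n \<Longrightarrow> Hl (ones L) i j = hpos L i j"
    and "i \<le> m \<Longrightarrow> j < n \<Longrightarrow> Vl (ones L) i j = vpos L i j"
proof -
  interpret label_array m n "hpos L" "vpos L" using growth_label_array[OF g] .
  have "(i < m \<longrightarrow> j \<le> n \<longrightarrow> Hl (ones L) i j = hpos L i j) \<and>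
    (i \<le> m \<longrightarrow> j < n \<longrightarrow> Vl (ones L) i j = vpos L i j)" for i j
  proof (induction "i + j" arbitrary: i j rule: less_induct)
    case less
    have "Hl (ones L) i j = hpos L i j" if "i < m" "j \<le> n"
    proof (cases j)
      case 0 then show ?thesis using growth_bottom(1)[OF g] that by simp
    next
      case (Suc j')
      have "Hl (ones L) i j' = hpos L i j'" "Vl (ones L) i j' = vpos L i j'"
        using less[of i j'] Suc that by auto
      moreover have "(i, j') \<in> ones L \<longleftrightarrow> bumps i j' (hpos L i j')"
        using growth_bumps_iff(1)[OF g, of i j'] Suc that by (simp add: ones_def)
      moreover have "hpos L i (Suc j') = hpos L i j' + of_bool (hpos L i j' = vpos L i j' \<and>
          bumps i j' (hpos L i j'))"
        using pass[of i j'] meet_cases[of i j'] Suc that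
        by (cases "hpos L i j' = vpos L i j'") (auto simp: bumps_def stays_def)
      ultimately show ?thesis using Suc by simp
    qed
    moreover have "Vl (ones L) i j = vpos L i j" if "i \<le> m" "j < n"
    proof (cases i)
      case 0 then show ?thesis using growth_left(1)[OF g] that by simp
    next
      case (Suc i')
      have "Hl (ones L) i' j = hpos L i' j" "Vl (ones L) i' j = vpos L i' j"
        using less[of i' j] Suc that by auto
      moreover have "(i', j) \<in> ones L \<longleftrightarrow> bumps i' j (hpos L i' j)"
        using growth_bumps_iff(1)[OF g, of i' j] Suc that by (simp add: ones_def)
      moreover have "vpos L (Suc i') j = vpos L i' j + of_bool (hpos L i' j = vpos L i' j \<and>
          bumps i' j (hpos L i' j))"
        using pass[of i' j] meet_cases[of i' j] Suc that
        by (cases "hpos L i' j = vpos L i' j") (auto simp: bumps_def stays_def)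
      ultimately show ?thesis using Suc by simp
    qed
    ultimately show ?case by blast
  qed
  then show "i < m \<Longrightarrow> j \<le> n \<Longrightarrow> Hl (ones L) i j = hpos L i j"
    and "i \<le> m \<Longrightarrow> j < n \<Longrightarrow> Vl (ones L) i j = vpos L i j" by blast+
qed

lemma moves_move_up_eq:
  assumes "moves k l l'" "l \<in> Sig N" "l' \<in> Sig N"
  shows "l' = move_up k l"
  by (rule Sig_eqI[of _ N])
    (use assms move_up_Sig moves_mem[OF assms(1)] below_move_up[OF moves_mem[OF assms(1)]]
      moves_below[OF assms(1)] in auto)

lemma growth_diagram_eq:
  assumes g: "growth rho L"
  shows "i \<le> m \<Longrightarrow> j \<le> n \<Longrightarrow> Dg (ones L) i j = L i j"
proof (induction j)
  case 0
  then show ?case using growth_bottom(2)[OF g] by simp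
next
  case (Suc j)
  then have "Dg (ones L) i j = L i j" "Vl (ones L) i j = vpos L i j"
    using growth_lines(2)[OF g] by auto
  moreover have "L i (Suc j) = move_up (vpos L i j) (L i j)"
    by (rule moves_move_up_eq) (use Suc.prems growth_vmoves[OF g] growth_Sig[OF g] in auto)
  ultimately show ?case by simp
qed

text \<open>A bump in the box to the left or below takes up the label that a stay would keep.\<close>

lemma growth_one_box_forced:
  assumes g: "growth rho L" and ij: "i < m" "j < n" and eq: "hpos L i j = vpos L i j"
  shows "0 < i \<Longrightarrow> one_box L (i - 1) j \<Longrightarrow> one_box L i j"
    and "0 < j \<Longrightarrow> one_box L i (j - 1) \<Longrightarrow> one_box L i j"
proof -
  interpret label_array m n "hpos L" "vpos L" using growth_label_array[OF g] .
  show "one_box L i j" if "0 < i" "one_box L (i - 1) j"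
  proof -
    have "bumps (i - 1) j (hpos L (i - 1) j)" using growth_bumps_iff(1)[OF g, of "i - 1" j] that ij by simp
    then have "hpos L (i - 1) (Suc j) = vpos L i j" using that by (auto simp: bumps_def)
    moreover have "hpos L (i - 1) (Suc j) < hpos L i (Suc j)" using H_strict[of "i - 1" i "Suc j"] that ij by simp
    ultimately have "\<not> stays i j (hpos L i j)" using eq by (auto simp: stays_def)
    then show ?thesis using meet_cases[OF ij eq] growth_bumps_iff(1)[OF g ij] by simp
  qed
  show "one_box L i j" if "0 < j" "one_box L i (j - 1)"
  proof -
    have "bumps i (j - 1) (hpos L i (j - 1))" using growth_bumps_iff(1)[OF g, of i "j - 1"] that ij by simp
    then have "vpos L (Suc i) (j - 1) = hpos L i j" using that by (auto simp: bumps_def)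
    moreover have "vpos L (Suc i) (j - 1) < vpos L (Suc i) j" using V_strict[of "j - 1" j "Suc i"] that ij by simp
    ultimately have "\<not> stays i j (hpos L i j)" using eq by (auto simp: stays_def)
    then show ?thesis using meet_cases[OF ij eq] growth_bumps_iff(1)[OF g ij] by simp
  qed
qed

text \<open>The many cases of \<open>box_weight\<close> reduce to those of \<open>stay_prob\<close> for geometric reasons: a neighbour
to the left or below of a meeting is never a zero-box, and if it is no one-box either, then two
adjacent lines of label \<open>k - 1\<close> have met in the diagonal box, so that its kind decides.\<close>

lemma growth_box_weight:
  assumes g: "growth rho L" and ij: "i < m" "j < n"
  shows "box_weight t L i j =
    (let q = stay_prob t (hpos L) (vpos L) (ones L) (L i j) i j in if one_box L i j then 1 - q else q)"
proof (cases "hpos L i j = vpos L i j")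
  case False
  then show ?thesis by (simp add: box_weight_def stay_prob_def Let_def zero_box_def one_box_def)
next
  case eq: True
  interpret label_array m n "hpos L" "vpos L" using growth_label_array[OF g] .
  define k where "k = hpos L i j"
  have vk: "vpos L i j = k" using eq k_def by simp
  have ZO: "zero_box L i j \<longleftrightarrow> \<not> one_box L i j"
    using meet_cases[OF ij eq] growth_bumps_iff[OF g ij] by (auto simp: stays_def bumps_def)
  have hless: "hpos L (i - 1) j < k" if "0 < i"
    using H_strict[of "i - 1" i j] that ij k_def by simp
  have vless: "vpos L i (j - 1) < k" if "0 < j"
    using V_strict[of "j - 1" j i] that ij vk by simp
  have lz: "\<not> zero_box L (i - 1) j" if "0 < i"
    using growth_bumps_iff(2)[OF g, of "i - 1" j] hless that ij vk by (auto simp: stays_def)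
  have bz: "\<not> zero_box L i (j - 1)" if "0 < j"
    using growth_bumps_iff(2)[OF g, of i "j - 1"] vless that ij k_def by (auto simp: stays_def)
  have diag: "zero_box L (i - 1) (j - 1) \<or> one_box L (i - 1) (j - 1) \<Longrightarrow> hpos L (i - 1) j = vpos L i (j - 1)"
    if "0 < i" "0 < j"
    using growth_bumps_iff[OF g, of "i - 1" "j - 1"] that ij by (auto simp: stays_def bumps_def)
  have onesI: "(i', j') \<in> ones L \<longleftrightarrow> one_box L i' j'" if "i' \<le> i" "j' \<le> j" for i' j'
    using that ij by (simp add: ones_def)
  have diag_nontriv: "zero_box L (i - 1) (j - 1) \<longleftrightarrow> \<not> one_box L (i - 1) (j - 1)"
    if "0 < i" "0 < j" "hpos L (i - 1) j = k - 1" "vpos L i (j - 1) = k - 1"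
    proof -
    have ij': "i - 1 < m" "j - 1 < n" using that ij by auto
    have "hpos L (i - 1) (j - 1) = vpos L (i - 1) (j - 1)"
      using pass[OF ij'] that by force
    then show ?thesis
      using meet_cases[OF ij'] growth_bumps_iff[OF g ij'] by (auto simp: stays_def bumps_def)
  qed
  have c_nz: "1 - t ^ count_list (L i j) k \<noteq> 0"
  proof -
    have "k \<in> set (L i j)" using growth_hmoves[OF g, of i j] ij moves_mem k_def by auto
    then have "count_list (L i j) k \<ge> 1" using count_list_0_iff[of "L i j" k] by linarith
    then have "t ^ count_list (L i j) k \<le> t ^ 1" using power_decreasing[of 1 _ t] t0 t1 by simp
    then show ?thesis using t1 by simp
  qed
  define z where "z = zero_box L i j"
  define e where "e = one_box L i j"
  define le where "le = (0 < i \<and> one_box L (i - 1) j)"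
  define be where "be = (0 < j \<and> one_box L i (j - 1))"
  define lt where "lt = (i = 0 \<or> \<not> zero_box L (i - 1) j \<and> \<not> one_box L (i - 1) j)"
  define bt where "bt = (j = 0 \<or> \<not> zero_box L i (j - 1) \<and> \<not> one_box L i (j - 1))"
  define ha where "ha = (0 < i \<and> hpos L (i - 1) j = k - 1)"
  define va where "va = (0 < j \<and> vpos L i (j - 1) = k - 1)"
  define hf where "hf = (i = 0 \<or> hpos L (i - 1) j < k - 1)"
  define vf where "vf = (j = 0 \<or> vpos L i (j - 1) < k - 1)"
  define dz where "dz = (0 < i \<and> 0 < j \<and> zero_box L (i - 1) (j - 1) \<and> hpos L (i - 1) j = k - 1)"
  define de where "de = (0 < i \<and> 0 < j \<and> one_box L (i - 1) (j - 1) \<and> hpos L (i - 1) j = k - 1)"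
  define c where "c = t ^ count_list (L i j) k"
  note defs = z_def e_def le_def be_def lt_def bt_def ha_def va_def hf_def vf_def dz_def de_def
  have bw: "box_weight t L i j =
      (if \<not> z \<and> \<not> e then 1
       else if e \<and> (le \<or> be) then 1
       else if e \<and> de then 1
       else if z \<and> dz then 1
       else if z \<and> (ha \<noteq> va) then t
       else if e \<and> lt \<and> bt \<and> (ha \<noteq> va) then 1 - t
       else if z \<and> hf \<and> vf then (t - c) / (1 - c)
       else if e \<and> hf \<and> vf then (1 - t) / (1 - c)
       else 0)"
    unfolding box_weight_def Let_def defs c_def k_def ..
  have le: "le \<Longrightarrow> e" and be: "be \<Longrightarrow> e"
    unfolding le_def be_def e_def using growth_one_box_forced[OF g ij eq] by auto
  have ze: "z = (\<not> e)" using ZO by (simp add: z_def e_def)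
  have lt: "\<not> le \<Longrightarrow> lt" using lz by (auto simp: le_def lt_def)
  have bt: "\<not> be \<Longrightarrow> bt" using bz by (auto simp: be_def bt_def)
  have hf: "hf = (\<not> ha)" using hless unfolding hf_def ha_def by force
  have vf: "vf = (\<not> va)" using vless unfolding vf_def va_def by force
  have both: "dz = (\<not> de)" if "ha" "va"
    using that diag_nontriv unfolding ha_def va_def dz_def de_def by blast
  have nb: "\<not> dz \<and> \<not> de" if "\<not> (ha \<and> va)"
    using that diag unfolding ha_def va_def dz_def de_def by metis
  have S: "(0 < i \<and> (i - 1, j) \<in> ones L) = le" "(0 < j \<and> (i, j - 1) \<in> ones L) = be"
    using ij by (auto simp: le_def be_def ones_def)
  have D: "((i - 1, j - 1) \<in> ones L) = de" if "ha" "va"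
    using that ij by (auto simp: de_def ones_def ha_def va_def)
  have sp: "stay_prob t (hpos L) (vpos L) (ones L) (L i j) i j =
      (if le \<or> be then 0
       else if ha \<and> va then (if de then 0 else 1)
       else if ha \<or> va then t
       else (t - c) / (1 - c))"
    unfolding stay_prob_def Let_def k_def[symmetric] S ha_def[symmetric] va_def[symmetric] c_def[symmetric]
    using vk D by (cases "ha \<and> va") auto
  have frac: "1 - (t - c) / (1 - c) = (1 - t) / (1 - c)"
    using c_nz unfolding c_def by (simp add: field_simps)
  show ?thesis
    unfolding bw sp Let_def e_def[symmetric] frac[symmetric] hf vf ze
    using le be lt bt both nb by (cases e; cases le; cases be; cases ha; cases va; cases de) simp_all
qed

lemma growth_weight:
  assumes g: "growth rho L"
  shows "(\<Prod>i<m. \<Prod>j<n. box_weight t L i j) = weight (ones L)"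
proof -
  have "box_weight t L i j = cw (ones L) (i, j)" if ij: "i < m" "j < n" for i j
  proof -
    have "Hl (ones L) i j = hpos L i j" "Vl (ones L) i j = vpos L i j"
      "0 < i \<Longrightarrow> Hl (ones L) (i - 1) j = hpos L (i - 1) j"
      "0 < j \<Longrightarrow> Vl (ones L) i (j - 1) = vpos L i (j - 1)"
      "Dg (ones L) i j = L i j"
      using growth_lines[OF g] growth_diagram_eq[OF g] ij by auto
    moreover have "(i, j) \<in> ones L \<longleftrightarrow> one_box L i j" using ij by (simp add: ones_def)
    ultimately show ?thesis
      unfolding growth_box_weight[OF g ij] choice_weight_def stay_prob_def Let_def prod.case
      by (simp cong: if_cong conj_cong)
  qed
  then show ?thesis unfolding weight_def by (simp add: prod.cartesian_product)
qed

end

section \<open>Every code of nonzero weight is a growth diagram\<close>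

context growth_data
begin

definition "supported S \<longleftrightarrow> S \<subseteq> boxes \<and> weight S \<noteq> 0"

lemma supported_cw: "supported S \<Longrightarrow> i < m \<Longrightarrow> j < n \<Longrightarrow> cw S (i, j) \<noteq> 0"
  unfolding supported_def weight_def by (simp add: prod_zero_iff)

lemma supported_meets:
  assumes S: "supported S" and ij: "(i, j) \<in> S"
  shows "Hl S i j = Vl S i j"
proof (rule ccontr)
  assume "Hl S i j \<noteq> Vl S i j"
  moreover have "i < m" "j < n" using S ij by (auto simp: supported_def)
  ultimately show False using supported_cw[OF S, of i j] ij
    by (simp add: choice_weight_def stay_prob_def Let_def)
qed

lemma supported_forced:
  assumes S: "supported S" and "i < m" "j < n" "Hl S i j = Vl S i j"
    and "0 < i \<and> (i - 1, j) \<in> S \<or> 0 < j \<and> (i, j - 1) \<in> S"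
  shows "(i, j) \<in> S"
proof (rule ccontr)
  assume "(i, j) \<notin> S"
  then show False using supported_cw[OF S, of i j] assms
    by (simp add: choice_weight_def stay_prob_def Let_def)
qed

lemma Hl_step: "Hl S i j \<le> Hl S i (Suc j) \<and> Hl S i (Suc j) \<le> Hl S i j + 1"
  by (simp add: of_bool_def)

lemma Vl_step: "Vl S i j \<le> Vl S (Suc i) j \<and> Vl S (Suc i) j \<le> Vl S i j + 1"
  by (simp add: of_bool_def)

text \<open>Labels of neighbouring edges could only become equal by a bump beside a box that stays, and such a
box has weight zero.\<close>

lemma supported_label_array:
  assumes S: "supported S"
  shows "label_array m n (Hl S) (Vl S)"
proof
  show "Hl S i j < Hl S (Suc i) j" if "Suc i < m" "j \<le> n" for i j
    using that(2)
  proof (induction j)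
    case 0
    then show ?case
      using strip_col_less[of lam nu i "Suc i"] finite_strip_cols[OF sigs(1,3)] that
      by (simp add: m_def)
  next
    case (Suc j)
    then have IH: "Hl S i j < Hl S (Suc i) j" "j < n" by auto
    show ?case
    proof (cases "Hl S i (Suc j) < Hl S (Suc i) (Suc j)")
      case False
      then have eq: "Hl S i (Suc j) = Hl S i j + 1" "Hl S (Suc i) j = Hl S i j + 1"
        "Hl S (Suc i) (Suc j) = Hl S (Suc i) j"
        using IH Hl_step[of S i j] Hl_step[of S "Suc i" j] by linarith+
      then have c: "Hl S i j = Vl S i j" "(i, j) \<in> S" by (auto simp: of_bool_def split: if_splits)
      then have "Vl S (Suc i) j = Hl S (Suc i) j" using eq by simp
      then have "(Suc i, j) \<in> S"
        using supported_forced[OF S, of "Suc i" j] that(1) IH c by simp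
      then show ?thesis using eq(3) \<open>Vl S (Suc i) j = Hl S (Suc i) j\<close> by simp
    qed simp
  qed
  show "Vl S i j < Vl S i (Suc j)" if "i \<le> m" "Suc j < n" for i j
    using that(1)
  proof (induction i)
    case 0
    then show ?case
      using strip_col_less[of lam mu j "Suc j"] finite_strip_cols[OF sigs(1,2)] that
      by (simp add: n_def)
  next
    case (Suc i)
    then have IH: "Vl S i j < Vl S i (Suc j)" "i < m" by auto
    show ?case
    proof (cases "Vl S (Suc i) j < Vl S (Suc i) (Suc j)")
      case False
      then have eq: "Vl S (Suc i) j = Vl S i j + 1" "Vl S i (Suc j) = Vl S i j + 1"
        "Vl S (Suc i) (Suc j) = Vl S i (Suc j)"
        using IH Vl_step[of S i j] Vl_step[of S i "Suc j"] by linarith+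
      then have c: "Hl S i j = Vl S i j" "(i, j) \<in> S" by (auto simp: of_bool_def split: if_splits)
      then have e: "Hl S i (Suc j) = Vl S i (Suc j)" using eq by simp
      then have "(i, Suc j) \<in> S"
        using supported_forced[OF S, of i "Suc j"] that(2) IH c by simp
      then show ?thesis using eq(3) e by simp
    qed simp
  qed
qed (auto simp: of_bool_def)

lemma move_left: "Dg S 0 j = move_seq lam vcol j"
  by (induction j) auto

text \<open>The weights never ask for a missing particle. If a line of label \<open>k - 1\<close> is adjacent, it has just
brought a second particle to \<open>k\<close>. Otherwise the chance to stay is \<open>(t - t ^ c) / (1 - t ^ c)\<close> for
\<open>c\<close> particles, which vanishes for \<open>c = 1\<close>.\<close>

lemma supported_two_particles:
  assumes S: "supported S" and ij: "i < m" "j < n" "Hl S i j = k" "Vl S i j = k" "(i, j) \<notin> S"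
    and mem: "k \<in> set (Dg S i j)"
    and left: "0 < i \<Longrightarrow> moves (Hl S (i - 1) j) (Dg S (i - 1) j) (Dg S i j) \<and> Vl S (i - 1) j \<in> set (Dg S (i - 1) j)"
    and below: "0 < j \<Longrightarrow> moves (Vl S i (j - 1)) (Dg S i (j - 1)) (Dg S i j) \<and> Hl S i (j - 1) \<in> set (Dg S i (j - 1))"
  shows "below (Dg S i j) (k - 1) + 2 \<le> below (Dg S i j) k"
proof -
  have nf: "0 < i \<Longrightarrow> (i - 1, j) \<notin> S" "0 < j \<Longrightarrow> (i, j - 1) \<notin> S"
    using supported_forced[OF S, of i j] ij by auto
  consider (l) "0 < i" "Hl S (i - 1) j = k - 1" | (b) "0 < j" "Vl S i (j - 1) = k - 1"
    | (far) "\<not> (0 < i \<and> Hl S (i - 1) j = k - 1)" "\<not> (0 < j \<and> Vl S i (j - 1) = k - 1)" by blast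
  then show ?thesis
  proof cases
    case l
    then have "Vl S (i - 1) j = k" using ij(4) nf(1) by (cases i) auto
    then have "below (Dg S (i - 1) j) (k - 1) < below (Dg S (i - 1) j) k"
      using left l mem_iff_below by blast
    moreover have m: "moves (k - 1) (Dg S (i - 1) j) (Dg S i j)" using left l by simp
    ultimately show ?thesis using moves_below[OF m, of "k - 1"] moves_below[OF m, of k] by simp
  next
    case b
    then have "Hl S i (j - 1) = k" using ij(3) nf(2) by (cases j) auto
    then have "below (Dg S i (j - 1)) (k - 1) < below (Dg S i (j - 1)) k"
      using below b mem_iff_below by blast
    moreover have m: "moves (k - 1) (Dg S i (j - 1)) (Dg S i j)" using below b by simp
    ultimately show ?thesis using moves_below[OF m, of "k - 1"] moves_below[OF m, of k] by simp
  next
    case far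
    define c where "c = count_list (Dg S i j) k"
    have "(t - t ^ c) / (1 - t ^ c) \<noteq> 0"
      using supported_cw[OF S ij(1,2)] ij nf far
      unfolding choice_weight_def stay_prob_def Let_def c_def by (auto split: if_splits)
    then have "c \<noteq> 1" by auto
    moreover have "c \<noteq> 0" using mem count_list_0_iff[of "Dg S i j" k] by (simp add: c_def)
    ultimately have "2 \<le> c" by simp
    then show ?thesis using below_pred[of "Dg S i j" k] by (simp add: c_def)
  qed
qed

text \<open>By induction over the rows: the particles demanded by the lines are there, and both paths around a
box agree.\<close>

lemma supported_moves:
  assumes S: "supported S"
  shows "j \<le> n \<Longrightarrow> \<forall>j' \<le> j. (\<forall>i \<le> m. Dg S i j' \<in> Sig N) \<and>
      (\<forall>i < m. moves (Hl S i j') (Dg S i j') (Dg S (Suc i) j')) \<and>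
      (j' < j \<longrightarrow> (\<forall>i \<le> m. Vl S i j' \<in> set (Dg S i j')))"
proof (induction j)
  case 0
  show ?case using strip_path(1,3)[OF sigs(1,3) strips(2)] by (simp add: m_def)
next
  case (Suc j)
  interpret label_array m n "Hl S" "Vl S" using supported_label_array[OF S] .
  have jn: "j < n" using Suc.prems by simp
  have IHs: "Dg S i j' \<in> Sig N" if "i \<le> m" "j' \<le> j" for i j' using Suc that by auto
  have IHm: "moves (Hl S i j') (Dg S i j') (Dg S (Suc i) j')" if "i < m" "j' \<le> j" for i j' using Suc that by auto
  have IHv: "Vl S i j' \<in> set (Dg S i j')" if "i \<le> m" "j' < j" for i j' using Suc that by auto
  have vm: "Vl S i j \<in> set (Dg S i j)" if "i \<le> m" for i
    using that
  proof (induction i rule: less_induct)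
    case (less i0)
    show ?case
    proof (cases i0)
    case 0
    then show ?thesis using strip_path(3)[OF sigs(1,2) strips(1), of j] moves_mem jn
      unfolding 0 move_left by (simp add: n_def)
  next
    case (Suc i)
    then have i: "i < m" and IH: "Vl S i j \<in> set (Dg S i j)" using less by auto
    have mv: "moves (Hl S i j) (Dg S i j) (Dg S (Suc i) j)" using IHm i by simp
    consider "Hl S i j \<noteq> Vl S i j" | "Hl S i j = Vl S i j" "(i, j) \<in> S" | "Hl S i j = Vl S i j" "(i, j) \<notin> S"
      by blast
    then have "Vl S (Suc i) j \<in> set (Dg S (Suc i) j)"
    proof cases
      case 1
      then have "Vl S (Suc i) j = Vl S i j" by simp
      then show ?thesis using 1 IH moves_below[OF mv, of "Vl S i j"] moves_below[OF mv, of "Vl S i j - 1"]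
        by (auto simp: mem_iff_below)
    next
      case 2
      then have "Vl S (Suc i) j = Hl S i j + 1" by simp
      moreover have "Hl S i j + 1 \<in># mset (Dg S (Suc i) j)" using mv by (simp add: moves_def)
      ultimately show ?thesis by simp
    next
      case 3
      define k where "k = Vl S i j"
      have "below (Dg S i j) (k - 1) + 2 \<le> below (Dg S i j) k"
      proof (rule supported_two_particles[OF S i jn])
        show "moves (Hl S (i - 1) j) (Dg S (i - 1) j) (Dg S i j) \<and> Vl S (i - 1) j \<in> set (Dg S (i - 1) j)" if "0 < i"
        proof
          show "moves (Hl S (i - 1) j) (Dg S (i - 1) j) (Dg S i j)" using IHm[of "i - 1" j] i that by simp
          show "Vl S (i - 1) j \<in> set (Dg S (i - 1) j)" using less.IH[of "i - 1"] i Suc that by simp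
        qed
        show "moves (Vl S i (j - 1)) (Dg S i (j - 1)) (Dg S i j) \<and> Hl S i (j - 1) \<in> set (Dg S i (j - 1))" if "0 < j"
        proof
          have "Dg S i j = move_up (Vl S i (j - 1)) (Dg S i (j - 1))" using that by (cases j) auto
          then show "moves (Vl S i (j - 1)) (Dg S i (j - 1)) (Dg S i j)"
            using moves_move_up[OF IHv[of i "j - 1"]] i that by simp
          show "Hl S i (j - 1) \<in> set (Dg S i (j - 1))" using moves_mem[OF IHm[of i "j - 1"]] i that by simp
        qed
      qed (use 3 IH k_def in auto)
      then have "below (Dg S (Suc i) j) (k - 1) < below (Dg S (Suc i) j) k"
        using moves_below[OF mv, of k] moves_below[OF mv, of "k - 1"] 3 k_def by simp
      then show ?thesis using 3 k_def by (simp add: mem_iff_below)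
    qed
    then show ?thesis using Suc by simp
    qed
  qed
  have sig: "Dg S i (Suc j) \<in> Sig N" if "i \<le> m" for i
    using move_up_Sig[OF IHs vm] that by simp
  have up: "moves (Vl S i j) (Dg S i j) (Dg S i (Suc j))" if "i \<le> m" for i
    using moves_move_up[OF vm[OF that]] by simp
  have across: "moves (Hl S i (Suc j)) (Dg S i (Suc j)) (Dg S (Suc i) (Suc j))" if i: "i < m" for i
  proof -
    have eq: "of_bool (x = Hl S i j) + of_bool (x = Vl S (Suc i) j) =
        of_bool (x = Vl S i j) + (of_bool (x = Hl S i (Suc j)) :: nat)" for x
      by (cases "Hl S i j = Vl S i j"; cases "(i, j) \<in> S") simp_all
    have "below (Dg S i (Suc j)) x = below (Dg S (Suc i) (Suc j)) x + of_bool (x = Hl S i (Suc j))" for x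
      using moves_below[OF up[OF less_imp_le[OF i]], of x] moves_below[OF up[OF Suc_leI[OF i]], of x]
        moves_below[OF IHm[OF i order_refl], of x] eq[of x]
      by linarith
    then show ?thesis using moves_iff_below[OF sig[of i] sig[of "Suc i"]] i by simp
  qed
  show ?case
  proof (intro allI impI conjI)
    fix j' i assume j': "j' \<le> Suc j"
    show "Dg S i j' \<in> Sig N" if "i \<le> m" using IHs[of i j'] sig[of i] that j' by (cases "j' = Suc j") auto
    show "moves (Hl S i j') (Dg S i j') (Dg S (Suc i) j')" if "i < m"
      using IHm[of i j'] across[of i] that j' by (cases "j' = Suc j") auto
    show "Vl S i j' \<in> set (Dg S i j')" if "j' < Suc j" "i \<le> m"
      using IHv[of i j'] vm[of i] that by (cases "j' = j") auto
  qed
qed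

lemma supported_growth:
  assumes S: "supported S"
  shows "growth (target S) (Dg S)"
    and "i < m \<Longrightarrow> j \<le> n \<Longrightarrow> hpos (Dg S) i j = Hl S i j"
    and "i \<le> m \<Longrightarrow> j < n \<Longrightarrow> vpos (Dg S) i j = Vl S i j"
    and "ones (Dg S) = S"
proof -
  interpret label_array m n "Hl S" "Vl S" using supported_label_array[OF S] .
  have sg: "Dg S i j \<in> Sig N" if "i \<le> m" "j \<le> n" for i j using supported_moves[OF S that(2)] that by blast
  have hm: "moves (Hl S i j) (Dg S i j) (Dg S (Suc i) j)" if "i < m" "j \<le> n" for i j
    using supported_moves[OF S that(2)] that by blast
  have vm: "moves (Vl S i j) (Dg S i j) (Dg S i (Suc j))" if "i \<le> m" "j < n" for i j
  proof -
    have "Vl S i j \<in> set (Dg S i j)" using supported_moves[OF S, of "Suc j"] that by auto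
    then show ?thesis using moves_move_up by simp
  qed
  show h: "hpos (Dg S) i j = Hl S i j" if "i < m" "j \<le> n" for i j
    using the_moves[OF hm[OF that]] by (simp add: hpos_def)
  show v: "vpos (Dg S) i j = Vl S i j" if "i \<le> m" "j < n" for i j
    using the_moves[OF vm[OF that]] by (simp add: vpos_def)
  have corner: "Dg S m 0 = nu" "Dg S 0 n = mu"
    using strip_path(4)[OF sigs(1,3) strips(2)] strip_path(4)[OF sigs(1,2) strips(1)]
    by (simp_all add: move_left m_def n_def)
  show "growth (target S) (Dg S)"
    unfolding growth_diagram_def length_lam
  proof (intro conjI allI impI)
    show "hpos (Dg S) i j < hpos (Dg S) (Suc i) j" if "Suc i < m \<and> j \<le> n" for i j
      using h that H_step by auto
    show "vpos (Dg S) i j < vpos (Dg S) i (Suc j)" if "i \<le> m \<and> Suc j < n" for i j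
      using v that V_step by auto
    fix i j assume "i < m" "j < n" "hpos (Dg S) i j = vpos (Dg S) i j"
    then show "hpos (Dg S) i (Suc j) = vpos (Dg S) (Suc i) j"
      "hpos (Dg S) i (Suc j) \<in> {hpos (Dg S) i j, hpos (Dg S) i j + 1}"
      using meet[of i j] by (auto simp add: h v simp del: line_h.simps line_v.simps)
  next
    show "\<exists>k. moves k (Dg S i j) (Dg S i (Suc j))" if "i \<le> m" "j < n" for i j using vm that by blast
    show "\<exists>k. moves k (Dg S i j) (Dg S (Suc i) j)" if "i < m" "j \<le> n" for i j using hm that by blast
  qed (use corner sg in \<open>auto simp del: line_h.simps line_v.simps\<close>)
  show "ones (Dg S) = S"
  proof -
    have "one_box (Dg S) i j \<longleftrightarrow> (i, j) \<in> S" if "i < m" "j < n" for i j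
    proof (cases "Hl S i j = Vl S i j")
      case True
      then show ?thesis using that h v by (simp add: one_box_def)
    next
      case False
      then show ?thesis using that supported_meets[OF S, of i j] h v by (auto simp: one_box_def)
    qed
    then show ?thesis using S by (auto simp: ones_def supported_def)
  qed
qed

text \<open>At a first box where two diagrams differ, lines of some label \<open>k\<close> are bumped in one of them and stay
in the other one, which excludes all bumps at \<open>k\<close> there. But the boundary decides whether there are
bumps at \<open>k\<close>, by \<open>ex_bumps_iff_card\<close>.\<close>

lemma growth_unique:
  assumes g: "growth rho L" and g': "growth rho L'"
  shows "ones L = ones L'"
proof -
  have sub: "(i, j) \<in> ones L \<Longrightarrow> (i, j) \<in> ones L'"
    if g: "growth rho L" and g': "growth rho L'"
      and agree: "\<And>i' j'. i' + j' < i + j \<Longrightarrow> (i', j') \<in> ones L \<longleftrightarrow> (i', j') \<in> ones L'"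
    for L L' i j
  proof (rule ccontr)
    interpret A: label_array m n "hpos L" "vpos L" using growth_label_array[OF g] .
    interpret B: label_array m n "hpos L'" "vpos L'" using growth_label_array[OF g'] .
    assume one: "(i, j) \<in> ones L" and zero: "(i, j) \<notin> ones L'"
    then have ij: "i < m" "j < n" by (auto simp: ones_def)
    have same: "hpos L i j = hpos L' i j" "vpos L i j = vpos L' i j"
      using growth_lines[OF g, of i j] growth_lines[OF g', of i j] ij
        lines_cong[of i j "ones L" "ones L'", OF agree] by auto
    have b: "A.bumps i j (hpos L i j)" using one growth_bumps_iff(1)[OF g ij] by (simp add: ones_def)
    then have "hpos L' i j = vpos L' i j" using same by (simp add: A.bumps_def)
    moreover have "\<not> B.bumps i j (hpos L' i j)" using zero ij growth_bumps_iff(1)[OF g' ij] by (simp add: ones_def)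
    ultimately have st: "B.stays i j (hpos L' i j)" using B.meet_cases[OF ij] by blast
    have "(\<exists>i j. A.bumps i j k) \<longleftrightarrow> (\<exists>i j. B.bumps i j k)" for k
      unfolding A.ex_bumps_iff_card B.ex_bumps_iff_card
        growth_bottom(3)[OF g] growth_bottom(3)[OF g'] growth_top(2)[OF g] growth_top(2)[OF g'] ..
    then obtain i' j' where "B.bumps i' j' (hpos L' i j)" using b same by metis
    then show False using B.stays_not_bumps[OF st] by blast
  qed
  have "(i, j) \<in> ones L \<longleftrightarrow> (i, j) \<in> ones L'" for i j
  proof (induction "i + j" arbitrary: i j rule: less_induct)
    case less
    then show ?case using sub[OF g g', of i j] sub[OF g' g, of i j] by blast
  qed
  then show ?thesis by auto
qed

text \<open>Diagrams and codes correspond to each other, and at most one code of nonzero weight leads to \<open>rho\<close>.\<close>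

lemma hlU_eq_sum:
  "hlU t mu rho lam nu = (\<Sum>S \<in> Pow boxes. weight S * of_bool (target S = rho))"
proof (cases "\<exists>S. supported S \<and> target S = rho")
  case True
  then obtain S where S: "supported S" "target S = rho" by blast
  have g: "growth rho (Dg S)" using supported_growth(1)[OF S(1)] S(2) by simp
  have mn: "nat (sum_list nu - sum_list lam) = m" "nat (sum_list mu - sum_list lam) = n"
    using strip_path_sum[OF sigs(1,3) strips(2)] strip_path_sum[OF sigs(1,2) strips(1)]
    by (simp_all add: m_def n_def)
  \<comment> \<open>The diagram picked by \<open>hlU\<close> need not be \<open>Dg S\<close>, but it has the same one-boxes.\<close>
  define L where "L = (SOME L. growth rho L)"
  have gL: "growth rho L" unfolding L_def using someI[of "growth rho", OF g] .
  have "hlU t mu rho lam nu = (\<Prod>i<m. \<Prod>j<n. box_weight t L i j)"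
    unfolding hlU_def mn Let_def L_def[symmetric] length_lam
    using g growth_top(1,3)[OF g] growth_right(1)[OF g] growth_sum[OF g] sigs strips by auto
  also have "\<dots> = weight S"
    using growth_weight[OF gL] growth_unique[OF gL g] supported_growth(4)[OF S(1)] by simp
  also have "\<dots> = (\<Sum>S' \<in> Pow boxes. if S' = S then weight S else 0)"
    using S by (simp add: supported_def)
  also have "\<dots> = (\<Sum>S' \<in> Pow boxes. weight S' * of_bool (target S' = rho))"
  proof (rule sum.cong[OF refl])
    fix S' assume S': "S' \<in> Pow boxes"
    show "(if S' = S then weight S else 0) = weight S' * of_bool (target S' = rho)"
    proof (cases "weight S' \<noteq> 0 \<and> target S' = rho")
      case True
      then have "supported S'" using S' by (simp add: supported_def)
      then have "S' = S"
        using growth_unique[of rho "Dg S'" "Dg S"] supported_growth(1,4) True g S(1) by metis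
      then show ?thesis using S by simp
    qed (use S in \<open>auto simp: supported_def\<close>)
  qed
  finally show ?thesis .
next
  case False
  have mn: "nat (sum_list nu - sum_list lam) = m" "nat (sum_list mu - sum_list lam) = n"
    using strip_path_sum[OF sigs(1,3) strips(2)] strip_path_sum[OF sigs(1,2) strips(1)]
    by (simp_all add: m_def n_def)
  have "weight S * of_bool (target S = rho) = 0" if "S \<in> Pow boxes" for S
    using False that by (auto simp: supported_def)
  then have "(\<Sum>S \<in> Pow boxes. weight S * of_bool (target S = rho)) = 0" by (intro sum.neutral) blast
  moreover have "hlU t mu rho lam nu = 0"
  proof (cases "\<exists>L. growth rho L")
    case True
    define L where "L = (SOME L. growth rho L)"
    have gL: "growth rho L" unfolding L_def using someI_ex[OF True] .
    have "Dg (ones L) m n = rho" using growth_diagram_eq[OF gL, of m n] gL by (simp add: growth_diagram_def)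
    moreover have "ones L \<subseteq> boxes" by (auto simp: ones_def)
    ultimately have "weight (ones L) = 0" using False by (auto simp: supported_def)
    then have "(\<Prod>i<m. \<Prod>j<n. box_weight t L i j) = 0" using growth_weight[OF gL] by simp
    then show ?thesis unfolding hlU_def mn Let_def L_def[symmetric] by simp
  next
    case False
    then show ?thesis unfolding hlU_def mn Let_def by (simp only: if_False if_cancel)
  qed
  ultimately show ?thesis by simp
qed

end

section \<open>Deciding the boxes one after another\<close>

lemma sum_Pow_insert:
  assumes "finite A" "x \<notin> A"
  shows "(\<Sum>S \<in> Pow (insert x A). f S) = (\<Sum>S \<in> Pow A. f S + f (insert x S))"
proof -
  have "inj_on (insert x) (Pow A)" using assms(2) by (auto simp: inj_on_def)
  moreover have "Pow A \<inter> insert x ` Pow A = {}" using assms(2) by auto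
  ultimately show ?thesis
    using assms by (simp add: Pow_insert sum.union_disjoint sum.reindex sum.distrib)
qed

definition choice_prod :: "('p set \<Rightarrow> 'p \<Rightarrow> real) \<Rightarrow> 'p set \<Rightarrow> 'p set \<Rightarrow> real" where
  "choice_prod q B S = (\<Prod>p\<in>B. if p \<in> S then 1 - q S p else q S p)"

context
  fixes q :: "'p set \<Rightarrow> 'p \<Rightarrow> real" and rank :: "'p \<Rightarrow> nat"
  assumes causal: "\<And>S S' p. (\<And>p'. rank p' < rank p \<Longrightarrow> p' \<in> S \<longleftrightarrow> p' \<in> S') \<Longrightarrow> q S p = q S' p"
begin

lemma choice_prod_insert:
  assumes A: "finite A" "x \<notin> A" "\<And>y. y \<in> A \<Longrightarrow> rank y \<le> rank x" and S: "S \<subseteq> A"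
  shows "choice_prod q (insert x A) S = q S x * choice_prod q A S"
    and "choice_prod q (insert x A) (insert x S) = (1 - q S x) * choice_prod q A S"
proof -
  show "choice_prod q (insert x A) S = q S x * choice_prod q A S"
    using A S by (auto simp: choice_prod_def)
  have same: "q (insert x S) p = q S p" if "rank p \<le> rank x" for p
    by (rule causal) (use that in auto)
  have "(\<Prod>p\<in>A. if p \<in> insert x S then 1 - q (insert x S) p else q (insert x S) p) =
      (\<Prod>p\<in>A. if p \<in> S then 1 - q S p else q S p)"
    by (rule prod.cong) (use A same in auto)
  then show "choice_prod q (insert x A) (insert x S) = (1 - q S x) * choice_prod q A S"
    using A same[of x] by (simp add: choice_prod_def)
qed

text \<open>The element of highest rank influences no other factor, so the sum over its two states gives one.\<close>

lemma choice_prod_total: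
  assumes "finite B"
  shows "(\<Sum>S \<in> Pow B. choice_prod q B S) = 1"
  using assms
proof (induction B rule: finite_ranking_induct[where f = rank])
  case empty
  show ?case by (simp add: choice_prod_def)
next
  case (insert x A)
  show ?case
  proof (cases "x \<in> A")
    case False
    have "(\<Sum>S \<in> Pow (insert x A). choice_prod q (insert x A) S) =
        (\<Sum>S \<in> Pow A. choice_prod q A S)"
      unfolding sum_Pow_insert[OF insert(1) False]
      by (rule sum.cong[OF refl])
        (use choice_prod_insert[OF insert(1) False insert(2)] in \<open>auto simp: algebra_simps\<close>)
    then show ?thesis using insert by simp
  qed (use insert in \<open>simp add: insert_absorb\<close>)
qed

text \<open>Decisions of higher rank sum to one, and those of lower rank leave the chance of \<open>p\<close> equal to \<open>c\<close>
whenever they have nonzero weight.\<close>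

lemma choice_prod_special:
  assumes "finite B" "p \<in> B"
    and "\<And>S. S \<subseteq> B \<Longrightarrow> (\<And>p'. p' \<in> B \<Longrightarrow> rank p' < rank p \<Longrightarrow> (if p' \<in> S then 1 - q S p' else q S p') \<noteq> 0) \<Longrightarrow> q S p = c"
  shows "(\<Sum>S \<in> Pow B. choice_prod q B S * of_bool (p \<notin> S)) = c"
  using assms
proof (induction B rule: finite_ranking_induct[where f = rank])
  case (insert x A)
  show ?case
  proof (cases "x \<in> A")
    case True
    then show ?thesis using insert by (simp add: insert_absorb)
  next
    case False
    note ins = choice_prod_insert[OF insert(1) False insert(2)]
    show ?thesis
    proof (cases "x = p")
      case True
      have "choice_prod q (insert x A) S * of_bool (p \<notin> S) +
          choice_prod q (insert x A) (insert x S) * of_bool (p \<notin> insert x S) = c * choice_prod q A S"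
        if S: "S \<in> Pow A" for S
      proof (cases "choice_prod q A S = 0")
        case True
        then show ?thesis using ins[of S] S by auto
      next
        case nz: False
        have "q S p = c"
        proof (rule insert.prems(2))
          show "S \<subseteq> insert x A" using S by auto
          show "(if p' \<in> S then 1 - q S p' else q S p') \<noteq> 0" if "p' \<in> insert x A" "rank p' < rank p" for p'
          proof -
            have "p' \<in> A" using that True by auto
            then show ?thesis using nz insert(1) unfolding choice_prod_def by (simp add: prod_zero_iff)
          qed
        qed
        then show ?thesis using ins[of S] S True False by auto
      qed
      then have "(\<Sum>S \<in> Pow (insert x A). choice_prod q (insert x A) S * of_bool (p \<notin> S)) =
          c * (\<Sum>S \<in> Pow A. choice_prod q A S)"
        unfolding sum_Pow_insert[OF insert(1) False] sum_distrib_left by (intro sum.cong) auto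
      then show ?thesis using choice_prod_total[OF insert(1)] by simp
    next
      case neq: False
      have "(\<Sum>S \<in> Pow (insert x A). choice_prod q (insert x A) S * of_bool (p \<notin> S)) =
          (\<Sum>S \<in> Pow A. choice_prod q A S * of_bool (p \<notin> S))"
        unfolding sum_Pow_insert[OF insert(1) False]
        by (rule sum.cong[OF refl]) (use ins neq in \<open>auto simp: algebra_simps\<close>)
      also have "\<dots> = c"
      proof (rule insert.IH)
        show "p \<in> A" using insert.prems(1) neq by auto
        then have le: "rank p \<le> rank x" using insert(2) by blast
        show "q S p = c"
          if S: "S \<subseteq> A" and nz: "\<And>p'. p' \<in> A \<Longrightarrow> rank p' < rank p \<Longrightarrow> (if p' \<in> S then 1 - q S p' else q S p') \<noteq> 0" for S
        proof (rule insert.prems(2))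
          show "S \<subseteq> insert x A" using S by auto
          show "(if p' \<in> S then 1 - q S p' else q S p') \<noteq> 0" if "p' \<in> insert x A" "rank p' < rank p" for p'
            by (rule nz) (use that le in auto)
        qed
      qed
      finally show ?thesis .
    qed
  qed
qed simp

end

context growth_data
begin

abbreviation "stay S \<equiv> (\<lambda>(i, j). stay_prob t (Hl S) (Vl S) S (Dg S i j) i j)"

lemma cw_stay: "cw S p = (if p \<in> S then 1 - stay S p else stay S p)"
  by (cases p) (simp add: choice_weight_def Let_def)

lemma weight_choice_prod: "weight S = choice_prod stay boxes S"
  unfolding weight_def choice_prod_def cw_stay ..

lemma stay_causal:
  assumes "\<And>p'. case_prod (+) p' < case_prod (+) p \<Longrightarrow> p' \<in> S \<longleftrightarrow> p' \<in> S'"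
  shows "stay S p = stay S' p"
proof (cases p)
  case (Pair i j)
  have "(i', j') \<in> S \<longleftrightarrow> (i', j') \<in> S'" if "i' + j' < i + j" for i' j'
    using assms[of "(i', j')"] that Pair by simp
  then show ?thesis unfolding Pair prod.case by (rule stay_prob_cong)
qed

lemma weight_total: "(\<Sum>S \<in> Pow boxes. weight S) = 1"
  unfolding weight_choice_prod
proof (rule choice_prod_total[where rank = "case_prod (+)"])
  show "stay S p = stay S' p"
    if "\<And>p'. case_prod (+) p' < case_prod (+) p \<Longrightarrow> p' \<in> S \<longleftrightarrow> p' \<in> S'" for S S' p
    using that by (rule stay_causal)
qed simp

lemma stay_prob_range:
  assumes "k \<in> set l \<or> H i j \<noteq> V i j" "k = H i j"
  shows "0 \<le> stay_prob t H V S l i j \<and> stay_prob t H V S l i j \<le> 1"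
proof -
  define c where "c = t ^ count_list l k"
  have "H i j = V i j \<Longrightarrow> c \<le> t"
  proof -
    assume "H i j = V i j"
    then have "k \<in> set l" using assms by simp
    then have "1 \<le> count_list l k" using count_list_0_iff[of l k] by linarith
    then show "c \<le> t" using power_decreasing[of 1 "count_list l k" t] t0 t1 by (simp add: c_def)
  qed
  moreover have "c \<le> t \<Longrightarrow> 0 \<le> (t - c) / (1 - c) \<and> (t - c) / (1 - c) \<le> 1"
    using t1 by (simp add: field_simps)
  ultimately show ?thesis
    unfolding stay_prob_def Let_def c_def assms(2) using t0 t1 by auto
qed

lemma weight_nonneg:
  assumes "S \<subseteq> boxes" shows "0 \<le> weight S"
proof (cases "weight S = 0")
  case False
  then have S: "supported S" using assms by (simp add: supported_def)
  have "0 \<le> cw S p" if pb: "p \<in> boxes" for p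
  proof -
    obtain i j where p: "p = (i, j)" "i < m" "j < n" using pb by auto
    have "Hl S i j \<in> set (Dg S i j)"
      using supported_moves[OF S, of j] moves_mem p by (meson less_imp_le_nat order_refl)
    then show ?thesis
      using stay_prob_range[of "Hl S i j" "Dg S i j" "Hl S" i j "Vl S" S] unfolding cw_stay p by auto
  qed
  then show ?thesis unfolding weight_def by (rule prod_nonneg)
qed simp

lemma strip_nu_less: "i < i' \<Longrightarrow> i' < m \<Longrightarrow> hcol i < hcol i'"
  using strip_col_less[OF finite_strip_cols[OF sigs(1,3)]] by (simp add: m_def)

lemma strip_mu_less: "j < j' \<Longrightarrow> j' < n \<Longrightarrow> vcol j < vcol j'"
  using strip_col_less[OF finite_strip_cols[OF sigs(1,2)]] by (simp add: n_def)

lemma strip_nu_mem: "i < m \<Longrightarrow> hcol i \<in> hcols"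
  using strip_col_image[OF finite_strip_cols[OF sigs(1,3)]] unfolding m_def by blast

lemma strip_mu_mem: "j < n \<Longrightarrow> vcol j \<in> vcols"
  using strip_col_image[OF finite_strip_cols[OF sigs(1,2)]] unfolding n_def by blast

lemma strip_nu_ex: "l \<in> hcols \<Longrightarrow> \<exists>i<m. hcol i = l"
proof -
  assume "l \<in> hcols"
  then have "l \<in> hcol ` {..<m}"
    using strip_col_image[OF finite_strip_cols[OF sigs(1,3)]] by (simp add: m_def)
  then show ?thesis by auto
qed

lemma strip_mu_ex: "l \<in> vcols \<Longrightarrow> \<exists>j<n. vcol j = l"
proof -
  assume "l \<in> vcols"
  then have "l \<in> vcol ` {..<n}"
    using strip_col_image[OF finite_strip_cols[OF sigs(1,2)]] by (simp add: n_def)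
  then show ?thesis by auto
qed

text \<open>Let \<open>k\<close> be the smallest label that occurs both on the bottom and on the left side. Before its two
lines meet, no lines of equal label have met. So the box of this meeting, the neighbouring labels
and the chance to stay are the same for all codes.\<close>

context
  fixes k :: int
  assumes common: "k \<in> hcols" "k \<in> vcols"
    and first: "\<And>l. l < k \<Longrightarrow> l \<in> hcols \<Longrightarrow> l \<notin> vcols"
begin

definition "first_i = (SOME i. i < m \<and> hcol i = k)"
definition "first_j = (SOME j. j < n \<and> vcol j = k)"

lemma first_i: "first_i < m" "hcol first_i = k"
proof -
  have "\<exists>i. i < m \<and> hcol i = k"
    using strip_nu_ex[OF common(1)] .
  then show "first_i < m" "hcol first_i = k" unfolding first_i_def by (metis (mono_tags, lifting) someI_ex)+
qed

lemma first_j: "first_j < n" "vcol first_j = k"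
proof -
  have "\<exists>j. j < n \<and> vcol j = k"
    using strip_mu_ex[OF common(2)] .
  then show "first_j < n" "vcol first_j = k" unfolding first_j_def by (metis (mono_tags, lifting) someI_ex)+
qed

lemma before_distinct:
  assumes "i \<le> first_i" "j \<le> first_j" "(i, j) \<noteq> (first_i, first_j)"
  shows "hcol i \<noteq> vcol j"
proof
  assume eq: "hcol i = vcol j"
  have ij: "i < m" "j < n" using assms first_i first_j by auto
  have "i < first_i \<or> j < first_j" using assms by auto
  then have "hcol i < k" using strip_nu_less[of i first_i] strip_mu_less[of j first_j] first_i first_j eq by auto
  then show False using first strip_nu_mem[OF ij(1)] strip_mu_mem[OF ij(2)] eq by metis
qed

lemma before_lines:
  assumes "i \<le> first_i" "j \<le> first_j"
  shows "Hl S i j = hcol i" "Vl S i j = vcol j"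
proof -
  have "Hl S i j = hcol i \<and> Vl S i j = vcol j"
    using assms
  proof (induction "i + j" arbitrary: i j rule: less_induct)
    case less
    have "Hl S i j = hcol i"
    proof (cases j)
      case (Suc j')
      then show ?thesis using less.hyps[of i j'] less.prems before_distinct[of i j'] by simp
    qed simp
    moreover have "Vl S i j = vcol j"
    proof (cases i)
      case (Suc i')
      then show ?thesis using less.hyps[of i' j] less.prems before_distinct[of i' j] by simp
    qed simp
    ultimately show ?case by blast
  qed
  then show "Hl S i j = hcol i" "Vl S i j = vcol j" by auto
qed

lemma count_move_up: "l + 1 < x \<Longrightarrow> count_list (move_up l xs) x = count_list xs x"
  by (simp add: count_mset[symmetric] mset_move_up)

lemma strip_nu_pred: "k - 1 \<in> hcols \<longleftrightarrow> 0 < first_i \<and> hcol (first_i - 1) = k - 1"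
proof
  assume "k - 1 \<in> hcols"
  then obtain i where i: "i < m" "hcol i = k - 1"
    using strip_nu_ex by blast
  have "i < first_i" using i first_i strip_nu_less[of first_i i] by (cases "i = first_i"; cases "i < first_i") auto
  moreover have "\<not> Suc i < first_i" using i first_i strip_nu_less[of i "Suc i"] strip_nu_less[of "Suc i" first_i] by auto
  ultimately have "first_i = Suc i" by simp
  then show "0 < first_i \<and> hcol (first_i - 1) = k - 1" using i by simp
next
  assume "0 < first_i \<and> hcol (first_i - 1) = k - 1"
  then show "k - 1 \<in> hcols" using strip_nu_mem[of "first_i - 1"] first_i by simp
qed

lemma strip_mu_pred: "k - 1 \<in> vcols \<longleftrightarrow> 0 < first_j \<and> vcol (first_j - 1) = k - 1"
proof
  assume "k - 1 \<in> vcols"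
  then obtain j where j: "j < n" "vcol j = k - 1"
    using strip_mu_ex by blast
  have "j < first_j" using j first_j strip_mu_less[of first_j j] by (cases "j = first_j"; cases "j < first_j") auto
  moreover have "\<not> Suc j < first_j" using j first_j strip_mu_less[of j "Suc j"] strip_mu_less[of "Suc j" first_j] by auto
  ultimately have "first_j = Suc j" by simp
  then show "0 < first_j \<and> vcol (first_j - 1) = k - 1" using j by simp
next
  assume "0 < first_j \<and> vcol (first_j - 1) = k - 1"
  then show "k - 1 \<in> vcols" using strip_mu_mem[of "first_j - 1"] first_j by simp
qed

text \<open>Only positions below \<open>k - 1\<close> have been moved so far.\<close>

lemma first_count:
  assumes "k - 1 \<notin> hcols" "k - 1 \<notin> vcols"
  shows "count_list (Dg S first_i first_j) k = count_list lam k"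
proof -
  have lt: "hcol i + 1 < k" if "i < first_i" for i
  proof -
    have "hcol i < k" using strip_nu_less[of i first_i] first_i that by simp
    moreover have "hcol i \<noteq> k - 1" using strip_nu_mem[of i] first_i that assms(1) by auto
    ultimately show ?thesis by simp
  qed
  have lt': "vcol j + 1 < k" if "j < first_j" for j
  proof -
    have "vcol j < k" using strip_mu_less[of j first_j] first_j that by simp
    moreover have "vcol j \<noteq> k - 1" using strip_mu_mem[of j] first_j that assms(2) by auto
    ultimately show ?thesis by simp
  qed
  have "count_list (move_seq lam hcol i) k = count_list lam k" if "i \<le> first_i" for i
    using that by (induction i) (auto simp: count_move_up lt)
  moreover have "count_list (Dg S first_i j) k = count_list (Dg S first_i 0) k" if "j \<le> first_j" for j
    using that
  proof (induction j)
    case (Suc j)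
    then show ?case using count_move_up[OF lt'[of j]] before_lines(2)[of first_i j S] by simp
  qed simp
  ultimately show ?thesis by simp
qed

lemma first_stay:
  assumes "\<And>p. p \<in> boxes \<Longrightarrow> case_prod (+) p < first_i + first_j \<Longrightarrow> cw S p \<noteq> 0"
  shows "stay S (first_i, first_j) =
    (if k - 1 \<in> hcols \<union> vcols then t
     else (t - t ^ count_list lam k) / (1 - t ^ count_list lam k))"
proof -
  have eq: "Hl S first_i first_j = k" "Vl S first_i first_j = k" using before_lines[of first_i first_j S] first_i first_j by auto
  have triv: "(i, j) \<notin> S" if "i \<le> first_i" "j \<le> first_j" "i + j < first_i + first_j" for i j
  proof
    assume "(i, j) \<in> S"
    moreover have "Hl S i j \<noteq> Vl S i j"
      using before_lines[OF that(1,2), of S] before_distinct[OF that(1,2)] that(3) by auto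
    ultimately have "cw S (i, j) = 0" by (simp add: choice_weight_def stay_prob_def Let_def)
    then show False using assms[of "(i, j)"] that first_i first_j by auto
  qed
  have nl: "0 < first_i \<Longrightarrow> (first_i - 1, first_j) \<notin> S" "0 < first_j \<Longrightarrow> (first_i, first_j - 1) \<notin> S"
    by (rule triv; simp)+
  have "Hl S (first_i - 1) first_j = hcol (first_i - 1)" "Vl S first_i (first_j - 1) = vcol (first_j - 1)"
    using before_lines(1)[of "first_i - 1" first_j S] before_lines(2)[of first_i "first_j - 1" S] by auto
  then have adj: "(0 < first_i \<and> Hl S (first_i - 1) first_j = k - 1) = (k - 1 \<in> hcols)"
    "(0 < first_j \<and> Vl S first_i (first_j - 1) = k - 1) = (k - 1 \<in> vcols)"
    unfolding strip_nu_pred strip_mu_pred by auto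
  have nb: "\<not> (k - 1 \<in> hcols \<and> k - 1 \<in> vcols)" using first[of "k - 1"] by simp
  show ?thesis
    unfolding prod.case stay_prob_def Let_def eq adj
    using nl nb first_count by auto
qed

lemma first_weight:
  "(\<Sum>S \<in> Pow boxes. weight S * of_bool ((first_i, first_j) \<notin> S)) =
    (if k - 1 \<in> hcols \<union> vcols then t
     else (t - t ^ count_list lam k) / (1 - t ^ count_list lam k))"
  unfolding weight_choice_prod
proof (rule choice_prod_special[where rank = "case_prod (+)"])
  show "(first_i, first_j) \<in> boxes" using first_i first_j by simp
  fix S assume "S \<subseteq> boxes" and *: "\<And>p'. p' \<in> boxes \<Longrightarrow> case_prod (+) p' < case_prod (+) (first_i, first_j) \<Longrightarrow>
    (if p' \<in> S then 1 - stay S p' else stay S p') \<noteq> 0"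
  show "stay S (first_i, first_j) = (if k - 1 \<in> hcols \<union> vcols then t
     else (t - t ^ count_list lam k) / (1 - t ^ count_list lam k))"
  proof (rule first_stay)
    fix p assume "p \<in> boxes" "case_prod (+) p < first_i + first_j"
    then show "cw S p \<noteq> 0" using *[of p] unfolding cw_stay by simp
  qed
next
  show "stay S p = stay S' p"
    if "\<And>p'. case_prod (+) p' < case_prod (+) p \<Longrightarrow> p' \<in> S \<longleftrightarrow> p' \<in> S'" for S S' p
    using that by (rule stay_causal)
qed simp

end

end

section \<open>Which lines leave the diagram\<close>

context growth_data
begin

definition "Top S = strip_cols mu (target S)"
definition "has_stay S k \<longleftrightarrow> (\<exists>i j. label_array.stays m n (Hl S) (Vl S) i j k)"
definition "has_bump S k \<longleftrightarrow> (\<exists>i j. label_array.bumps m n (Hl S) (Vl S) i j k)"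

lemma supported_sides:
  assumes S: "supported S"
  shows "(\<lambda>i. Hl S i 0) ` {..<m} = hcols" "(\<lambda>i. Hl S i n) ` {..<m} = Top S"
    "(\<lambda>j. Vl S 0 j) ` {..<n} = vcols"
    "(\<lambda>j. Vl S m j) ` {..<n} = strip_cols nu (target S)"
proof -
  note g = supported_growth(1)[OF S] and h = supported_growth(2)[OF S] and v = supported_growth(3)[OF S]
  show "(\<lambda>i. Hl S i 0) ` {..<m} = hcols"
    unfolding growth_bottom(3)[OF g, symmetric] by (rule image_cong) (simp_all add: h[symmetric] del: line_h.simps)
  show "(\<lambda>i. Hl S i n) ` {..<m} = Top S"
    unfolding Top_def growth_top(2)[OF g, symmetric] by (rule image_cong) (simp_all add: h[symmetric] del: line_h.simps)
  show "(\<lambda>j. Vl S 0 j) ` {..<n} = vcols"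
    unfolding growth_left(2)[OF g, symmetric] by (rule image_cong) (simp_all add: v[symmetric] del: line_v.simps)
  show "(\<lambda>j. Vl S m j) ` {..<n} = strip_cols nu (target S)"
    unfolding growth_right(2)[OF g, symmetric] by (rule image_cong) (simp_all add: v[symmetric] del: line_v.simps)
qed

text \<open>If a vertical line of label \<open>k\<close> enters, a horizontal line can leave with this label only after meeting
it, and the two survive such a meeting only by staying.\<close>

lemma top_iff_stay:
  assumes S: "supported S" and k: "k \<in> vcols"
  shows "k \<in> Top S \<longleftrightarrow> has_stay S k"
proof -
  interpret label_array m n "Hl S" "Vl S" using supported_label_array[OF S] .
  show ?thesis
  proof
    show "k \<in> Top S \<Longrightarrow> has_stay S k"
      using stays_if_left_top[of k] k unfolding supported_sides(2,3)[OF S] has_stay_def by blast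
    assume "has_stay S k"
    then obtain i j where st: "stays i j k" by (auto simp: has_stay_def)
    then have "H i n = k" if "H = Hl S" for H using stays_boundary(2)[OF st] that by simp
    moreover have "i < m" using st by (simp add: stays_def)
    ultimately show "k \<in> Top S" unfolding supported_sides(2)[OF S, symmetric] by blast
  qed
qed

lemma top_iff_bump:
  assumes S: "supported S" and k: "k \<notin> hcols" "k \<notin> vcols"
  shows "k \<in> Top S \<longleftrightarrow> has_bump S (k - 1)"
proof -
  interpret label_array m n "Hl S" "Vl S" using supported_label_array[OF S] .
  show ?thesis
    using bumps_below_if_top[of k] top_if_bumps_below[of k] k
    unfolding supported_sides(1,2,3)[OF S] has_bump_def by blast
qed

lemma top_if_bottom_only:
  assumes S: "supported S" and k: "k \<in> hcols" "k \<notin> vcols"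
  shows "k \<in> Top S"
proof -
  note g = supported_growth(1)[OF S]
  have "below lam k = below nu k + 1" using below_strip[OF sigs(1,3) strips(2)] k by simp
  moreover have "below lam k = below mu k" using below_strip[OF sigs(1,2) strips(1)] k by simp
  moreover have "below (target S) k \<le> below nu k"
    using interlaces_iff_below[OF sigs(3) growth_top(3)[OF g]] growth_right(1)[OF g] by blast
  ultimately show ?thesis by (simp add: Top_def strip_cols_def)
qed

lemma has_bump_iff_card:
  assumes S: "supported S"
  shows "has_bump S k \<longleftrightarrow> card {x \<in> hcols. x \<le> k} \<noteq> card {x \<in> Top S. x \<le> k}"
proof -
  interpret label_array m n "Hl S" "Vl S" using supported_label_array[OF S] .
  show ?thesis unfolding has_bump_def ex_bumps_iff_card supported_sides(1,2)[OF S] ..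
qed

lemma stay_no_bump:
  assumes S: "supported S" and st: "has_stay S k"
  shows "\<not> has_bump S k" "\<not> has_bump S (k - 1)"
    "k \<in> hcols" "k \<in> vcols"
proof -
  interpret label_array m n "Hl S" "Vl S" using supported_label_array[OF S] .
  obtain i j where st: "stays i j k" using st by (auto simp: has_stay_def)
  show "\<not> has_bump S k" using stays_not_bumps[OF st] by (auto simp: has_bump_def)
  show "\<not> has_bump S (k - 1)" using stays_not_bumps_below[OF st] by (auto simp: has_bump_def)
  have ij: "i < m" "j < n" using st by (auto simp: stays_def)
  have "Hl S i 0 \<in> (\<lambda>i. Hl S i 0) ` {..<m}" "Vl S 0 j \<in> (\<lambda>j. Vl S 0 j) ` {..<n}"
    using ij by (auto simp del: line_h.simps line_v.simps)
  then show "k \<in> hcols" "k \<in> vcols"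
    unfolding stays_boundary(1,3)[OF st] supported_sides(1,3)[OF S] by simp_all
qed

text \<open>The stay would have an adjacent one-box on the diagonal, and such a zero-box has weight 0.\<close>

lemma no_stay_above_bump:
  assumes S: "supported S" and b: "has_bump S (k - 2)"
    and k: "k - 1 \<notin> hcols" "k - 1 \<notin> vcols"
  shows "\<not> has_stay S k"
proof
  interpret label_array m n "Hl S" "Vl S" using supported_label_array[OF S] .
  assume "has_stay S k"
  then obtain i j where st: "stays i j k" by (auto simp: has_stay_def)
  obtain i0 j0 where b0: "bumps i0 j0 (k - 2)" using b by (auto simp: has_bump_def)
  have d: "0 < i" "0 < j" "Hl S (i - 1) j = k - 1" "Vl S i (j - 1) = k - 1"
    "bumps (i - 1) (j - 1) (k - 2)"
    using stays_above_bumps[OF st b0] k unfolding supported_sides(1,3)[OF S] by blast+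
  have ij: "i < m" "j < n" "Hl S i j = k" "Vl S i j = k" "Hl S i (Suc j) = k"
    using st unfolding stays_def by blast+
  have "(i - 1, j - 1) \<in> S"
    using d(5) d(1,2) unfolding bumps_def by (cases i; cases j) (auto split: if_splits)
  moreover have "(i, j) \<notin> S" using ij by auto
  ultimately have "cw S (i, j) = 0"
    using ij d by (simp add: choice_weight_def stay_prob_def Let_def)
  then show False using supported_cw[OF S ij(1,2)] by simp
qed

text \<open>The bump would have an adjacent zero-box on the diagonal, and such a one-box has weight 0.\<close>

lemma no_bump_above_stay:
  assumes S: "supported S" and st: "has_stay S k"
  shows "\<not> has_bump S (k + 1)"
proof
  interpret label_array m n "Hl S" "Vl S" using supported_label_array[OF S] .
  assume "has_bump S (k + 1)"
  then obtain i' j' where b: "bumps i' j' (k + 1)" by (auto simp: has_bump_def)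
  obtain i j where st: "stays i j k" using st by (auto simp: has_stay_def)
  have e: "i' = Suc i" "j' = Suc j" using bumps_above_stays[OF st b] by auto
  have ij: "i < m" "j < n" "Hl S i j = k" "Vl S i j = k" "Hl S i (Suc j) = k" "Vl S (Suc i) j = k"
    using st unfolding stays_def by blast+
  have ij': "Suc i < m" "Suc j < n" "Hl S (Suc i) (Suc j) = k + 1" "Vl S (Suc i) (Suc j) = k + 1"
    "Hl S (Suc i) (Suc (Suc j)) = k + 2"
    using b unfolding bumps_def e by auto
  have nd: "(i, j) \<notin> S" using ij by auto
  have nl: "(i, Suc j) \<notin> S"
    using supported_meets[OF S, of i "Suc j"] V_step[of i j] ij ij' by auto
  have nb: "(Suc i, j) \<notin> S"
    using supported_meets[OF S, of "Suc i" j] H_step[of i j] ij ij' by auto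
  have "(Suc i, Suc j) \<in> S" using ij' by (auto split: if_splits)
  then have "cw S (Suc i, Suc j) = 0"
    using ij ij' nd nl nb by (simp add: choice_weight_def stay_prob_def Let_def del: line_h.simps line_v.simps)
  then show False using supported_cw[OF S ij'(1,2)] by simp
qed

lemma first_box_cases:
  assumes S: "supported S" and k: "k \<in> hcols" "k \<in> vcols"
    and first: "\<And>l. l < k \<Longrightarrow> l \<in> hcols \<Longrightarrow> l \<notin> vcols"
  shows "has_stay S k \<longleftrightarrow> (first_i k, first_j k) \<notin> S"
proof -
  interpret label_array m n "Hl S" "Vl S" using supported_label_array[OF S] .
  note f = first_i[OF k first] first_j[OF k first]
  have e: "Hl S (first_i k) (first_j k) = k" "Vl S (first_i k) (first_j k) = k"
    using before_lines[OF k first, of "first_i k" "first_j k" S] f by auto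
  show ?thesis
  proof (cases "(first_i k, first_j k) \<in> S")
    case True
    then have "bumps (first_i k) (first_j k) k" using e f by (simp add: bumps_def)
    then have "has_bump S k" by (auto simp: has_bump_def)
    then show ?thesis using True stay_no_bump(1)[OF S] by blast
  next
    case False
    then have "stays (first_i k) (first_j k) k" using e f by (simp add: stays_def)
    then show ?thesis using False by (auto simp: has_stay_def)
  qed
qed

end

section \<open>The two lowest positions\<close>

text \<open>The exiting arrows, if the arrows \<open>E\<close> enter, the input is \<open>d\<close>, and \<open>s\<close> tells whether the lines of the
undecided meeting stay. The auxiliary \<open>carry\<close> says whether lines are bumped from label 0 to label 1:
of the \<open>d\<close> lines raised to 0 and the one entering from below with label 0, all but the one that
leaves at 0 go on to label 1.\<close>

definition exits :: "in_arrow set \<Rightarrow> nat \<Rightarrow> bool \<Rightarrow> out_arrow set" where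
  "exits E d s =
    (let bu = (if BL \<in> E then BB \<in> E \<or> 0 < d else BB \<in> E \<and> d = 0 \<and> s);
         br = (if bu then BL \<in> E \<and> BB \<in> E else BL \<in> E \<or> BB \<in> E);
         carry = (of_bool bu \<noteq> d + of_bool (BB \<in> E));
         ru = (if RL \<in> E then RB \<in> E \<or> carry else RB \<in> E \<and> \<not> carry \<and> d = 0 \<and> s);
         rr = (if ru then RL \<in> E \<and> RB \<in> E else RL \<in> E \<or> RB \<in> E)
     in {x. x = BU \<and> bu \<or> x = BR \<and> br \<or> x = RU \<and> ru \<or> x = RR \<and> rr})"

text \<open>The condition says that neither a vertical nor a horizontal line of label 0 enters, so that no line is
adjacent to the undecided meeting, which is then at label 1, with \<open>k\<close> particles at this position.\<close>

definition stay_chance :: "real \<Rightarrow> in_arrow set \<Rightarrow> nat \<Rightarrow> real" where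
  "stay_chance t E k = (if BL \<in> E \<and> BB \<notin> E then (t - t ^ k) / (1 - t ^ k) else t)"

lemma h_below:
  assumes "\<forall>x \<in> set l. 0 \<le> x"
  shows "h0 l = below l 0" "h1 l = below l 1"
proof -
  have "below l (- 1) = 0" using assms by (force simp: below_def filter_empty_conv)
  then show "h0 l = below l 0" "h1 l = below l 1"
    using below_pred[of l 0] below_pred[of l 1] by (simp_all add: h0_def h1_def d0_def d1_def)
qed

lemma below_snoc: "below (l @ [w]) k = below l k + of_bool (w \<le> k)"
  by (simp add: below_def)

lemma interlaces_snoc:
  assumes "length l' = Suc (length l)" "l \<prec>s l'" "\<forall>x \<in> set l'. w \<le> x"
  shows "l @ [w] \<prec>s l'"
  using assms by (auto simp: interlaces_def nth_append less_Suc_eq)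

lemma interlaces_butlast:
  assumes "length l' = Suc (length l)" "l @ [w] \<prec>s l'"
  shows "l \<prec>s l'"
  using assms by (auto simp: interlaces_def nth_append split: if_splits)

lemma Sig_snoc:
  assumes "l \<in> Sig N" "\<forall>x \<in> set l. w \<le> x"
  shows "l @ [w] \<in> Sig (Suc N)"
  using assms by (auto simp: Sig_def sorted_wrt_append)

lemma interlaces_lower_bound:
  assumes "length l' = Suc (length l)" "l \<prec>s l'" "\<forall>x \<in> set l'. w \<le> x"
  shows "\<forall>x \<in> set l. w \<le> x"
proof
  fix x assume "x \<in> set l"
  then obtain i where i: "i < length l" "x = l ! i" by (auto simp: in_set_conv_nth)
  then have "l' ! Suc i \<le> x" "l' ! Suc i \<in> set l'" using assms by (auto simp: interlaces_def)
  then show "w \<le> x" using assms(3) by force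
qed

text \<open>A coordinate far to the left, added to \<open>l\<close>, reduces this to lists of equal length.\<close>

lemma interlaces_Suc_below:
  assumes "l \<in> Sig N" "l' \<in> Sig (Suc N)" "l \<prec>s l'"
  shows "below l' k \<in> {below l k, below l k + 1}"
proof -
  \<comment> \<open>Being at most \<open>k\<close>, the new coordinate adds exactly one to the count at \<open>k\<close>.\<close>
  define w where "w = min k (Min (set l'))"
  have len: "length l' = Suc (length l)" using assms by (simp add: Sig_def)
  have w: "\<forall>x \<in> set l'. w \<le> x" by (auto simp: w_def min_le_iff_disj)
  have "\<forall>x \<in> set l. w \<le> x" using interlaces_lower_bound[OF len assms(3) w] .
  then have "l @ [w] \<in> Sig (Suc N)" using Sig_snoc assms(1) by blast
  moreover have "l @ [w] \<prec>s l'" using interlaces_snoc[OF len assms(3) w] .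
  ultimately have "below l' k \<le> below (l @ [w]) k" "below (l @ [w]) k \<le> below l' k + 1"
    using interlaces_iff_below assms(2) by blast+
  then show ?thesis by (auto simp: below_snoc w_def)
qed

lemma card_le_step:
  fixes A :: "int set"
  assumes "finite A"
  shows "card {x \<in> A. x \<le> k} = card {x \<in> A. x \<le> k - 1} + of_bool (k \<in> A)"
proof -
  have "x \<in> A \<and> x \<le> k \<longleftrightarrow> x \<in> A \<and> x \<le> k - 1 \<or> k \<in> A \<and> x = k" for x
    by (cases "x = k") auto
  then have "{x \<in> A. x \<le> k} = {x \<in> A. x \<le> k - 1} \<union> (if k \<in> A then {k} else {})" by auto
  then show ?thesis using assms by auto
qed

text \<open>The balance of arrows of one colour at a vertex.\<close>

lemma exit_arith:
  fixes l m n r :: nat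
  assumes "r \<in> {n, n + 1}" "m \<in> {r, r + 1}" "m \<in> {l, l + 1}" "l \<in> {n, n + 1}"
  shows "r \<noteq> n \<longleftrightarrow> (if r \<noteq> m then m \<noteq> l \<and> n \<noteq> l else m \<noteq> l \<or> n \<noteq> l)"
  using assms by (elim insertE emptyE) simp_all

text \<open>The data of one sampling step with input \<open>d\<close>. The auxiliary particle moves from \<open>z - d\<close> to \<open>z\<close>.\<close>

locale input_data =
  fixes t :: real and N d :: nat and lam mu nu :: "int list"
  assumes t0: "0 \<le> t" and t1: "t < 1"
    and Sig: "lam \<in> Sig N" "nu \<in> Sig N" "mu \<in> Sig (Suc N)"
    and il: "lam \<prec>s nu" "lam \<prec>s mu"
    and nonneg: "\<forall>x \<in> set mu. 0 \<le> x" "\<forall>x \<in> set nu. 0 \<le> x"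
begin

definition "z = Min (set mu \<union> set nu) - 1"

lemma lengths: "length lam = N" "length nu = N" "length mu = Suc N"
  using Sig by (auto simp: Sig_def)

lemma z_less: "x \<in> set mu \<Longrightarrow> z < x" "x \<in> set nu \<Longrightarrow> z < x"
proof -
  have "z < x" if "x \<in> set mu \<union> set nu"
  proof -
    have "Min (set mu \<union> set nu) \<le> x" by (rule Min_le) (use that in simp_all)
    then show ?thesis unfolding z_def by linarith
  qed
  then show "x \<in> set mu \<Longrightarrow> z < x" "x \<in> set nu \<Longrightarrow> z < x" by blast+
qed

lemma z_less_lam: "x \<in> set lam \<Longrightarrow> z < x"
  using interlaces_lower_bound[of mu lam "z + 1"] lengths il(2) z_less(1) by force

lemma nonneg_lam: "\<forall>x \<in> set lam. 0 \<le> x"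
  using interlaces_lower_bound[of mu lam 0] lengths il(2) nonneg(1) by auto

sublocale G: growth_data t "Suc N" "lam @ [z - int d]" mu "nu @ [z]"
proof
  have low: "\<forall>x \<in> set lam. z - int d \<le> x" "\<forall>x \<in> set nu. z \<le> x" "\<forall>x \<in> set mu. z - int d \<le> x"
    by (auto dest!: z_less_lam z_less)
  show "lam @ [z - int d] \<in> Sig (Suc N)" "nu @ [z] \<in> Sig (Suc N)"
    using Sig_snoc[OF Sig(1) low(1)] Sig_snoc[OF Sig(2) low(2)] .
  show "lam @ [z - int d] \<prec>s mu"
    by (rule interlaces_snoc) (use lengths il(2) low in auto)
  show "lam @ [z - int d] \<prec>s nu @ [z]"
    unfolding interlaces_def
  proof (intro conjI allI impI)
    fix i assume i: "i < length (lam @ [z - int d])"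
    then show "(lam @ [z - int d]) ! i \<le> (nu @ [z]) ! i"
      using il(1) lengths by (cases "i < N") (auto simp: interlaces_def nth_append)
  next
    fix i assume i: "Suc i < length (nu @ [z])"
    then have "lam ! i \<in> set lam" using lengths by simp
    then show "(nu @ [z]) ! Suc i \<le> (lam @ [z - int d]) ! i"
      using i il(1) lengths z_less_lam[of "lam ! i"]
      by (cases "Suc i < N") (auto simp: interlaces_def nth_append less_Suc_eq)
  qed (simp add: lengths)
qed (use t0 t1 Sig in auto)

lemma hlU_input_eq: "hlU_input t d mu rho lam nu = hlU t mu rho (lam @ [z - int d]) (nu @ [z])"
  by (simp add: hlU_input_def z_def Let_def)

lemma below_neg: "k < 0 \<Longrightarrow> below lam k = 0" "k < 0 \<Longrightarrow> below mu k = 0" "k < 0 \<Longrightarrow> below nu k = 0"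
  using nonneg nonneg_lam by (force simp: below_def filter_empty_conv)+

abbreviation "E \<equiv> entering lam nu mu"
abbreviation "X \<equiv> strip_cols (lam @ [z - int d]) (nu @ [z])"
abbreviation "Y \<equiv> strip_cols (lam @ [z - int d]) mu"

lemma entering_below:
  "BL \<in> E \<longleftrightarrow> below mu 0 \<noteq> below lam 0" "RL \<in> E \<longleftrightarrow> below mu 1 \<noteq> below lam 1"
  "BB \<in> E \<longleftrightarrow> below nu 0 \<noteq> below lam 0" "RB \<in> E \<longleftrightarrow> below nu 1 \<noteq> below lam 1"
  using h_below[OF nonneg(1)] h_below[OF nonneg(2)] h_below[OF nonneg_lam]
  by (auto simp: entering_def)

lemma rho_facts:
  assumes "mu \<prec>s rho" "rho \<in> Sig (Suc N)" "nu \<prec>s rho"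
  shows "\<forall>x \<in> set rho. 0 \<le> x"
    "below rho k \<in> {below nu k, below nu k + 1}" "below mu k \<in> {below rho k, below rho k + 1}"
    "below mu k \<in> {below lam k, below lam k + 1}" "below lam k \<in> {below nu k, below nu k + 1}"
proof -
  show "below rho k \<in> {below nu k, below nu k + 1}" using interlaces_Suc_below[OF Sig(2) assms(2,3)] .
  have *: "below rho k \<le> below mu k \<and> below mu k \<le> below rho k + 1" for k
    using interlaces_iff_below[OF Sig(3) assms(2)] assms(1) by blast
  from *[of k] show "below mu k \<in> {below rho k, below rho k + 1}" by auto
  show "below mu k \<in> {below lam k, below lam k + 1}" using interlaces_Suc_below[OF Sig(1,3) il(2)] .
  have "below nu k \<le> below lam k \<and> below lam k \<le> below nu k + 1"
    using interlaces_iff_below[OF Sig(1,2)] il(1) by blast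
  then show "below lam k \<in> {below nu k, below nu k + 1}" by auto
  have "below rho (- 1) = 0" using *[of "- 1"] below_neg(2)[of "- 1"] by simp
  then show "\<forall>x \<in> set rho. 0 \<le> x" by (force simp: below_def filter_empty_conv)
qed

lemma exiting_below:
  assumes "mu \<prec>s rho" "rho \<in> Sig (Suc N)" "nu \<prec>s rho"
  shows "BU \<in> exiting nu mu rho \<longleftrightarrow> below rho 0 \<noteq> below mu 0"
    "RU \<in> exiting nu mu rho \<longleftrightarrow> below rho 1 \<noteq> below mu 1"
    "BR \<in> exiting nu mu rho \<longleftrightarrow> (if BU \<in> exiting nu mu rho then BL \<in> E \<and> BB \<in> E else BL \<in> E \<or> BB \<in> E)"
    "RR \<in> exiting nu mu rho \<longleftrightarrow> (if RU \<in> exiting nu mu rho then RL \<in> E \<and> RB \<in> E else RL \<in> E \<or> RB \<in> E)"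
proof -
  note r = rho_facts[OF assms]
  note h = h_below[OF nonneg(1)] h_below[OF nonneg(2)] h_below[OF r(1)]
  show bu: "BU \<in> exiting nu mu rho \<longleftrightarrow> below rho 0 \<noteq> below mu 0"
    and ru: "RU \<in> exiting nu mu rho \<longleftrightarrow> below rho 1 \<noteq> below mu 1"
    by (auto simp: exiting_def h)
  have "BR \<in> exiting nu mu rho \<longleftrightarrow> below rho 0 \<noteq> below nu 0"
    "RR \<in> exiting nu mu rho \<longleftrightarrow> below rho 1 \<noteq> below nu 1"
    by (auto simp: exiting_def h)
  then show
    "BR \<in> exiting nu mu rho \<longleftrightarrow> (if BU \<in> exiting nu mu rho then BL \<in> E \<and> BB \<in> E else BL \<in> E \<or> BB \<in> E)"
    "RR \<in> exiting nu mu rho \<longleftrightarrow> (if RU \<in> exiting nu mu rho then RL \<in> E \<and> RB \<in> E else RL \<in> E \<or> RB \<in> E)"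
    unfolding bu ru entering_below
    using exit_arith[OF r(2-5)[of 0]] exit_arith[OF r(2-5)[of 1]] by blast+
qed

lemma supported_rho:
  assumes S: "G.supported S"
  shows "mu \<prec>s G.target S" "G.target S \<in> Sig (Suc N)" "nu \<prec>s G.target S"
proof -
  note g = G.supported_growth(1)[OF S]
  show "mu \<prec>s G.target S" "G.target S \<in> Sig (Suc N)" using G.growth_top[OF g] by auto
  then have "length (G.target S) = Suc (length nu)" using lengths by (simp add: Sig_def)
  then show "nu \<prec>s G.target S" using G.growth_right(1)[OF g] interlaces_butlast by blast
qed

text \<open>If \<open>1 \<le> z\<close>, all coordinates exceed 1 and no arrow is present.\<close>

lemma far_exiting:
  assumes z: "1 \<le> z" and S: "G.supported S"
  shows "exiting nu mu (G.target S) = exits E d s"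
proof -
  note r = supported_rho[OF S]
  have b: "below mu k = 0" "below nu k = 0" if "k \<le> 1" for k
    using z z_less that by (force simp: below_def filter_empty_conv)+
  then have b': "below lam k = 0" "below (G.target S) k = 0" if "k \<le> 1" for k
    using rho_facts(3,4)[OF r, of k] that by auto
  have nE: "BL \<notin> E" "BB \<notin> E" "RL \<notin> E" "RB \<notin> E" unfolding entering_below using b b' by auto
  have "BU \<notin> exiting nu mu (G.target S)" "RU \<notin> exiting nu mu (G.target S)"
    unfolding exiting_below[OF r] using b b' by auto
  moreover from this have "BR \<notin> exiting nu mu (G.target S)" "RR \<notin> exiting nu mu (G.target S)"
    using exiting_below(3,4)[OF r] nE by auto
  ultimately have "x \<notin> exiting nu mu (G.target S)" for x by (cases x) simp_all
  then have "exiting nu mu (G.target S) = {}" by blast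
  then show ?thesis by (simp add: exits_def nE)
qed

context
  assumes z0: "z \<le> 0"
begin

lemma mem_X: "k < 0 \<Longrightarrow> k \<in> X \<longleftrightarrow> z - int d \<le> k \<and> k < z" "0 \<le> k \<Longrightarrow> k \<in> X \<longleftrightarrow> below nu k \<noteq> below lam k"
  using z0 below_neg[of k] by (auto simp: strip_cols_def below_snoc)

lemma mem_Y: "k < 0 \<Longrightarrow> k \<in> Y \<longleftrightarrow> z - int d \<le> k" "0 \<le> k \<Longrightarrow> k \<in> Y \<longleftrightarrow> below mu k = below lam k"
proof -
  show "k < 0 \<Longrightarrow> k \<in> Y \<longleftrightarrow> z - int d \<le> k"
    using z0 below_neg[of k] by (auto simp: strip_cols_def below_snoc)
  show "0 \<le> k \<Longrightarrow> k \<in> Y \<longleftrightarrow> below mu k = below lam k"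
    using z0 interlaces_Suc_below[OF Sig(1,3) il(2), of k] by (auto simp: strip_cols_def below_snoc)
qed

lemma mem_XY: "0 \<in> X \<longleftrightarrow> BB \<in> E" "1 \<in> X \<longleftrightarrow> RB \<in> E" "0 \<in> Y \<longleftrightarrow> BL \<notin> E" "1 \<in> Y \<longleftrightarrow> RL \<notin> E"
  by (simp_all add: mem_X mem_Y entering_below)

text \<open>Below position 0 only the auxiliary particle is found. It contributes \<open>d\<close> negative labels on the bottom,
and there are none on the top because \<open>mu\<close> has no negative coordinates.\<close>

lemma near_bumps:
  assumes S: "G.supported S"
  shows "G.has_bump S (- 1) \<longleftrightarrow> d \<noteq> 0"
    "G.has_bump S 0 \<longleftrightarrow> of_bool (0 \<in> G.Top S) \<noteq> d + of_bool (0 \<in> X)"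
    "G.has_bump S 1 \<longleftrightarrow> of_bool (0 \<in> G.Top S) + of_bool (1 \<in> G.Top S) \<noteq> d + of_bool (0 \<in> X) + of_bool (1 \<in> X)"
proof -
  have "{x \<in> X. x \<le> - 1} = {z - int d..<z}" using mem_X(1) z0 by auto
  then have X1: "card {x \<in> X. x \<le> - 1} = d" by simp
  have "{x \<in> G.Top S. x \<le> - 1} = {}"
  proof -
    have "k \<notin> G.Top S" if "k < 0" for k
      using rho_facts(3)[OF supported_rho[OF S], of k] below_neg(2)[OF that]
      by (auto simp: G.Top_def strip_cols_def)
    then show ?thesis by force
  qed
  then have T1: "card {x \<in> G.Top S. x \<le> - 1} = 0" by (simp only: card.empty)
  have fin: "finite X" "finite (G.Top S)"
    using finite_strip_cols[OF G.sigs(1,3)] finite_strip_cols[OF G.sigs(2) supported_rho(2)[OF S]]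
    by (auto simp: G.Top_def)
  note c = card_le_step[OF fin(1), of 0] card_le_step[OF fin(2), of 0]
    card_le_step[OF fin(1), of 1] card_le_step[OF fin(2), of 1]
  show "G.has_bump S (- 1) \<longleftrightarrow> d \<noteq> 0" unfolding G.has_bump_iff_card[OF S] using X1 T1 by simp
  show "G.has_bump S 0 \<longleftrightarrow> of_bool (0 \<in> G.Top S) \<noteq> d + of_bool (0 \<in> X)"
    unfolding G.has_bump_iff_card[OF S] using X1 T1 c by auto
  show "G.has_bump S 1 \<longleftrightarrow> of_bool (0 \<in> G.Top S) + of_bool (1 \<in> G.Top S) \<noteq> d + of_bool (0 \<in> X) + of_bool (1 \<in> X)"
    unfolding G.has_bump_iff_card[OF S] using X1 T1 c by auto
qed

lemma near_black:
  assumes S: "G.supported S"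
    and s0: "d = 0 \<Longrightarrow> 0 \<in> X \<Longrightarrow> 0 \<in> Y \<Longrightarrow> s \<longleftrightarrow> G.has_stay S 0"
  shows "0 \<in> G.Top S \<longleftrightarrow> (if BL \<in> E then BB \<in> E \<or> 0 < d else BB \<in> E \<and> d = 0 \<and> s)"
proof (cases "BL \<in> E")
  case True
  then show ?thesis
    using G.top_if_bottom_only[OF S, of 0] G.top_iff_bump[OF S, of 0] near_bumps(1)[OF S] mem_XY
    by (cases "BB \<in> E") auto
next
  case False
  then have "0 \<in> G.Top S \<longleftrightarrow> G.has_stay S 0" using G.top_iff_stay[OF S] mem_XY by simp
  also have "\<dots> \<longleftrightarrow> BB \<in> E \<and> d = 0 \<and> s"
    using G.stay_no_bump(2,3)[OF S, of 0] near_bumps(1)[OF S] mem_XY s0 False by auto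
  finally show ?thesis using False by simp
qed

text \<open>The delicate case is that lines of label 1 enter from both sides and no line is bumped from 0 to 1.
For \<open>d = 0\<close> a stay at 0 then entails a stay at 1, as a bump would have weight 0. For \<open>d > 0\<close> it
means that the only line raised to 0 stops there, and a stay at 1 would have weight 0.\<close>

lemma near_red:
  assumes S: "G.supported S"
    and s0: "d = 0 \<Longrightarrow> 0 \<in> X \<Longrightarrow> 0 \<in> Y \<Longrightarrow> s \<longleftrightarrow> G.has_stay S 0"
    and s1: "d = 0 \<Longrightarrow> \<not> (0 \<in> X \<and> 0 \<in> Y) \<Longrightarrow> 1 \<in> X \<Longrightarrow> 1 \<in> Y \<Longrightarrow> s \<longleftrightarrow> G.has_stay S 1"
    and carry: "carry \<longleftrightarrow> of_bool (0 \<in> G.Top S) \<noteq> d + of_bool (BB \<in> E)"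
  shows "1 \<in> G.Top S \<longleftrightarrow> (if RL \<in> E then RB \<in> E \<or> carry else RB \<in> E \<and> \<not> carry \<and> d = 0 \<and> s)"
proof -
  have b0: "G.has_bump S 0 \<longleftrightarrow> carry" using near_bumps(2)[OF S] mem_XY carry by simp
  show ?thesis
  proof (cases "RL \<in> E")
    case True
    then show ?thesis
      using G.top_if_bottom_only[OF S, of 1] G.top_iff_bump[OF S, of 1] b0 mem_XY
      by (cases "RB \<in> E") auto
  next
    case False
    then have top: "1 \<in> G.Top S \<longleftrightarrow> G.has_stay S 1" using G.top_iff_stay[OF S] mem_XY by simp
    have stay1: "G.has_stay S 1 \<Longrightarrow> RB \<in> E \<and> \<not> carry"
      using G.stay_no_bump(2,3)[OF S, of 1] b0 mem_XY by auto
    have "G.has_stay S 1 \<longleftrightarrow> d = 0 \<and> s" if rb: "RB \<in> E" "\<not> carry"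
    proof (cases "d = 0")
      case d: True
      show ?thesis
      proof (cases "0 \<in> X \<and> 0 \<in> Y")
        case both: True
        then have t0: "0 \<in> G.Top S" using rb(2) d mem_XY carry by (auto simp: of_bool_def split: if_splits)
        then have st: "G.has_stay S 0" using both G.top_iff_stay[OF S] by blast
        then have "\<not> G.has_bump S 1" using G.no_bump_above_stay[OF S st] by simp
        then have "1 \<in> G.Top S" using near_bumps(3)[OF S] d t0 both rb mem_XY by (auto simp: of_bool_def split: if_splits)
        then show ?thesis using top st s0 d both by simp
      next
        case False
        then show ?thesis using s1[OF d False] d rb mem_XY \<open>RL \<notin> E\<close> by simp
      qed
    next
      case d: False
      then have "d = 1" "0 \<notin> X" "0 \<in> G.Top S"
        using rb(2) mem_XY carry by (auto simp: of_bool_def split: if_splits)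
      moreover from this have "0 \<notin> Y" using near_black[OF S s0] mem_XY by (auto split: if_splits)
      ultimately show ?thesis
        using G.no_stay_above_bump[OF S, of 1] near_bumps(1)[OF S] by simp
    qed
    then show ?thesis using False top stay1 by auto
  qed
qed

lemma near_exiting:
  assumes S: "G.supported S"
    and s0: "d = 0 \<Longrightarrow> 0 \<in> X \<Longrightarrow> 0 \<in> Y \<Longrightarrow> s \<longleftrightarrow> G.has_stay S 0"
    and s1: "d = 0 \<Longrightarrow> \<not> (0 \<in> X \<and> 0 \<in> Y) \<Longrightarrow> 1 \<in> X \<Longrightarrow> 1 \<in> Y \<Longrightarrow> s \<longleftrightarrow> G.has_stay S 1"
  shows "exiting nu mu (G.target S) = exits E d s"
proof -
  define rho where "rho = G.target S"
  note r = supported_rho[OF S, folded rho_def]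
  have bu: "BU \<in> exiting nu mu rho \<longleftrightarrow> 0 \<in> G.Top S" and ru: "RU \<in> exiting nu mu rho \<longleftrightarrow> 1 \<in> G.Top S"
    using exiting_below(1,2)[OF r] by (simp_all add: G.Top_def strip_cols_def rho_def)
  have black: "BU \<in> exiting nu mu rho \<longleftrightarrow> (if BL \<in> E then BB \<in> E \<or> 0 < d else BB \<in> E \<and> d = 0 \<and> s)"
    unfolding bu by (rule near_black[OF S]) (rule s0)
  have red: "RU \<in> exiting nu mu rho \<longleftrightarrow>
      (if RL \<in> E then RB \<in> E \<or> of_bool (BU \<in> exiting nu mu rho) \<noteq> d + of_bool (BB \<in> E)
       else RB \<in> E \<and> \<not> (of_bool (BU \<in> exiting nu mu rho) \<noteq> d + of_bool (BB \<in> E)) \<and> d = 0 \<and> s)"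
    unfolding ru
  proof (rule near_red[OF S])
    show "s = G.has_stay S 0" if "d = 0" "0 \<in> X" "0 \<in> Y" using s0 that by blast
    show "s = G.has_stay S 1" if "d = 0" "\<not> (0 \<in> X \<and> 0 \<in> Y)" "1 \<in> X" "1 \<in> Y" using s1 that by blast
    show "(of_bool (BU \<in> exiting nu mu rho) \<noteq> d + of_bool (BB \<in> E)) =
        (of_bool (0 \<in> G.Top S) \<noteq> d + of_bool (BB \<in> E))" using bu by simp
  qed
  have "x \<in> exiting nu mu rho \<longleftrightarrow> x \<in> exits E d s" for x
    unfolding exits_def Let_def black[symmetric] red[symmetric] exiting_below(3,4)[OF r, symmetric]
    by (cases x) simp_all
  then show ?thesis unfolding rho_def by blast
qed

end

end

section \<open>The law of the exiting arrows for a given input\<close>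

context input_data
begin

text \<open>For \<open>d = 0\<close> no negative label occurs on the bottom, so a smallest common label, if it is at most 1, is
0 or 1, and \<open>first_weight\<close> applies to it. If there is no such label or if \<open>d > 0\<close>, then all codes of
nonzero weight have the same exiting arrows.\<close>

lemma exit_sum:
  defines "q \<equiv> stay_chance t E (d1 lam)"
  shows "(\<Sum>S \<in> Pow G.boxes. G.weight S * of_bool (exiting nu mu (G.target S) = A)) =
    q * of_bool (exits E d True = A) + (1 - q) * of_bool (exits E d False = A)"
proof (cases "z \<le> 0 \<and> d = 0 \<and> (0 \<in> X \<and> 0 \<in> Y \<or> 1 \<in> X \<and> 1 \<in> Y)")
  case True
  then have z: "z \<le> 0" and d: "d = 0" by auto
  \<comment> \<open>The label of the one undecided meeting.\<close>
  define k :: int where "k = (if 0 \<in> X \<and> 0 \<in> Y then 0 else 1)"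
  have k: "k \<in> X" "k \<in> Y" using True by (auto simp: k_def split: if_splits)
  have first: "l \<notin> Y" if "l < k" "l \<in> X" for l
  proof -
    have "\<not> l < 0" using mem_X(1)[OF z, of l] that d by auto
    then have "l = 0" "\<not> (0 \<in> X \<and> 0 \<in> Y)" using that by (auto simp: k_def split: if_splits)
    then show ?thesis using that by blast
  qed
  define p where "p = (G.first_i k, G.first_j k)"
  have ex: "exiting nu mu (G.target S) = exits E d (p \<notin> S)" if S: "G.supported S" for S
  proof (rule near_exiting[OF z S])
    have st: "(p \<notin> S) = G.has_stay S k" using G.first_box_cases[OF S k first] by (simp add: p_def)
    then show "(p \<notin> S) = G.has_stay S 0" if "0 \<in> X" "0 \<in> Y" using that by (simp add: k_def)
    show "(p \<notin> S) = G.has_stay S 1" if "\<not> (0 \<in> X \<and> 0 \<in> Y)" using st that unfolding k_def by presburger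
  qed
  have term_eq: "G.weight S * of_bool (exiting nu mu (G.target S) = A) =
      of_bool (exits E d True = A) * (G.weight S * of_bool (p \<notin> S)) +
      of_bool (exits E d False = A) * (G.weight S - G.weight S * of_bool (p \<notin> S))" if "S \<in> Pow G.boxes" for S
  proof (cases "G.weight S = 0")
    case False
    then have "G.supported S" using that by (simp add: G.supported_def)
    then show ?thesis using ex[of S] by (cases "p \<in> S") simp_all
  qed simp
  have W: "(\<Sum>S \<in> Pow G.boxes. G.weight S * of_bool (p \<notin> S)) = q"
  proof -
    have "(if k - 1 \<in> X \<union> Y then t else (t - t ^ count_list (lam @ [z - int d]) k) / (1 - t ^ count_list (lam @ [z - int d]) k)) = q"
    proof (cases "0 \<in> X \<and> 0 \<in> Y")
      case both: True
      then have e: "BB \<in> E" using mem_XY[OF z] by simp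
      have "0 < below lam 0"
        using e interlaces_iff_below[OF Sig(1,2)] il(1) unfolding entering_below
        by (metis bot_nat_0.not_eq_extremum le_0_eq)
      moreover have "below mu 0 = below lam 0" using both mem_Y(2)[OF z, of 0] by simp
      ultimately have "filter (\<lambda>x. x \<le> 0) mu \<noteq> []" unfolding below_def by fastforce
      then obtain x where "x \<in> set mu" "x \<le> 0" unfolding filter_empty_conv by blast
      then have "- 1 \<in> Y" using z_less(1)[of x] mem_Y(1)[OF z, of "- 1"] d by simp
      then show ?thesis using both e by (simp add: k_def q_def stay_chance_def)
    next
      case False
      have c: "count_list (lam @ [z - int d]) 1 = d1 lam" using z d by (simp add: d1_def)
      show ?thesis
        unfolding q_def stay_chance_def k_def if_not_P[OF False] c
        using mem_XY[OF z] by auto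
    qed
    then show ?thesis using G.first_weight[OF k first] unfolding p_def by simp
  qed
  have "(\<Sum>S \<in> Pow G.boxes. G.weight S * of_bool (exiting nu mu (G.target S) = A)) =
      (\<Sum>S \<in> Pow G.boxes. of_bool (exits E d True = A) * (G.weight S * of_bool (p \<notin> S)) +
      of_bool (exits E d False = A) * (G.weight S - G.weight S * of_bool (p \<notin> S)))"
    by (rule sum.cong[OF refl]) (rule term_eq)
  also have "\<dots> = of_bool (exits E d True = A) * q + of_bool (exits E d False = A) * (1 - q)"
    unfolding sum.distrib sum_distrib_left[symmetric] sum_subtractf G.weight_total W ..
  finally show ?thesis by (simp only: mult.commute)
next
  case False
  have ex: "exiting nu mu (G.target S) = exits E d s" if S: "G.supported S" for S s
  proof (cases "z \<le> 0")
    case z: True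
    show ?thesis by (rule near_exiting[OF z S]) (use False z in auto)
  next
    case False
    then show ?thesis using far_exiting[OF _ S] by simp
  qed
  have "\<exists>S. G.supported S"
  proof (rule ccontr)
    assume "\<nexists>S. G.supported S"
    then have "(\<Sum>S \<in> Pow G.boxes. G.weight S) = 0" by (intro sum.neutral) (auto simp: G.supported_def)
    then show False using G.weight_total by simp
  qed
  then have same: "exits E d True = exits E d False" using ex by metis
  have "G.weight S * of_bool (exiting nu mu (G.target S) = A) =
      of_bool (exits E d True = A) * G.weight S" if "S \<in> Pow G.boxes" for S
  proof (cases "G.weight S = 0")
    case False
    then have "G.supported S" using that by (simp add: G.supported_def)
    then show ?thesis using ex[of S True] by simp
  qed simp
  then have "(\<Sum>S \<in> Pow G.boxes. G.weight S * of_bool (exiting nu mu (G.target S) = A)) =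
      (\<Sum>S \<in> Pow G.boxes. of_bool (exits E d True = A) * G.weight S)" by (rule sum.cong[OF refl])
  also have "\<dots> = of_bool (exits E d True = A)"
    unfolding sum_distrib_left[symmetric] G.weight_total by simp
  finally show ?thesis unfolding same by (simp add: algebra_simps)
qed

lemma rsk_pmf:
  obtains p :: "int list pmf" where
    "\<And>rho. pmf p rho = hlU_input t d mu rho lam nu"
    "\<And>A. measure p {rho. exiting nu mu rho = A} =
      stay_chance t E (d1 lam) * of_bool (exits E d True = A) +
      (1 - stay_chance t E (d1 lam)) * of_bool (exits E d False = A)"
proof -
  define w where "w S = (if S \<subseteq> G.boxes then G.weight S else 0)" for S
  have fin: "finite (Pow G.boxes)" by simp
  have w0: "0 \<le> w S" for S using G.weight_nonneg by (simp add: w_def)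
  have "(\<integral>\<^sup>+S. ennreal (w S) \<partial>count_space UNIV) = (\<integral>\<^sup>+S. ennreal (w S) \<partial>count_space (Pow G.boxes))"
    by (rule nn_integral_count_space_eq) (auto simp: w_def)
  also have "\<dots> = (\<Sum>S \<in> Pow G.boxes. ennreal (w S))"
    by (rule nn_integral_count_space_finite[OF fin])
  also have "\<dots> = ennreal (\<Sum>S \<in> Pow G.boxes. w S)" using w0 by (simp add: sum_ennreal)
  also have "(\<Sum>S \<in> Pow G.boxes. w S) = 1" using G.weight_total by (simp add: w_def)
  finally have w1: "(\<integral>\<^sup>+S. ennreal (w S) \<partial>count_space UNIV) = 1" by simp
  define P where "P = embed_pmf w"
  have P: "pmf P S = w S" for S unfolding P_def by (rule pmf_embed_pmf[OF w0 w1])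
  have set_P: "set_pmf P \<subseteq> Pow G.boxes" by (auto simp: set_pmf_eq P w_def split: if_splits)
  have meas: "measure P B = (\<Sum>S \<in> Pow G.boxes. G.weight S * of_bool (S \<in> B))" for B
  proof -
    have "measure P B = measure P (B \<inter> Pow G.boxes)"
    proof -
      have "B \<inter> set_pmf P = B \<inter> Pow G.boxes \<inter> set_pmf P" using set_P by blast
      then show ?thesis
        using measure_Int_set_pmf[of P B] measure_Int_set_pmf[of P "B \<inter> Pow G.boxes"] by simp
    qed
    also have "\<dots> = (\<Sum>S \<in> B \<inter> Pow G.boxes. pmf P S)"
      by (rule measure_measure_pmf_finite) (use fin in blast)
    also have "\<dots> = (\<Sum>S \<in> Pow G.boxes. G.weight S * of_bool (S \<in> B))"
      by (rule sum.mono_neutral_cong_left) (use fin in \<open>auto simp: P w_def\<close>)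
    finally show ?thesis .
  qed
  define p where "p = map_pmf (\<lambda>S. G.target S) P"
  show ?thesis
  proof
    show "pmf p rho = hlU_input t d mu rho lam nu" for rho
      unfolding hlU_input_eq G.hlU_eq_sum p_def pmf_map meas by simp
    show "measure p {rho. exiting nu mu rho = A} =
      stay_chance t E (d1 lam) * of_bool (exits E d True = A) +
      (1 - stay_chance t E (d1 lam)) * of_bool (exits E d False = A)" for A
      unfolding exit_sum[symmetric] p_def measure_map_pmf meas by simp
  qed
qed

end

lemma hlU_input_nonzero:
  assumes "hlU_input t r mu rho lam nu \<noteq> 0"
  shows "mu \<prec>s rho" "mu \<in> Sig (Suc (length lam))" "rho \<in> Sig (Suc (length lam))"
    "length nu = length lam" "nu \<prec>s rho"
proof -
  define z where "z = Min (set mu \<union> set nu) - 1"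
  have "hlU t mu rho (lam @ [z - int r]) (nu @ [z]) \<noteq> 0"
    using assms by (simp add: hlU_input_def z_def Let_def)
  then have *: "{lam @ [z - int r], mu, nu @ [z], rho} \<subseteq> Sig (Suc (length lam))"
    "mu \<prec>s rho" "nu @ [z] \<prec>s rho"
    unfolding hlU_def by (auto split: if_splits)
  then show "mu \<prec>s rho" "mu \<in> Sig (Suc (length lam))" "rho \<in> Sig (Suc (length lam))" by auto
  show "length nu = length lam" using * by (simp add: Sig_def)
  then show "nu \<prec>s rho" using * interlaces_butlast[of rho nu z] by (simp add: Sig_def)
qed

definition input_prob :: "real \<Rightarrow> real \<Rightarrow> nat \<Rightarrow> real" where
  "input_prob t x d = (1 - t * (if 1 \<le> d then 1 else 0)) * x ^ d * ((1 - x) / (1 - t * x))"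

lemma in_arrow_set_eq: "(E :: in_arrow set) = F \<longleftrightarrow>
    (BL \<in> E \<longleftrightarrow> BL \<in> F) \<and> (BB \<in> E \<longleftrightarrow> BB \<in> F) \<and> (RL \<in> E \<longleftrightarrow> RL \<in> F) \<and> (RB \<in> E \<longleftrightarrow> RB \<in> F)"
  (is "_ = ?R")
proof
  assume *: ?R
  have "x \<in> E \<longleftrightarrow> x \<in> F" for x using * by (cases x) auto
  then show "E = F" by blast
qed simp

lemma out_arrow_set_eq: "(E :: out_arrow set) = F \<longleftrightarrow>
    (BU \<in> E \<longleftrightarrow> BU \<in> F) \<and> (BR \<in> E \<longleftrightarrow> BR \<in> F) \<and> (RU \<in> E \<longleftrightarrow> RU \<in> F) \<and> (RR \<in> E \<longleftrightarrow> RR \<in> F)"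
  (is "_ = ?R")
proof
  assume *: ?R
  have "x \<in> E \<longleftrightarrow> x \<in> F" for x using * by (cases x) auto
  then show "E = F" by blast
qed simp

lemma stay_chance_range:
  assumes "0 \<le> t" "t < 1"
  shows "0 \<le> stay_chance t E k" "stay_chance t E k \<le> 1"
proof -
  have "0 \<le> (t - t ^ k) / (1 - t ^ k) \<and> (t - t ^ k) / (1 - t ^ k) \<le> 1"
  proof (cases k)
    case (Suc k')
    have "t ^ k \<le> t ^ 1" by (rule power_decreasing) (use assms Suc in auto)
    then show ?thesis using assms by (simp add: field_simps)
  qed simp
  then show "0 \<le> stay_chance t E k" "stay_chance t E k \<le> 1" using assms by (auto simp: stay_chance_def)
qed

lemma exits_many: "2 \<le> d \<Longrightarrow> exits E d s = exits E 2 s"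
  unfolding exits_def Let_def by (auto simp: of_bool_def)

section \<open>Averaging over the input\<close>

text \<open>The three coefficients are the probabilities that the input is 0, is 1, and is at least 2. The rows of
the table are of five kinds: no choice at all (\<open>sure\<close>), a choice between zero and positive input
(\<open>push\<close>), one with a coin toss for input zero (\<open>coin\<close>, \<open>far\<close>), and the row where inputs 1 and 2
differ (\<open>steps\<close>). The premise on \<open>k\<close> prevents \<open>1 - t ^ k\<close> from vanishing in the only row that uses it.\<close>

lemma vertex_prob_average:
  fixes t x :: real and E :: "in_arrow set" and A :: "out_arrow set" and k :: nat
  assumes t: "0 \<le> t" "t < 1" and x: "0 < x" "x < 1"
    and k: "BL \<in> E \<Longrightarrow> BB \<notin> E \<Longrightarrow> RL \<notin> E \<Longrightarrow> RB \<in> E \<Longrightarrow> 1 \<le> k"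
  defines "q \<equiv> stay_chance t E k"
  defines "f \<equiv> \<lambda>d. q * of_bool (exits E d True = A) + (1 - q) * of_bool (exits E d False = A)"
  shows "vertex_prob t x k E A =
    (1 - x) / (1 - t * x) * f 0 + (1 - t) * x * (1 - x) / (1 - t * x) * f 1 + (1 - t) * x ^ 2 / (1 - t * x) * f 2"
proof -
  have "t * x < 1" using t x mult_strict_mono[of t 1 x 1] by simp
  define D where "D = 1 - t * x"
  have D: "D \<noteq> 0" using \<open>t * x < 1\<close> by (simp add: D_def)
  define P0 P1 P2 where "P0 = (1 - x) / D" and "P1 = (1 - t) * x * (1 - x) / D" and "P2 = (1 - t) * x ^ 2 / D"
  have sum12: "(1 - t) * x / D = P1 + P2"
    by (simp add: P1_def P2_def power2_eq_square field_simps add_divide_distrib[symmetric])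
  have tP: "t * (1 - x) / D = t * P0" by (simp add: P0_def)
  have rest: "(1 - t) / D = (1 - t) * P0 + P1 + P2"
    by (simp add: P0_def P1_def P2_def power2_eq_square field_simps add_divide_distrib[symmetric])
  have one: "P0 + P1 + P2 = 1"
  proof -
    have "(1 - x) + (1 - t) * x * (1 - x) + (1 - t) * x ^ 2 = D"
      by (simp add: D_def power2_eq_square algebra_simps)
    then show ?thesis using D by (simp add: P0_def P1_def P2_def add_divide_distrib[symmetric])
  qed
  have tk: "1 - (t - t ^ k) / (1 - t ^ k) = (1 - t) / (1 - t ^ k)" if "1 \<le> k"
  proof -
    have "t ^ k \<le> t ^ 1" by (rule power_decreasing) (use t that in auto)
    then have "1 - t ^ k \<noteq> 0" using t by simp
    then show ?thesis by (simp add: field_simps)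
  qed
  have mix: "q * b + (1 - q) * b = b" for b by (simp add: algebra_simps)
  have sure: "lookup_prob [(S, 1)] A = P0 * f 0 + P1 * f 1 + P2 * f 2"
    if "\<And>s. exits E 0 s = S" "\<And>s. exits E 1 s = S" "\<And>s. exits E 2 s = S" for S
  proof -
    have "lookup_prob [(S, 1)] A = (P0 + P1 + P2) * of_bool (S = A)"
      unfolding one by (auto simp: lookup_prob_def)
    then show ?thesis unfolding f_def that mix by (simp only: distrib_right)
  qed
  have push: "lookup_prob [(S, P0), (S', P1 + P2)] A = P0 * f 0 + P1 * f 1 + P2 * f 2"
    if "S \<noteq> S'" "\<And>s. exits E 0 s = S" "\<And>s. exits E 1 s = S'" "\<And>s. exits E 2 s = S'" for S S'
  proof -
    have "lookup_prob [(S, P0), (S', P1 + P2)] A = P0 * of_bool (S = A) + (P1 + P2) * of_bool (S' = A)"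
      using that(1) by (auto simp: lookup_prob_def)
    then show ?thesis unfolding f_def that(2-) mix by (simp add: algebra_simps)
  qed
  have coin: "lookup_prob [(S, t * P0), (S', (1 - t) * P0 + P1 + P2)] A = P0 * f 0 + P1 * f 1 + P2 * f 2"
    if "S \<noteq> S'" "q = t" "exits E 0 True = S" "exits E 0 False = S'" "\<And>s. exits E 1 s = S'" "\<And>s. exits E 2 s = S'" for S S'
  proof -
    have "lookup_prob [(S, t * P0), (S', (1 - t) * P0 + P1 + P2)] A =
        t * P0 * of_bool (S = A) + ((1 - t) * P0 + P1 + P2) * of_bool (S' = A)"
      using that(1) by (auto simp: lookup_prob_def)
    then show ?thesis unfolding f_def that(2-) by (simp add: algebra_simps)
  qed
  have far: "lookup_prob [(S', P0 * ((1 - t) / (1 - t ^ k))), (S, P0 * ((t - t ^ k) / (1 - t ^ k))), (S'', P1 + P2)] A =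
      P0 * f 0 + P1 * f 1 + P2 * f 2"
    if "S \<noteq> S'" "S \<noteq> S''" "S' \<noteq> S''" "q = (t - t ^ k) / (1 - t ^ k)" "1 \<le> k"
      "exits E 0 True = S" "exits E 0 False = S'" "\<And>s. exits E 1 s = S''" "\<And>s. exits E 2 s = S''" for S S' S''
  proof -
    have "lookup_prob [(S', P0 * ((1 - t) / (1 - t ^ k))), (S, P0 * ((t - t ^ k) / (1 - t ^ k))), (S'', P1 + P2)] A =
        P0 * (1 - q) * of_bool (S' = A) + P0 * q * of_bool (S = A) + (P1 + P2) * of_bool (S'' = A)"
      using that(1-3) unfolding that(4) tk[OF that(5)] by (auto simp: lookup_prob_def)
    then show ?thesis unfolding f_def that(6-) mix by (simp add: algebra_simps)
  qed
  have steps: "lookup_prob [(S, P0), (S', P1), (S'', P2)] A = P0 * f 0 + P1 * f 1 + P2 * f 2"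
    if "S \<noteq> S'" "S \<noteq> S''" "S' \<noteq> S''" "\<And>s. exits E 0 s = S" "\<And>s. exits E 1 s = S'" "\<And>s. exits E 2 s = S''" for S S' S''
  proof -
    have "lookup_prob [(S, P0), (S', P1), (S'', P2)] A =
        P0 * of_bool (S = A) + P1 * of_bool (S' = A) + P2 * of_bool (S'' = A)"
      using that(1-3) by (auto simp: lookup_prob_def)
    then show ?thesis unfolding f_def that(4-) mix .
  qed
  \<comment> \<open>The case split on \<open>E\<close> selects the row, whose shape tells which of the five kinds it is.\<close>
  show ?thesis
    unfolding D_def[symmetric] P0_def[symmetric] P1_def[symmetric] P2_def[symmetric]
      vertex_prob_def sum12 tP rest
    by (insert k, cases "BL \<in> E"; cases "BB \<in> E"; cases "RL \<in> E"; cases "RB \<in> E";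
        simp only: in_arrow_set_eq[of E] insert_iff empty_iff in_arrow.distinct simp_thms if_True if_False;
        (rule sure | rule push | rule coin | rule far | rule steps);
        simp add: exits_def out_arrow_set_eq q_def stay_chance_def)
qed

section \<open>Factorization of the field\<close>

lemma input_average:
  fixes g :: "nat \<Rightarrow> real"
  assumes t: "0 \<le> t" "t < 1" and x: "0 < x" "x < 1" and g: "\<And>d. 2 \<le> d \<Longrightarrow> g d = g 2" "\<And>d. 0 \<le> g d"
  shows "(\<integral>\<^sup>+d. ennreal (input_prob t x d) * ennreal (g d) \<partial>count_space UNIV) =
    ennreal ((1 - x) / (1 - t * x) * g 0 + (1 - t) * x * (1 - x) / (1 - t * x) * g 1 + (1 - t) * x ^ 2 / (1 - t * x) * g 2)"
proof -
  have "t * x < 1" using t x mult_strict_mono[of t 1 x 1] by simp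
  then have nn: "0 \<le> input_prob t x d" for d using t x by (auto simp: input_prob_def)
  define c where "c = (1 - t) * ((1 - x) / (1 - t * x)) * g 2 * x ^ 2"
  have s0: "(\<lambda>d. c * x ^ d) sums (c * (1 / (1 - x)))"
    by (rule sums_mult) (use geometric_sums[of x] x in simp)
  have e1: "c * x ^ d = input_prob t x (d + 2) * g (d + 2)" for d
    using g(1)[of "d + 2"] by (simp add: input_prob_def c_def power_add power2_eq_square mult_ac)
  have e2: "c * (1 / (1 - x)) = (1 - t) * x ^ 2 / (1 - t * x) * g 2"
    using x by (simp add: c_def)
  have "(\<lambda>d. input_prob t x d * g d) sums
      ((1 - t) * x ^ 2 / (1 - t * x) * g 2 + (\<Sum>d<2. input_prob t x d * g d))"
    using s0 unfolding e1 e2 sums_iff_shift[of "\<lambda>d. input_prob t x d * g d" 2] .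
  moreover have "(\<Sum>d<2. input_prob t x d * g d) =
      (1 - x) / (1 - t * x) * g 0 + (1 - t) * x * (1 - x) / (1 - t * x) * g 1"
    by (simp add: input_prob_def numeral_2_eq_2)
  ultimately have s: "(\<lambda>d. input_prob t x d * g d) sums
      ((1 - x) / (1 - t * x) * g 0 + (1 - t) * x * (1 - x) / (1 - t * x) * g 1 + (1 - t) * x ^ 2 / (1 - t * x) * g 2)"
    by (simp add: add_ac)
  have "(\<integral>\<^sup>+d. ennreal (input_prob t x d) * ennreal (g d) \<partial>count_space UNIV) =
      (\<Sum>d. ennreal (input_prob t x d * g d))"
    unfolding nn_integral_count_space_nat using nn g(2) by (simp add: ennreal_mult)
  also have "\<dots> = ennreal (\<Sum>d. input_prob t x d * g d)"
    by (rule suminf_ennreal2) (use nn g(2) s in \<open>auto simp: sums_iff\<close>)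
  finally show ?thesis using s by (simp add: sums_iff)
qed

lemma (in prob_space) emeasure_partition:
  assumes "countable I" "\<And>\<omega>. \<omega> \<in> space M \<Longrightarrow> X \<omega> \<in> I"
    and "\<And>x. x \<in> I \<Longrightarrow> {\<omega> \<in> space M. X \<omega> = x} \<in> events" and A: "A \<in> events"
  shows "emeasure M A = (\<integral>\<^sup>+x. emeasure M (A \<inter> {\<omega> \<in> space M. X \<omega> = x}) \<partial>count_space I)"
proof -
  have "A = (\<Union>x\<in>I. A \<inter> {\<omega> \<in> space M. X \<omega> = x})"
    using assms(2) sets.sets_into_space[OF A] by auto
  then have "emeasure M A = emeasure M (\<Union>x\<in>I. A \<inter> {\<omega> \<in> space M. X \<omega> = x})" by simp
  also have "\<dots> = (\<integral>\<^sup>+x. emeasure M (A \<inter> {\<omega> \<in> space M. X \<omega> = x}) \<partial>count_space I)"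
    by (rule emeasure_UN_countable) (use assms in \<open>auto simp: disjoint_family_on_def\<close>)
  finally show ?thesis .
qed

definition cells :: "nat \<Rightarrow> (nat \<times> nat) set" where
  "cells m = {(i, j). 1 \<le> i \<and> 1 \<le> j \<and> i + j \<le> m}"

lemma finite_cells: "finite (cells m)"
  by (rule finite_subset[of _ "{..m} \<times> {..m}"]) (auto simp: cells_def)

lemma finite_antidiag: "finite (antidiag m)"
  by (rule finite_subset[of _ "{..m} \<times> {..m}"]) (auto simp: antidiag_def)

lemma finite_triangle: "finite {(i, j). i + j < (n::nat)}"
  by (rule finite_subset[of _ "{..n} \<times> {..n}"]) auto

locale rsk_field = HL_RSK_field t a b M r \<Lambda>
  for t :: real and a b :: "nat \<Rightarrow> real" and M :: "'w measure"
    and r :: "nat \<Rightarrow> nat \<Rightarrow> 'w \<Rightarrow> nat" and \<Lambda> :: "nat \<Rightarrow> nat \<Rightarrow> 'w \<Rightarrow> int list" +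
  assumes t0: "0 \<le> t" and t1: "t < 1"
    and a_pos: "\<And>i. 1 \<le> i \<Longrightarrow> 0 < a i" and b_pos: "\<And>j. 1 \<le> j \<Longrightarrow> 0 < b j"
    and ab: "\<And>i j. 1 \<le> i \<Longrightarrow> 1 \<le> j \<Longrightarrow> a i * b j < 1"
begin

definition "past n l = {\<omega> \<in> space M. \<forall>i j. i + j < n \<longrightarrow> \<Lambda> i j \<omega> = l i j}"
definition "inputs m s = {\<omega> \<in> space M. \<forall>i j. 1 \<le> i \<and> 1 \<le> j \<and> i + j \<le> m \<longrightarrow> r i j \<omega> = s i j}"
definition "diagonal n l = {\<omega> \<in> space M. \<forall>(i, j) \<in> antidiag n. \<Lambda> i j \<omega> = l i j}"
definition "step_prob n l s =
  (\<Prod>(i, j) \<in> antidiag n. hlU_input t (s i j) (l (i - 1) j) (l i j) (l (i - 1) (j - 1)) (l i (j - 1)))"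

lemma r_measurable: "1 \<le> i \<Longrightarrow> 1 \<le> j \<Longrightarrow> r i j \<in> measurable M (count_space UNIV)"
  using inputs_indep unfolding indep_vars_def by auto

lemma Lam_event: "{\<omega> \<in> space M. \<Lambda> i j \<omega> = c} \<in> events"
  using measurable_sets[OF field_measurable[of i j], of "{c}"] by (simp add: vimage_def Int_def conj_commute)

lemma r_event: "1 \<le> i \<Longrightarrow> 1 \<le> j \<Longrightarrow> {\<omega> \<in> space M. r i j \<omega> = c} \<in> events"
  using measurable_sets[OF r_measurable[of i j], of "{c}"] by (simp add: vimage_def Int_def conj_commute)

lemma finite_Lam_event:
  assumes "finite D" shows "{\<omega> \<in> space M. \<forall>p\<in>D. \<Lambda> (fst p) (snd p) \<omega> = c p} \<in> events"
  by (rule sets.sets_Collect_finite_All[OF Lam_event assms])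

lemma finite_r_event:
  assumes "finite D" "\<And>p. p \<in> D \<Longrightarrow> 1 \<le> fst p \<and> 1 \<le> snd p"
  shows "{\<omega> \<in> space M. \<forall>p\<in>D. r (fst p) (snd p) \<omega> = c p} \<in> events"
  by (rule sets.sets_Collect_finite_All[OF r_event assms(1)]) (use assms(2) in auto)

lemma past_event: "past n l \<in> events"
proof -
  have eq: "past n l = {\<omega> \<in> space M. \<forall>p\<in>{(i, j). i + j < n}. \<Lambda> (fst p) (snd p) \<omega> = case_prod l p}"
    by (auto simp: past_def)
  show ?thesis unfolding eq by (rule finite_Lam_event[OF finite_triangle])
qed

lemma inputs_event: "inputs m s \<in> events"
proof -
  have eq: "inputs m s = {\<omega> \<in> space M. \<forall>p\<in>cells m. r (fst p) (snd p) \<omega> = case_prod s p}"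
    by (auto simp: inputs_def cells_def)
  show ?thesis unfolding eq by (rule finite_r_event[OF finite_cells]) (auto simp: cells_def)
qed

lemma diagonal_step:
  assumes "n \<le> m"
  shows "prob (diagonal n l \<inter> (past n l \<inter> inputs m s)) = step_prob n l s * prob (past n l \<inter> inputs m s)"
proof (cases "prob (past n l \<inter> inputs m s) = 0")
  case True
  have "prob (diagonal n l \<inter> (past n l \<inter> inputs m s)) \<le> prob (past n l \<inter> inputs m s)"
    by (rule finite_measure_mono) (use past_event inputs_event in auto)
  then show ?thesis using True measure_nonneg[of M] by (metis antisym mult_zero_right)
next
  case False
  then have pos: "0 < prob (past n l \<inter> inputs m s)" using measure_nonneg[of M] by (metis less_eq_real_def)
  have e1: "past n l \<inter> inputs m s = {\<omega> \<in> space M. (\<forall>i j. i + j < n \<longrightarrow> \<Lambda> i j \<omega> = l i j) \<and>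
      (\<forall>i j. 1 \<le> i \<and> 1 \<le> j \<and> i + j \<le> m \<longrightarrow> r i j \<omega> = s i j)}"
    by (auto simp: past_def inputs_def)
  have e2: "diagonal n l \<inter> (past n l \<inter> inputs m s) = {\<omega> \<in> space M. (\<forall>(i, j) \<in> antidiag n. \<Lambda> i j \<omega> = l i j) \<and>
      (\<forall>i j. i + j < n \<longrightarrow> \<Lambda> i j \<omega> = l i j) \<and>
      (\<forall>i j. 1 \<le> i \<and> 1 \<le> j \<and> i + j \<le> m \<longrightarrow> r i j \<omega> = s i j)}"
    unfolding e1 diagonal_def by blast
  have "prob (diagonal n l \<inter> (past n l \<inter> inputs m s)) / prob (past n l \<inter> inputs m s) = step_prob n l s"
    using field_step[OF assms pos[unfolded e1]] unfolding cond_prob_def step_prob_def e2 unfolding e1 .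
  then show ?thesis using pos by (simp add: field_simps)
qed

lemma past_Suc:
  "past (Suc n) l = (if l n 0 = [] \<and> l 0 n = replicate n 0 then diagonal n l \<inter> past n l else {})"
proof -
  have split: "(\<forall>i j. i + j < Suc n \<longrightarrow> P i j) \<longleftrightarrow>
      (\<forall>i j. i + j < n \<longrightarrow> P i j) \<and> (\<forall>(i, j) \<in> antidiag n. P i j) \<and> P n 0 \<and> P 0 n" for P
  proof
    assume "\<forall>i j. i + j < Suc n \<longrightarrow> P i j"
    then show "(\<forall>i j. i + j < n \<longrightarrow> P i j) \<and> (\<forall>(i, j) \<in> antidiag n. P i j) \<and> P n 0 \<and> P 0 n"
      by (auto simp: antidiag_def)
  next
    assume *: "(\<forall>i j. i + j < n \<longrightarrow> P i j) \<and> (\<forall>(i, j) \<in> antidiag n. P i j) \<and> P n 0 \<and> P 0 n"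
    show "\<forall>i j. i + j < Suc n \<longrightarrow> P i j"
    proof (intro allI impI)
      fix i j assume "i + j < Suc n"
      then have "i + j < n \<or> i = n \<and> j = 0 \<or> i = 0 \<and> j = n \<or> (i, j) \<in> antidiag n"
        unfolding antidiag_def by (simp add: less_Suc_eq) arith
      then show "P i j" using * by auto
    qed
  qed
  have "past (Suc n) l = {\<omega> \<in> space M. \<omega> \<in> past n l \<and> \<omega> \<in> diagonal n l \<and> \<Lambda> n 0 \<omega> = l n 0 \<and> \<Lambda> 0 n \<omega> = l 0 n}"
    unfolding past_def diagonal_def split by auto
  also have "\<dots> = {\<omega> \<in> space M. \<omega> \<in> past n l \<and> \<omega> \<in> diagonal n l \<and> [] = l n 0 \<and> replicate n 0 = l 0 n}"
    using field_bottom field_left by (intro Collect_cong) auto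
  finally show ?thesis by (auto simp: past_def diagonal_def)
qed

text \<open>Iteration of the sampling rule. The weight of antidiagonal \<open>k\<close> involves only the inputs on this
antidiagonal, and the conditions on \<open>l k 0\<close> and \<open>l 0 k\<close> are the boundary values of the field.\<close>

lemma past_inputs:
  assumes "n \<le> Suc m"
  shows "prob (past n l \<inter> inputs m s) =
    (\<Prod>k<n. if l k 0 = [] \<and> l 0 k = replicate k 0 then step_prob k l s else 0) * prob (inputs m s)"
  using assms
proof (induction n)
  case 0
  have "past 0 l = space M" by (simp add: past_def)
  then have "past 0 l \<inter> inputs m s = inputs m s"
    using sets.sets_into_space[OF inputs_event] by blast
  then show ?case by simp
next
  case (Suc n)
  have "prob (past (Suc n) l \<inter> inputs m s) =
      (if l n 0 = [] \<and> l 0 n = replicate n 0 then step_prob n l s else 0) * prob (past n l \<inter> inputs m s)"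
    using diagonal_step[of n m l s] Suc.prems unfolding past_Suc by (simp add: Int_assoc)
  then show ?case using Suc by simp
qed

end

section \<open>Independence of the input and the past\<close>

context rsk_field
begin

lemma a_b: "1 \<le> i \<Longrightarrow> 1 \<le> j \<Longrightarrow> 0 < a i * b j \<and> a i * b j < 1"
  using a_pos b_pos ab by simp

abbreviation "input_is i j d \<equiv> {\<omega> \<in> space M. r i j \<omega> = d}"
abbreviation "Lam_in i j R \<equiv> {\<omega> \<in> space M. \<Lambda> i j \<omega> \<in> R}"
abbreviation "input_law i j \<equiv> input_prob t (a i * b j)"

lemma prob_input: "1 \<le> i \<Longrightarrow> 1 \<le> j \<Longrightarrow> prob (input_is i j d) = input_law i j d"
  using inputs_law[of i j d] by (simp add: input_prob_def mult.assoc)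

text \<open>The properties that the field has almost surely at a cell and that make the next sampling step
well-defined.\<close>

definition good :: "(nat \<Rightarrow> nat \<Rightarrow> int list) \<Rightarrow> nat \<Rightarrow> nat \<Rightarrow> bool" where
  "good l i j \<longleftrightarrow> l i j \<in> Sig j \<and> (\<forall>x \<in> set (l i j). 0 \<le> x) \<and>
  (0 < i \<longrightarrow> l (i - 1) j \<prec>s l i j) \<and> (0 < j \<longrightarrow> l i (j - 1) \<prec>s l i j)"

text \<open>Any violation would give a sampling step of weight zero.\<close>

lemma good_atom:
  assumes pos: "prob (past n l \<inter> inputs m s) \<noteq> 0" and nm: "n \<le> Suc m"
  shows "i + j < n \<Longrightarrow> good l i j"
proof (induction "i + j" arbitrary: i j rule: less_induct)
  case less
  have "(\<Prod>k<n. if l k 0 = [] \<and> l 0 k = replicate k 0 then step_prob k l s else 0) \<noteq> 0"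
    using pos unfolding past_inputs[OF nm] by auto
  then have nz: "l k 0 = [] \<and> l 0 k = replicate k 0 \<and> step_prob k l s \<noteq> 0" if "k < n" for k
    using that by (auto simp: prod_zero_iff split: if_splits)
  have left: "l 0 k = replicate k 0" and bot: "l k 0 = []" if "k < n" for k using nz that by auto
  show ?case
  proof (cases "i = 0 \<or> j = 0")
    case True
    then show ?thesis
      using left[of j] left[of "j - 1"] bot[of i] bot[of "i - 1"] less.prems
      by (auto simp: good_def Sig_def interlaces_def sorted_wrt_iff_nth_less)
  next
    case False
    then have ij: "1 \<le> i" "1 \<le> j" by auto
    have "step_prob (i + j) l s \<noteq> 0" using nz less.prems by simp
    then have h: "hlU_input t (s i j) (l (i - 1) j) (l i j) (l (i - 1) (j - 1)) (l i (j - 1)) \<noteq> 0"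
      unfolding step_prob_def using finite_antidiag ij by (auto simp: prod_zero_iff antidiag_def)
    have lam: "good l (i - 1) (j - 1)" and mu: "good l (i - 1) j"
      using less ij by auto
    note h = hlU_input_nonzero[OF h]
    have len: "Suc (length (l (i - 1) (j - 1))) = j" using lam ij by (simp add: good_def Sig_def)
    have "0 \<le> x" if "x \<in> set (l i j)" for x
    proof -
      obtain k where k: "k < length (l i j)" "x = l i j ! k" using \<open>x \<in> set (l i j)\<close> by (auto simp: in_set_conv_nth)
      have "length (l i j) = length (l (i - 1) j)" using h(2,3) by (simp add: Sig_def)
      then have "l (i - 1) j ! k \<le> x" "l (i - 1) j ! k \<in> set (l (i - 1) j)"
        using h(1) k by (auto simp: interlaces_def)
      then show ?thesis using mu unfolding good_def by fastforce
    qed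
    then show ?thesis using h len by (simp add: good_def)
  qed
qed

lemma good_input_data:
  assumes "good l (i - 1) (j - 1)" "good l i (j - 1)" "good l (i - 1) j" "1 \<le> i" "1 \<le> j"
  shows "input_data t (j - 1) (l (i - 1) (j - 1)) (l (i - 1) j) (l i (j - 1))"
proof -
  have p: "0 < i" "0 < j" "Suc (j - 1) = j" using assms(4,5) by auto
  show ?thesis
    unfolding input_data_def p(3) using assms(1-3) p(1,2) t0 t1 unfolding good_def by blast
qed

definition "corner n = {(i, j). i + j < (n::nat)}"

text \<open>The part of the field and of the inputs on which cells of antidiagonal \<open>n\<close> depend. It has countably
many values, so that events can be split according to it.\<close>

definition "atom_of n \<omega> =
  (restrict (\<lambda>p. \<Lambda> (fst p) (snd p) \<omega>) (corner n), restrict (\<lambda>p. r (fst p) (snd p) \<omega>) (cells n))"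
definition "atom_space n = PiE (corner n) (\<lambda>_. UNIV :: int list set) \<times> PiE (cells n) (\<lambda>_. UNIV :: nat set)"

abbreviation "atom n c \<equiv> {\<omega> \<in> space M. atom_of n \<omega> = c}"

lemma countable_atom_space: "countable (atom_space n)"
  unfolding atom_space_def corner_def
  by (intro countable_SIGMA countable_PiE finite_triangle finite_cells) auto

lemma atom_of_mem: "atom_of n \<omega> \<in> atom_space n"
  by (auto simp: atom_of_def atom_space_def)

lemma atom_eq:
  assumes "c \<in> atom_space n"
  shows "atom n c = past n (curry (fst c)) \<inter> inputs n (curry (snd c))"
proof -
  have "atom_of n \<omega> = c \<longleftrightarrow> (\<forall>i j. i + j < n \<longrightarrow> \<Lambda> i j \<omega> = fst c (i, j)) \<and>
      (\<forall>i j. 1 \<le> i \<and> 1 \<le> j \<and> i + j \<le> n \<longrightarrow> r i j \<omega> = snd c (i, j))" for \<omega>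
  proof -
    have "restrict (\<lambda>p. \<Lambda> (fst p) (snd p) \<omega>) (corner n) = fst c \<longleftrightarrow> (\<forall>p \<in> corner n. \<Lambda> (fst p) (snd p) \<omega> = fst c p)"
      using assms by (auto simp: atom_space_def PiE_def extensional_def fun_eq_iff restrict_def)
    moreover have "restrict (\<lambda>p. r (fst p) (snd p) \<omega>) (cells n) = snd c \<longleftrightarrow> (\<forall>p \<in> cells n. r (fst p) (snd p) \<omega> = snd c p)"
      using assms by (auto simp: atom_space_def PiE_def extensional_def fun_eq_iff restrict_def)
    ultimately show ?thesis by (auto simp: atom_of_def prod_eq_iff corner_def cells_def)
  qed
  then show ?thesis by (auto simp: past_def inputs_def)
qed

lemma atom_event: "c \<in> atom_space n \<Longrightarrow> (atom n c) \<in> events"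
  unfolding atom_eq using past_event inputs_event by blast

lemma emeasure_atoms:
  "A \<in> events \<Longrightarrow> emeasure M A = (\<integral>\<^sup>+c. emeasure M (A \<inter> atom n c) \<partial>count_space (atom_space n))"
  by (rule emeasure_partition) (use countable_atom_space atom_of_mem atom_event in auto)

lemma AE_good: "AE \<omega> in M. good (\<lambda>i j. \<Lambda> i j \<omega>) i j"
proof -
  define n where "n = Suc (i + j)"
  have "AE \<omega> in M. atom_of n \<omega> = c \<longrightarrow> good (\<lambda>i j. \<Lambda> i j \<omega>) i j" if c: "c \<in> atom_space n" for c
  proof (cases "prob (atom n c) = 0")
    case True
    then have "(atom n c) \<in> null_sets M"
      using atom_event[OF c] by (simp add: null_sets_def emeasure_eq_measure)
    then have "AE \<omega> in M. \<omega> \<notin> (atom n c)" by (rule AE_not_in)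
    then show ?thesis by (rule AE_mp) (rule AE_I2, auto)
  next
    case False
    then have g: "good (curry (fst c)) i' j'" if "i' + j' < n" for i' j'
      using good_atom[of n "curry (fst c)" n "curry (snd c)"] that unfolding atom_eq[OF c] by simp
    show ?thesis
    proof (rule AE_I2, rule impI)
      fix \<omega> assume "\<omega> \<in> space M" "atom_of n \<omega> = c"
      then have "\<omega> \<in> past n (curry (fst c))" using atom_eq[OF c] by auto
      then have "\<Lambda> i' j' \<omega> = curry (fst c) i' j'" if "i' + j' < n" for i' j'
        using that unfolding past_def by blast
      then show "good (\<lambda>i j. \<Lambda> i j \<omega>) i j"
        using g[of i j] unfolding good_def n_def by (cases "0 < i"; cases "0 < j") auto
    qed
  qed
  then have "AE \<omega> in M. \<forall>c \<in> atom_space n. atom_of n \<omega> = c \<longrightarrow> good (\<lambda>i j. \<Lambda> i j \<omega>) i j"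
    unfolding AE_ball_countable[OF countable_atom_space] by (intro ballI)
  then show ?thesis by (rule AE_mp) (rule AE_I2, use atom_of_mem in blast)
qed

lemma prob_inputs:
  assumes "(i, j) \<in> cells m"
  shows "prob (inputs m s) = (\<Prod>p\<in>cells m. prob {\<omega> \<in> space M. r (fst p) (snd p) \<omega> = s (fst p) (snd p)})"
proof -
  have "inputs m s = (\<Inter>p\<in>cells m. case_prod r p -` {case_prod s p} \<inter> space M)"
    using assms by (auto simp: inputs_def cells_def)
  also have "prob \<dots> = (\<Prod>p\<in>cells m. prob (case_prod r p -` {case_prod s p} \<inter> space M))"
    by (rule indep_varsD[OF inputs_indep]) (use assms finite_cells in \<open>auto simp: cells_def\<close>)
  also have "\<dots> = (\<Prod>p\<in>cells m. prob {\<omega> \<in> space M. r (fst p) (snd p) \<omega> = s (fst p) (snd p)})"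
    by (intro prod.cong refl arg_cong[where f = prob]) auto
  finally show ?thesis .
qed

text \<open>The weights of the antidiagonals before \<open>i + j\<close> do not contain the input of cell \<open>(i, j)\<close>. So the
joint probability with all inputs is \<open>input_law i j d\<close> times a factor \<open>K\<close> that does not depend on
\<open>d\<close>, and summing over \<open>d\<close> identifies the sum of these factors.\<close>

lemma past_indep_input:
  assumes ij: "1 \<le> i" "1 \<le> j"
  shows "emeasure M (past (i + j) l \<inter> input_is i j d) =
    ennreal (input_law i j d) * emeasure M (past (i + j) l)"
proof -
  define n where "n = i + j"
  define Q where "Q = cells n - {(i, j)}"
  define I where "I = PiE Q (\<lambda>_. UNIV :: nat set)"
  define X where "X \<omega> = restrict (\<lambda>p. r (fst p) (snd p) \<omega>) Q" for \<omega>
  have cell: "(i, j) \<in> cells n" using ij by (simp add: cells_def n_def)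
  have finQ: "finite Q" using finite_cells by (simp add: Q_def)
  have cI: "countable I" unfolding I_def by (rule countable_PiE[OF finQ]) auto
  have XI: "X \<omega> \<in> I" for \<omega> by (auto simp: X_def I_def)
  have Xeq: "X \<omega> = s \<longleftrightarrow> (\<forall>p \<in> Q. r (fst p) (snd p) \<omega> = s p)" if "s \<in> I" for s \<omega>
    using that by (auto simp: I_def X_def PiE_def extensional_def fun_eq_iff restrict_def)
  have XE: "{\<omega> \<in> space M. X \<omega> = s} \<in> events" if "s \<in> I" for s
    unfolding Xeq[OF that] by (rule finite_r_event[OF finQ]) (auto simp: Q_def cells_def)
  define K where "K s = (\<Prod>k<n. if l k 0 = [] \<and> l 0 k = replicate k 0 then step_prob k l (curry s) else 0) *
      (\<Prod>p\<in>Q. prob {\<omega> \<in> space M. r (fst p) (snd p) \<omega> = s p})" for s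
  have joint: "prob (past n l \<inter> input_is i j d \<inter> {\<omega> \<in> space M. X \<omega> = s}) =
      input_law i j d * K s" if s: "s \<in> I" for s d
  proof -
    \<comment> \<open>All inputs up to antidiagonal \<open>n\<close>, with the one of the cell singled out.\<close>
    define s' where "s' = s((i, j) := d)"
    have "past n l \<inter> input_is i j d \<inter> {\<omega> \<in> space M. X \<omega> = s} = past n l \<inter> inputs n (curry s')"
    proof -
      have ins: "cells n = insert (i, j) Q" using cell by (auto simp: Q_def)
      have "s' p = s p" if "p \<in> Q" for p using that by (auto simp: s'_def Q_def)
      then have "(\<forall>p\<in>cells n. r (fst p) (snd p) \<omega> = s' p) \<longleftrightarrow>
          r i j \<omega> = d \<and> (\<forall>p \<in> Q. r (fst p) (snd p) \<omega> = s p)" for \<omega>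
        unfolding ins by (simp add: s'_def)
      moreover have "inputs n (curry s') = {\<omega> \<in> space M. \<forall>p\<in>cells n. r (fst p) (snd p) \<omega> = s' p}"
        by (auto simp: inputs_def cells_def)
      ultimately show ?thesis unfolding Xeq[OF s] by auto
    qed
    then have "prob (past n l \<inter> input_is i j d \<inter> {\<omega> \<in> space M. X \<omega> = s}) =
        (\<Prod>k<n. if l k 0 = [] \<and> l 0 k = replicate k 0 then step_prob k l (curry s') else 0) * prob (inputs n (curry s'))"
      using past_inputs[of n n l "curry s'"] by simp
    also have "(\<Prod>k<n. if l k 0 = [] \<and> l 0 k = replicate k 0 then step_prob k l (curry s') else 0) =
        (\<Prod>k<n. if l k 0 = [] \<and> l 0 k = replicate k 0 then step_prob k l (curry s) else 0)"
    proof (rule prod.cong[OF refl])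
      fix k assume "k \<in> {..<n}"
      then have "step_prob k l (curry s') = step_prob k l (curry s)"
        unfolding step_prob_def by (intro prod.cong) (auto simp: antidiag_def n_def s'_def)
      then show "(if l k 0 = [] \<and> l 0 k = replicate k 0 then step_prob k l (curry s') else 0) =
          (if l k 0 = [] \<and> l 0 k = replicate k 0 then step_prob k l (curry s) else 0)" by simp
    qed
    also have "prob (inputs n (curry s')) = input_law i j d *
        (\<Prod>p\<in>Q. prob {\<omega> \<in> space M. r (fst p) (snd p) \<omega> = s p})"
    proof -
      have "prob (inputs n (curry s')) = (\<Prod>p\<in>cells n. prob {\<omega> \<in> space M. r (fst p) (snd p) \<omega> = s' p})"
        unfolding prob_inputs[OF cell] by simp
      also have "\<dots> = prob (input_is i j d) * (\<Prod>p\<in>Q. prob {\<omega> \<in> space M. r (fst p) (snd p) \<omega> = s' p})"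
        unfolding Q_def prod.remove[OF finite_cells cell] by (simp add: s'_def)
      also have "(\<Prod>p\<in>Q. prob {\<omega> \<in> space M. r (fst p) (snd p) \<omega> = s' p}) =
          (\<Prod>p\<in>Q. prob {\<omega> \<in> space M. r (fst p) (snd p) \<omega> = s p})"
        by (rule prod.cong) (auto simp: s'_def Q_def)
      finally show ?thesis unfolding prob_input[OF ij] .
    qed
    finally show ?thesis by (simp add: K_def)
  qed
  define \<kappa> where "\<kappa> = (\<integral>\<^sup>+s. ennreal (K s) \<partial>count_space I)"
  have K0: "0 \<le> K s" if s: "s \<in> I" for s
  proof -
    have "t * (a i * b j) < 1" using a_b[OF ij] t0 t1 mult_strict_mono[of t 1 "a i * b j" 1] by simp
    then have "0 < input_law i j 0" using a_b[OF ij] by (simp add: input_prob_def)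
    moreover have "0 \<le> input_law i j 0 * K s"
      unfolding joint[OF s, symmetric] by (rule measure_nonneg)
    ultimately show ?thesis by (simp add: zero_le_mult_iff)
  qed
  have Ed: "emeasure M (past n l \<inter> input_is i j d) = ennreal (input_law i j d) * \<kappa>" for d
  proof -
    have "past n l \<inter> input_is i j d \<in> events" using past_event r_event[OF ij] by blast
    then have "emeasure M (past n l \<inter> input_is i j d) =
        (\<integral>\<^sup>+s. emeasure M (past n l \<inter> input_is i j d \<inter> {\<omega> \<in> space M. X \<omega> = s}) \<partial>count_space I)"
      by (intro emeasure_partition) (use cI XI XE in auto)
    also have "\<dots> = (\<integral>\<^sup>+s. ennreal (input_law i j d) * ennreal (K s) \<partial>count_space I)"
      by (rule nn_integral_cong) (use joint K0 prob_input[OF ij, of d, symmetric] in \<open>simp add: emeasure_eq_measure ennreal_mult\<close>)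
    also have "\<dots> = ennreal (input_law i j d) * \<kappa>"
      unfolding \<kappa>_def by (rule nn_integral_cmult) simp
    finally show ?thesis .
  qed
  have "emeasure M (past n l) = (\<integral>\<^sup>+d. emeasure M (past n l \<inter> input_is i j d) \<partial>count_space UNIV)"
    by (rule emeasure_partition) (use past_event r_event[OF ij] in auto)
  also have "\<dots> = (\<integral>\<^sup>+d. ennreal (input_law i j d) \<partial>count_space UNIV) * \<kappa>"
    unfolding Ed by (rule nn_integral_multc) simp
  also have "(\<integral>\<^sup>+d. ennreal (input_law i j d) \<partial>count_space UNIV) = 1"
  proof -
    have "emeasure M (space M) = (\<integral>\<^sup>+d. emeasure M (space M \<inter> input_is i j d) \<partial>count_space UNIV)"
      by (rule emeasure_partition) (use r_event[OF ij] in auto)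
    also have "\<dots> = (\<integral>\<^sup>+d. ennreal (input_law i j d) \<partial>count_space UNIV)"
      by (rule nn_integral_cong) (simp add: emeasure_eq_measure prob_input[OF ij, symmetric] Int_def)
    finally show ?thesis using emeasure_space_1 by simp
  qed
  finally show ?thesis using Ed[of d] by (simp add: n_def)
qed

end

section \<open>The conditional law of one cell\<close>

context rsk_field
begin

lemma Lam_set_event: "(Lam_in i j R) \<in> events"
  using measurable_sets[OF field_measurable[of i j], of R] by (simp add: vimage_def Int_def conj_commute)

text \<open>Given the past and the inputs, the cells of the antidiagonal are independent. Each of them has the
probability distribution found in \<open>rsk_pmf\<close>, so the marginal at \<open>(i, j)\<close> is the factor that belongs
to this cell.\<close>

lemma atom_law:
  fixes p :: "int list pmf"
  assumes ij: "1 \<le> i" "1 \<le> j" and n: "n = i + j"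
    and p: "\<And>rho. pmf p rho = hlU_input t (s i j) (l (i - 1) j) rho (l (i - 1) (j - 1)) (l i (j - 1))"
  defines "A \<equiv> past n l \<inter> inputs n s"
  shows "emeasure M (A \<inter> Lam_in i j R) = emeasure (measure_pmf p) R * emeasure M A"
proof (cases "prob A = 0")
  case True
  have A: "A \<in> events" unfolding A_def using past_event inputs_event by blast
  have "emeasure M (A \<inter> Lam_in i j R) \<le> emeasure M A"
    by (rule emeasure_mono) (use A in auto)
  then show ?thesis using True by (simp add: emeasure_eq_measure)
next
  case False
  have A: "A \<in> events" unfolding A_def using past_event inputs_event by blast
  have g: "good l i' j'" if "i' + j' < n" for i' j'
    using good_atom[of n l n s i' j'] False that by (simp add: A_def)
  define D where "D = antidiag n"
  have finD: "finite D" unfolding D_def by (rule finite_antidiag)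
  have ijD: "(i, j) \<in> D" using ij n by (simp add: D_def antidiag_def)
  define u where "u q rho = hlU_input t (s (fst q) (snd q)) (l (fst q - 1) (snd q)) rho
      (l (fst q - 1) (snd q - 1)) (l (fst q) (snd q - 1))" for q rho
  have "\<forall>q \<in> D. \<exists>p :: int list pmf. \<forall>rho. pmf p rho = u q rho"
  proof
    fix q assume q: "q \<in> D"
    obtain i' j' where q': "q = (i', j')" "1 \<le> i'" "1 \<le> j'" "i' + j' = n"
      using q by (auto simp: D_def antidiag_def)
    interpret input_data t "j' - 1" "s i' j'" "l (i' - 1) (j' - 1)" "l (i' - 1) j'" "l i' (j' - 1)"
      by (rule good_input_data) (use g q' in auto)
    show "\<exists>p :: int list pmf. \<forall>rho. pmf p rho = u q rho"
      by (rule rsk_pmf) (auto simp: u_def q')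
  qed
  then obtain P :: "nat \<times> nat \<Rightarrow> int list pmf" where P: "\<And>q rho. q \<in> D \<Longrightarrow> pmf (P q) rho = u q rho"
    by (auto dest!: bchoice)
  have Pp: "P (i, j) = p" by (rule pmf_eqI) (simp add: P[OF ijD] p u_def)
  define F where "F = PiE D (\<lambda>_. UNIV :: int list set)"
  define X where "X \<omega> = restrict (\<lambda>q. \<Lambda> (fst q) (snd q) \<omega>) D" for \<omega>
  have cF: "countable F" unfolding F_def by (rule countable_PiE[OF finD]) auto
  have XF: "X \<omega> \<in> F" for \<omega> by (auto simp: X_def F_def)
  have Xeq: "X \<omega> = f \<longleftrightarrow> (\<forall>q \<in> D. \<Lambda> (fst q) (snd q) \<omega> = f q)" if "f \<in> F" for f \<omega>
    using that by (auto simp: F_def X_def PiE_def extensional_def fun_eq_iff restrict_def)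
  have XE: "{\<omega> \<in> space M. X \<omega> = f} \<in> events" if "f \<in> F" for f
    unfolding Xeq[OF that] by (rule finite_Lam_event[OF finD])
  define Q where "Q = Pi_pmf D undefined P"
  have law: "prob (A \<inter> {\<omega> \<in> space M. X \<omega> = f}) = pmf Q f * prob A" if f: "f \<in> F" for f
  proof -
    \<comment> \<open>Extending the past by the values \<open>f\<close> does not change the event \<open>past n l\<close>.\<close>
    define l' where "l' i j = (if (i, j) \<in> D then f (i, j) else l i j)" for i j
    have same: "l' i' j' = l i' j'" if "i' + j' < n" for i' j'
      using that by (auto simp: l'_def D_def antidiag_def)
    have past: "past n l' = past n l" unfolding past_def using same by auto
    have diag: "{\<omega> \<in> space M. X \<omega> = f} = diagonal n l'"
      unfolding Xeq[OF f] diagonal_def D_def[symmetric] by (auto simp: l'_def)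
    have "step_prob n l' s = (\<Prod>q\<in>D. pmf (P q) (f q))"
      unfolding step_prob_def D_def[symmetric]
    proof (rule prod.cong[OF refl])
      fix q assume q: "q \<in> D"
      obtain i' j' where q': "q = (i', j')" "1 \<le> i'" "1 \<le> j'" "i' + j' = n"
        using q by (auto simp: D_def antidiag_def)
      have "l' (i' - 1) j' = l (i' - 1) j'" "l' (i' - 1) (j' - 1) = l (i' - 1) (j' - 1)"
        "l' i' (j' - 1) = l i' (j' - 1)" by (rule same; use q' in linarith)+
      moreover have "l' i' j' = f q" using q q' by (simp add: l'_def)
      ultimately show "(case q of (i, j) \<Rightarrow> hlU_input t (s i j) (l' (i - 1) j) (l' i j) (l' (i - 1) (j - 1)) (l' i (j - 1))) =
          pmf (P q) (f q)" using P[OF q, of "f q"] unfolding u_def q' by simp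
    qed
    also have "\<dots> = pmf Q f"
      unfolding Q_def by (rule pmf_Pi'[symmetric, OF finD]) (use f in \<open>auto simp: F_def PiE_def extensional_def\<close>)
    finally have "step_prob n l' s = pmf Q f" .
    moreover have "A \<inter> {\<omega> \<in> space M. X \<omega> = f} = diagonal n l' \<inter> (past n l' \<inter> inputs n s)"
      unfolding diag past A_def by blast
    ultimately show ?thesis using diagonal_step[of n n l' s] by (simp add: past A_def)
  qed
  have "emeasure M (A \<inter> Lam_in i j R) =
      (\<integral>\<^sup>+f. emeasure M (A \<inter> Lam_in i j R \<inter> {\<omega> \<in> space M. X \<omega> = f}) \<partial>count_space F)"
    by (rule emeasure_partition) (use cF XF XE A Lam_set_event in auto)
  also have "\<dots> = (\<integral>\<^sup>+f. ennreal (pmf Q f) * indicator {f. f (i, j) \<in> R} f * emeasure M A \<partial>count_space F)"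
  proof (rule nn_integral_cong)
    fix f assume "f \<in> space (count_space F)"
    then have f: "f \<in> F" by simp
    show "emeasure M (A \<inter> Lam_in i j R \<inter> {\<omega> \<in> space M. X \<omega> = f}) =
        ennreal (pmf Q f) * indicator {f. f (i, j) \<in> R} f * emeasure M A"
    proof (cases "f (i, j) \<in> R")
      case True
      have "A \<inter> Lam_in i j R \<inter> {\<omega> \<in> space M. X \<omega> = f} = A \<inter> {\<omega> \<in> space M. X \<omega> = f}"
        using True ijD unfolding Xeq[OF f] by fastforce
      then show ?thesis using law[OF f] True by (simp add: emeasure_eq_measure ennreal_mult)
    next
      case False
      have "A \<inter> Lam_in i j R \<inter> {\<omega> \<in> space M. X \<omega> = f} = {}"
        using False ijD unfolding Xeq[OF f] by fastforce
      then show ?thesis using False by simp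
    qed
  qed
  also have "\<dots> = (\<integral>\<^sup>+f. ennreal (pmf Q f) * indicator {f. f (i, j) \<in> R} f \<partial>count_space F) * emeasure M A"
    by (rule nn_integral_multc) simp
  also have "(\<integral>\<^sup>+f. ennreal (pmf Q f) * indicator {f. f (i, j) \<in> R} f \<partial>count_space F) =
      (\<integral>\<^sup>+f. ennreal (pmf Q f) * indicator {f. f (i, j) \<in> R} f \<partial>count_space UNIV)"
  proof (rule nn_integral_count_space_eq)
    fix f :: "nat \<times> nat \<Rightarrow> int list" assume "f \<in> UNIV - F"
    then have "pmf Q f = 0"
      unfolding Q_def by (intro pmf_Pi_outside[OF finD]) (auto simp: F_def PiE_def extensional_def)
    then show "ennreal (pmf Q f) * indicator {f. f (i, j) \<in> R} f = 0" by simp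
  qed simp
  also have "\<dots> = emeasure (measure_pmf Q) {f. f (i, j) \<in> R}"
    unfolding nn_integral_measure_pmf[symmetric] by simp
  also have "\<dots> = emeasure (measure_pmf (map_pmf (\<lambda>f. f (i, j)) Q)) R"
    by (simp add: vimage_def)
  also have "map_pmf (\<lambda>f. f (i, j)) Q = p"
    unfolding Q_def Pi_pmf_component[OF finD] using ijD Pp by simp
  finally show ?thesis .
qed

context
  fixes i j :: nat
  assumes ij: "1 \<le> i" "1 \<le> j"
begin

definition "block lam nu mu = {\<omega> \<in> space M. \<Lambda> (i - 1) (j - 1) \<omega> = lam \<and> \<Lambda> i (j - 1) \<omega> = nu \<and> \<Lambda> (i - 1) j \<omega> = mu}"

lemma block_event: "block lam nu mu \<in> events"
proof -
  have "block lam nu mu = {\<omega> \<in> space M. \<Lambda> (i - 1) (j - 1) \<omega> = lam} \<inter> {\<omega> \<in> space M. \<Lambda> i (j - 1) \<omega> = nu} \<inter>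
      {\<omega> \<in> space M. \<Lambda> (i - 1) j \<omega> = mu}"
    by (auto simp: block_def)
  also have "\<dots> \<in> events" using Lam_event by blast
  finally show ?thesis .
qed

lemma block_past:
  assumes "\<omega>0 \<in> past (i + j) l" "\<omega>0 \<in> block lam nu mu"
  shows "l (i - 1) (j - 1) = lam" "l i (j - 1) = nu" "l (i - 1) j = mu" "past (i + j) l \<subseteq> block lam nu mu"
proof -
  have lt: "i - 1 + (j - 1) < i + j" "i + (j - 1) < i + j" "i - 1 + j < i + j" using ij by auto
  have eq: "\<Lambda> (i - 1) (j - 1) \<omega> = l (i - 1) (j - 1)" "\<Lambda> i (j - 1) \<omega> = l i (j - 1)" "\<Lambda> (i - 1) j \<omega> = l (i - 1) j"
    if "\<omega> \<in> past (i + j) l" for \<omega>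
    using that lt unfolding past_def by blast+
  show e: "l (i - 1) (j - 1) = lam" "l i (j - 1) = nu" "l (i - 1) j = mu"
    using eq[OF assms(1)] assms(2) by (auto simp: block_def)
  show "past (i + j) l \<subseteq> block lam nu mu"
    using eq e unfolding block_def by (auto simp: past_def)
qed

lemma block_indep_input:
  "emeasure M (block lam nu mu \<inter> input_is i j d) =
    ennreal (input_law i j d) * emeasure M (block lam nu mu)"
proof -
  define n where "n = i + j"
  define I where "I = PiE (corner n) (\<lambda>_. UNIV :: int list set)"
  define X where "X \<omega> = restrict (\<lambda>p. \<Lambda> (fst p) (snd p) \<omega>) (corner n)" for \<omega>
  have cI: "countable I" unfolding I_def corner_def by (rule countable_PiE[OF finite_triangle]) auto
  have XI: "X \<omega> \<in> I" for \<omega> by (auto simp: X_def I_def)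
  have Xeq: "{\<omega> \<in> space M. X \<omega> = f} = past n (curry f)" if "f \<in> I" for f
  proof -
    have "X \<omega> = f \<longleftrightarrow> (\<forall>p \<in> corner n. \<Lambda> (fst p) (snd p) \<omega> = f p)" for \<omega>
      using that by (auto simp: I_def X_def PiE_def extensional_def fun_eq_iff restrict_def)
    then show ?thesis by (auto simp: past_def corner_def)
  qed
  define B where "B = block lam nu mu"
  have B: "B \<in> events" unfolding B_def by (rule block_event)
  have part: "emeasure M (B \<inter> input_is i j d \<inter> past n l) =
      ennreal (input_law i j d) * emeasure M (B \<inter> past n l)" for l
  proof (cases "B \<inter> past n l = {}")
    case True
    then have "B \<inter> input_is i j d \<inter> past n l = {}" by blast
    then show ?thesis using True by simp
  next
    case False
    then have "past n l \<subseteq> B" using block_past(4) unfolding n_def B_def by blast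
    then have "B \<inter> input_is i j d \<inter> past n l = past n l \<inter> input_is i j d"
      "B \<inter> past n l = past n l" by auto
    then show ?thesis using past_indep_input[OF ij, of l d] by (simp add: n_def)
  qed
  have "emeasure M (B \<inter> input_is i j d) =
      (\<integral>\<^sup>+f. emeasure M (B \<inter> input_is i j d \<inter> {\<omega> \<in> space M. X \<omega> = f}) \<partial>count_space I)"
    by (rule emeasure_partition) (use cI XI Xeq past_event B r_event[OF ij] in auto)
  also have "\<dots> = (\<integral>\<^sup>+f. ennreal (input_law i j d) * emeasure M (B \<inter> {\<omega> \<in> space M. X \<omega> = f}) \<partial>count_space I)"
    by (rule nn_integral_cong) (simp add: Xeq part)
  also have "\<dots> = ennreal (input_law i j d) * (\<integral>\<^sup>+f. emeasure M (B \<inter> {\<omega> \<in> space M. X \<omega> = f}) \<partial>count_space I)"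
    by (rule nn_integral_cmult) simp
  also have "(\<integral>\<^sup>+f. emeasure M (B \<inter> {\<omega> \<in> space M. X \<omega> = f}) \<partial>count_space I) = emeasure M B"
    by (rule emeasure_partition[symmetric]) (use cI XI Xeq past_event B in auto)
  finally show ?thesis unfolding B_def .
qed

lemma block_input_data:
  assumes "0 < prob (block lam nu mu)"
  shows "input_data t (j - 1) lam mu nu"
proof -
  define n where "n = i + j"
  have "emeasure M (block lam nu mu) \<noteq> 0" using assms by (simp add: emeasure_eq_measure)
  then have "(\<integral>\<^sup>+c. emeasure M (block lam nu mu \<inter> atom n c) \<partial>count_space (atom_space n)) \<noteq> 0"
    unfolding emeasure_atoms[OF block_event, of lam nu mu n] .
  moreover have "(\<integral>\<^sup>+c. emeasure M (block lam nu mu \<inter> atom n c) \<partial>count_space (atom_space n)) = 0"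
    if "\<And>c. c \<in> atom_space n \<Longrightarrow> emeasure M (block lam nu mu \<inter> atom n c) = 0"
    using nn_integral_cong[of "count_space (atom_space n)" _ "\<lambda>_. 0"] that by simp
  ultimately obtain c where c: "c \<in> atom_space n"
    and nz: "emeasure M (block lam nu mu \<inter> atom n c) \<noteq> 0" by blast
  define l s where "l = curry (fst c)" and "s = curry (snd c)"
  note at = atom_eq[OF c, folded l_def s_def]
  have "block lam nu mu \<inter> (past n l \<inter> inputs n s) \<noteq> {}" using nz unfolding at by auto
  then obtain \<omega> where "\<omega> \<in> past n l" "\<omega> \<in> block lam nu mu" by blast
  note e = block_past[OF this[unfolded n_def]]
  have "prob (block lam nu mu \<inter> (past n l \<inter> inputs n s)) \<le> prob (past n l \<inter> inputs n s)"
    by (rule finite_measure_mono) (use past_event inputs_event in auto)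
  moreover have "prob (block lam nu mu \<inter> (past n l \<inter> inputs n s)) \<noteq> 0"
    using nz unfolding at by (simp add: emeasure_eq_measure)
  ultimately have "prob (past n l \<inter> inputs n s) \<noteq> 0"
    using measure_nonneg[of M "block lam nu mu \<inter> (past n l \<inter> inputs n s)"] by linarith
  then have "good l i' j'" if "i' + j' < n" for i' j' using good_atom[of n l n s i' j'] that by simp
  then have "input_data t (j - 1) (l (i - 1) (j - 1)) (l (i - 1) j) (l i (j - 1))"
    by (intro good_input_data) (use ij in \<open>auto simp: n_def\<close>)
  then show ?thesis unfolding e(1-3) .
qed

text \<open>On each atom the conditional law of the exiting arrows depends on nothing but the input \<open>d\<close> of the
cell. The atoms with the same \<open>d\<close> can be put together, and \<open>d\<close> is independent of the block.\<close>

lemma block_exit_law: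
  assumes pos: "0 < prob (block lam nu mu)"
  shows "prob (block lam nu mu \<inter> {\<omega> \<in> space M. exiting nu mu (\<Lambda> i j \<omega>) = A}) =
    vertex_prob t (a i * b j) (d1 lam) (entering lam nu mu) A * prob (block lam nu mu)"
proof -
  note data = block_input_data[OF pos]
  define n where "n = i + j"
  define E where "E = entering lam nu mu"
  define q where "q = stay_chance t E (d1 lam)"
  define g where "g d = q * of_bool (exits E d True = A) + (1 - q) * of_bool (exits E d False = A)" for d
  define B where "B = block lam nu mu"
  define R where "R = {rho. exiting nu mu rho = A}"
  have B: "B \<in> events" unfolding B_def by (rule block_event)
  have q01: "0 \<le> q" "q \<le> 1" unfolding q_def using stay_chance_range[OF t0 t1] by auto
  have g0: "0 \<le> g d" for d using q01 by (simp add: g_def)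
  have d1: "1 \<le> d1 lam" if "BL \<in> E" "BB \<notin> E" "RL \<notin> E" "RB \<in> E"
  proof -
    interpret input_data t "j - 1" 0 lam mu nu by (rule data)
    have "below mu 0 \<noteq> below lam 0" "below mu 1 = below lam 1"
      using that entering_below unfolding E_def by auto
    then have "below lam 0 < below lam 1"
      using interlaces_Suc_below[OF Sig(1,3) il(2), of 0] below_mono[of 0 1 mu] by auto
    then show ?thesis using below_pred[of lam 1] by (simp add: d1_def)
  qed
  have x: "0 < a i * b j" "a i * b j < 1" using a_b[OF ij] by auto
  have g2: "g d = g 2" if "2 \<le> d" for d using exits_many[OF that] by (simp add: g_def)
  have v: "vertex_prob t (a i * b j) (d1 lam) E A =
      (1 - a i * b j) / (1 - t * (a i * b j)) * g 0 +
      (1 - t) * (a i * b j) * (1 - a i * b j) / (1 - t * (a i * b j)) * g 1 +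
      (1 - t) * (a i * b j) ^ 2 / (1 - t * (a i * b j)) * g 2"
    unfolding g_def q_def by (rule vertex_prob_average[OF t0 t1 x d1])
  have "t * (a i * b j) < 1" using x t0 t1 mult_strict_mono[of t 1 "a i * b j" 1] by simp
  then have v0: "0 \<le> vertex_prob t (a i * b j) (d1 lam) E A"
    unfolding v using x t1 g0 by simp
  have atom: "emeasure M (B \<inter> input_is i j d \<inter> Lam_in i j R \<inter> atom n c) =
      ennreal (g d) * emeasure M (B \<inter> input_is i j d \<inter> atom n c)"
    if c: "c \<in> atom_space n" for c d
  proof (cases "B \<inter> input_is i j d \<inter> atom n c = {}")
    case True
    then have "B \<inter> input_is i j d \<inter> Lam_in i j R \<inter> atom n c = {}" by blast
    then show ?thesis using True by simp
  next
    case False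
    define l s where "l = curry (fst c)" and "s = curry (snd c)"
    note at = atom_eq[OF c, folded l_def s_def]
    obtain \<omega>0 where w: "\<omega>0 \<in> B" "r i j \<omega>0 = d" "\<omega>0 \<in> past n l" "\<omega>0 \<in> inputs n s" using False unfolding at by blast
    note e = block_past[OF w(3)[unfolded n_def] w(1)[unfolded B_def]]
    have cell: "1 \<le> i \<and> 1 \<le> j \<and> i + j \<le> n" using ij by (simp add: n_def)
    then have sd: "s i j = d" using w(2,4) unfolding inputs_def by auto
    have sub: "past n l \<inter> inputs n s \<subseteq> B \<inter> input_is i j d"
      using e(4) cell sd unfolding B_def n_def inputs_def by auto
    interpret input_data t "j - 1" d lam mu nu by (rule data)
    obtain p :: "int list pmf" where p: "\<And>rho. pmf p rho = hlU_input t d mu rho lam nu"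
      "\<And>A. measure p {rho. exiting nu mu rho = A} =
        stay_chance t E (d1 lam) * of_bool (exits E d True = A) + (1 - stay_chance t E (d1 lam)) * of_bool (exits E d False = A)"
      using rsk_pmf unfolding E_def by blast
    have pR: "emeasure (measure_pmf p) R = ennreal (g d)"
      unfolding measure_pmf.emeasure_eq_measure R_def p(2) g_def q_def ..
    have "emeasure M (past n l \<inter> inputs n s \<inter> Lam_in i j R) =
        emeasure (measure_pmf p) R * emeasure M (past n l \<inter> inputs n s)"
      by (rule atom_law[OF ij n_def]) (simp only: p(1) sd e(1-3))
    moreover have "B \<inter> input_is i j d \<inter> Lam_in i j R \<inter> (past n l \<inter> inputs n s) =
        past n l \<inter> inputs n s \<inter> Lam_in i j R"
      "B \<inter> input_is i j d \<inter> (past n l \<inter> inputs n s) = past n l \<inter> inputs n s"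
      using sub by blast+
    ultimately show ?thesis unfolding at pR by simp
  qed
  have given_input: "emeasure M (B \<inter> Lam_in i j R \<inter> input_is i j d) =
      ennreal (input_law i j d) * ennreal (g d) * emeasure M B" for d
  proof -
    have ev: "B \<inter> input_is i j d \<in> events" using B r_event[OF ij] by blast
    have "emeasure M (B \<inter> input_is i j d \<inter> Lam_in i j R) =
        (\<integral>\<^sup>+c. ennreal (g d) * emeasure M (B \<inter> input_is i j d \<inter> atom n c) \<partial>count_space (atom_space n))"
      unfolding emeasure_atoms[OF sets.Int[OF ev Lam_set_event[of i j R]], of n]
      by (rule nn_integral_cong) (simp add: atom)
    also have "\<dots> = ennreal (g d) * emeasure M (B \<inter> input_is i j d)"
      unfolding emeasure_atoms[OF ev, of n] by (rule nn_integral_cmult) simp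
    also have "\<dots> = ennreal (input_law i j d) * ennreal (g d) * emeasure M B"
      unfolding B_def block_indep_input by (simp add: mult_ac)
    finally show ?thesis by (simp add: Int_ac)
  qed
  have "emeasure M (B \<inter> Lam_in i j R) =
      (\<integral>\<^sup>+d. emeasure M (B \<inter> Lam_in i j R \<inter> input_is i j d) \<partial>count_space UNIV)"
    by (rule emeasure_partition) (use B Lam_set_event r_event[OF ij] in auto)
  also have "\<dots> = (\<integral>\<^sup>+d. ennreal (input_law i j d) * ennreal (g d) \<partial>count_space UNIV) * emeasure M B"
    unfolding given_input by (rule nn_integral_multc) simp
  also have "(\<integral>\<^sup>+d. ennreal (input_law i j d) * ennreal (g d) \<partial>count_space UNIV) =
      ennreal (vertex_prob t (a i * b j) (d1 lam) E A)"
    unfolding v by (rule input_average[where g = g, OF t0 t1 x g2 g0])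
  finally show ?thesis
    using v0 unfolding B_def R_def E_def by (simp add: emeasure_eq_measure ennreal_mult[symmetric])
qed

end

end

section \<open>The vertex model\<close>

lemma out_arrow_UNIV: "(UNIV :: out_arrow set) = {BU, BR, RU, RR}"
  using out_arrow.exhaust by blast

lemma finite_out_arrow_sets: "finite (UNIV :: out_arrow set set)"
proof -
  have "finite (UNIV :: out_arrow set)" unfolding out_arrow_UNIV by simp
  then show ?thesis unfolding Pow_UNIV[symmetric] by (simp only: finite_Pow_iff)
qed

definition arrows_in :: "nat \<times> nat \<Rightarrow> nat \<times> nat \<Rightarrow> nat \<times> nat \<Rightarrow> in_arrow set" where
  "arrows_in mu nu lam = {x.
     x = BL \<and> fst mu \<noteq> fst lam \<or> x = RL \<and> fst mu + snd mu \<noteq> fst lam + snd lam \<or>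
     x = BB \<and> fst nu \<noteq> fst lam \<or> x = RB \<and> fst nu + snd nu \<noteq> fst lam + snd lam}"

text \<open>The pair \<open>(d0, d1)\<close> at the upper right corner, from its value at the upper left corner and the
exiting arrows, of which those pointing upwards lower the heights.\<close>

definition pair_out :: "nat \<times> nat \<Rightarrow> out_arrow set \<Rightarrow> nat \<times> nat" where
  "pair_out mu A = (fst mu - of_bool (BU \<in> A),
     fst mu + snd mu - of_bool (RU \<in> A) - (fst mu - of_bool (BU \<in> A)))"

lemma arrows_in_eq: "arrows_in (d0 mu, d1 mu) (d0 nu, d1 nu) (d0 lam, d1 lam) = entering lam nu mu"
  by (simp add: arrows_in_def entering_def h0_def h1_def)

lemma pair_out_eq:
  assumes "h0 mu \<in> {h0 rho, h0 rho + 1}" "h1 mu \<in> {h1 rho, h1 rho + 1}"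
  shows "pair_out (d0 mu, d1 mu) (exiting nu mu rho) = (d0 rho, d1 rho)"
  using assms by (auto simp: pair_out_def exiting_def h0_def h1_def)

lemma card_entering_exiting:
  fixes h :: "int list \<Rightarrow> nat"
  assumes "h mu \<in> {h lam, h lam + 1}" "h rho \<in> {h nu, h nu + 1}"
    "h lam \<in> {h nu, h nu + 1}" "h mu \<in> {h rho, h rho + 1}"
  shows "of_bool (h mu \<noteq> h lam) + of_bool (h nu \<noteq> h lam) =
    (of_bool (h rho \<noteq> h mu) + of_bool (h rho \<noteq> h nu) :: nat)"
  using assms by (elim insertE emptyE) simp_all

lemma card_Int_pair:
  assumes "x \<noteq> y" shows "card (A \<inter> {x, y}) = of_bool (x \<in> A) + of_bool (y \<in> A)"
proof -
  have "A \<inter> {x, y} = (if x \<in> A then {x} else {}) \<union> (if y \<in> A then {y} else {})" by auto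
  then show ?thesis using assms by auto
qed

context rsk_field
begin

lemma good_heights:
  assumes g: "good l (i - 1) (j - 1)" "good l i (j - 1)" "good l (i - 1) j" "good l i j"
    and ij: "1 \<le> i" "1 \<le> j" and h: "h \<in> {h0, h1}"
  shows "h (l (i - 1) j) \<in> {h (l (i - 1) (j - 1)), h (l (i - 1) (j - 1)) + 1}"
    "h (l i j) \<in> {h (l i (j - 1)), h (l i (j - 1)) + 1}"
    "h (l (i - 1) (j - 1)) \<in> {h (l i (j - 1)), h (l i (j - 1)) + 1}"
    "h (l (i - 1) j) \<in> {h (l i j), h (l i j) + 1}"
proof -
  have p: "0 < i" "0 < j" "Suc (j - 1) = j" using ij by auto
  have sig: "l (i - 1) (j - 1) \<in> Sig (j - 1)" "l i (j - 1) \<in> Sig (j - 1)"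
    "l (i - 1) j \<in> Sig (Suc (j - 1))" "l i j \<in> Sig (Suc (j - 1))"
    using g unfolding good_def p(3) by auto
  have il: "l (i - 1) (j - 1) \<prec>s l i (j - 1)" "l (i - 1) (j - 1) \<prec>s l (i - 1) j"
    "l (i - 1) j \<prec>s l i j" "l i (j - 1) \<prec>s l i j"
    using g p(1,2) unfolding good_def by auto
  have "\<exists>k. \<forall>l' \<in> {l (i - 1) (j - 1), l i (j - 1), l (i - 1) j, l i j}. h l' = below l' k"
    using h h_below g unfolding good_def by auto
  then obtain k where k: "h (l (i - 1) (j - 1)) = below (l (i - 1) (j - 1)) k"
    "h (l i (j - 1)) = below (l i (j - 1)) k" "h (l (i - 1) j) = below (l (i - 1) j) k" "h (l i j) = below (l i j) k"
    by auto
  show "h (l (i - 1) j) \<in> {h (l (i - 1) (j - 1)), h (l (i - 1) (j - 1)) + 1}"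
    "h (l i j) \<in> {h (l i (j - 1)), h (l i (j - 1)) + 1}"
    unfolding k using interlaces_Suc_below[OF sig(1,3) il(2)] interlaces_Suc_below[OF sig(2,4) il(4)] .
  have same: "below x k \<in> {below y k, below y k + 1}" if "x \<in> Sig N" "y \<in> Sig N" "x \<prec>s y" for x y N
  proof -
    have "below y k \<le> below x k \<and> below x k \<le> below y k + 1"
      using interlaces_iff_below[OF that(1,2)] that(3) by blast
    then show ?thesis by auto
  qed
  show "h (l (i - 1) (j - 1)) \<in> {h (l i (j - 1)), h (l i (j - 1)) + 1}"
    "h (l (i - 1) j) \<in> {h (l i j), h (l i j) + 1}"
    unfolding k using same[OF sig(1,2) il(1)] same[OF sig(3,4) il(3)] .
qed

lemma AE_heights:
  assumes ij: "1 \<le> i" "1 \<le> j"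
  shows "AE \<omega> in M. \<forall>h \<in> {h0, h1}.
    h (\<Lambda> (i - 1) j \<omega>) \<in> {h (\<Lambda> (i - 1) (j - 1) \<omega>), h (\<Lambda> (i - 1) (j - 1) \<omega>) + 1} \<and>
    h (\<Lambda> i j \<omega>) \<in> {h (\<Lambda> i (j - 1) \<omega>), h (\<Lambda> i (j - 1) \<omega>) + 1} \<and>
    h (\<Lambda> (i - 1) (j - 1) \<omega>) \<in> {h (\<Lambda> i (j - 1) \<omega>), h (\<Lambda> i (j - 1) \<omega>) + 1} \<and>
    h (\<Lambda> (i - 1) j \<omega>) \<in> {h (\<Lambda> i j \<omega>), h (\<Lambda> i j \<omega>) + 1}"
  using AE_good[of "i - 1" "j - 1"] AE_good[of i "j - 1"] AE_good[of "i - 1" j] AE_good[of i j]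
proof eventually_elim
  case (elim \<omega>)
  note h = good_heights[OF elim ij]
  show ?case by (intro ballI conjI h)
qed

lemma AE_arrow_counts:
  assumes ij: "1 \<le> i" "1 \<le> j"
  shows "AE \<omega> in M.
    (let E = entering (\<Lambda> (i - 1) (j - 1) \<omega>) (\<Lambda> i (j - 1) \<omega>) (\<Lambda> (i - 1) j \<omega>);
         X = exiting (\<Lambda> i (j - 1) \<omega>) (\<Lambda> (i - 1) j \<omega>) (\<Lambda> i j \<omega>)
     in card (E \<inter> {BL, BB}) = card (X \<inter> {BU, BR}) \<and>
        card (E \<inter> {RL, RB}) = card (X \<inter> {RU, RR}))"
  using AE_heights[OF ij]
proof eventually_elim
  case (elim \<omega>)
  have c: "of_bool (h (\<Lambda> (i - 1) j \<omega>) \<noteq> h (\<Lambda> (i - 1) (j - 1) \<omega>)) + of_bool (h (\<Lambda> i (j - 1) \<omega>) \<noteq> h (\<Lambda> (i - 1) (j - 1) \<omega>)) =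
      (of_bool (h (\<Lambda> i j \<omega>) \<noteq> h (\<Lambda> (i - 1) j \<omega>)) + of_bool (h (\<Lambda> i j \<omega>) \<noteq> h (\<Lambda> i (j - 1) \<omega>)) :: nat)"
    if "h \<in> {h0, h1}" for h
    by (rule card_entering_exiting) (use elim that in blast)+
  show ?case
    using c[of h0] c[of h1] unfolding Let_def by (simp add: card_Int_pair entering_def exiting_def)
qed

lemma exiting_event: "{\<omega> \<in> space M. exiting nu mu (\<Lambda> i j \<omega>) = A} \<in> events"
  using Lam_set_event[of i j "{rho. exiting nu mu rho = A}"] by simp

lemma block_pair_law:
  assumes ij: "1 \<le> i" "1 \<le> j" and pos: "0 < prob (block i j lam nu mu)"
  shows "prob (block i j lam nu mu \<inter> {\<omega> \<in> space M. (d0 (\<Lambda> i j \<omega>), d1 (\<Lambda> i j \<omega>)) = x}) =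
    (\<Sum>A\<in>{A. pair_out (d0 mu, d1 mu) A = x}. vertex_prob t (a i * b j) (d1 lam) (entering lam nu mu) A) *
    prob (block i j lam nu mu)"
proof -
  define B where "B = block i j lam nu mu"
  define Ax where "Ax = {A. pair_out (d0 mu, d1 mu) A = x}"
  have B: "B \<in> events" unfolding B_def by (rule block_event[OF ij])
  have fin: "finite Ax" by (rule finite_subset[OF subset_UNIV finite_out_arrow_sets])
  have "prob (B \<inter> {\<omega> \<in> space M. \<Lambda> i j \<omega> \<in> {rho. (d0 rho, d1 rho) = x}}) =
      prob (\<Union>A\<in>Ax. B \<inter> {\<omega> \<in> space M. exiting nu mu (\<Lambda> i j \<omega>) = A})"
  proof (rule finite_measure_eq_AE)
    show "AE \<omega> in M. \<omega> \<in> B \<inter> {\<omega> \<in> space M. \<Lambda> i j \<omega> \<in> {rho. (d0 rho, d1 rho) = x}} \<longleftrightarrow>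
        \<omega> \<in> (\<Union>A\<in>Ax. B \<inter> {\<omega> \<in> space M. exiting nu mu (\<Lambda> i j \<omega>) = A})"
      using AE_heights[OF ij]
    proof eventually_elim
      case (elim \<omega>)
      show ?case
      proof (cases "\<omega> \<in> B")
        case True
        then have "\<Lambda> (i - 1) j \<omega> = mu" by (simp add: B_def block_def[OF ij])
        then have "pair_out (d0 mu, d1 mu) (exiting nu mu (\<Lambda> i j \<omega>)) = (d0 (\<Lambda> i j \<omega>), d1 (\<Lambda> i j \<omega>))"
          by (intro pair_out_eq) (use elim in auto)
        then show ?thesis by (auto simp: Ax_def)
      qed simp
    qed
    show "B \<inter> {\<omega> \<in> space M. \<Lambda> i j \<omega> \<in> {rho. (d0 rho, d1 rho) = x}} \<in> events"
      using B Lam_set_event by blast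
    show "(\<Union>A\<in>Ax. B \<inter> {\<omega> \<in> space M. exiting nu mu (\<Lambda> i j \<omega>) = A}) \<in> events"
      using B exiting_event fin by (intro sets.finite_UN) auto
  qed
  also have "\<dots> = (\<Sum>A\<in>Ax. prob (B \<inter> {\<omega> \<in> space M. exiting nu mu (\<Lambda> i j \<omega>) = A}))"
    by (rule finite_measure_finite_Union) (use fin B exiting_event in \<open>auto simp: disjoint_family_on_def\<close>)
  also have "\<dots> = (\<Sum>A\<in>Ax. vertex_prob t (a i * b j) (d1 lam) (entering lam nu mu) A) * prob B"
    unfolding B_def block_exit_law[OF ij pos] sum_distrib_right ..
  finally show ?thesis by (simp add: B_def Ax_def)
qed

end

theorem proposition4p2:
  fixes t :: real and a b :: "nat \<Rightarrow> real" and M :: "'w measure"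
    and r :: "nat \<Rightarrow> nat \<Rightarrow> 'w \<Rightarrow> nat" and \<Lambda> :: "nat \<Rightarrow> nat \<Rightarrow> 'w \<Rightarrow> int list"
    and i j :: nat
  assumes "0 \<le> t" and "t < 1"
    and "\<And>i. 1 \<le> i \<Longrightarrow> 0 < a i"
    and "\<And>j. 1 \<le> j \<Longrightarrow> 0 < b j"
    and "\<And>i j. 1 \<le> i \<Longrightarrow> 1 \<le> j \<Longrightarrow> a i * b j < 1"
    and "HL_RSK_field t a b M r \<Lambda>"
    and "1 \<le> i" and "1 \<le> j"
  shows
    "(\<exists>K :: nat \<times> nat \<Rightarrow> nat \<times> nat \<Rightarrow> nat \<times> nat \<Rightarrow> nat \<times> nat \<Rightarrow> real.
        \<forall>lam nu mu.
          \<P>(\<omega> in M. \<Lambda> (i - 1) (j - 1) \<omega> = lam \<and> \<Lambda> i (j - 1) \<omega> = nu \<and> \<Lambda> (i - 1) j \<omega> = mu) > 0 \<longrightarrow>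
          (\<forall>x. \<P>(\<omega> in M. (d0 (\<Lambda> i j \<omega>), d1 (\<Lambda> i j \<omega>)) = x \<bar>
                 \<Lambda> (i - 1) (j - 1) \<omega> = lam \<and> \<Lambda> i (j - 1) \<omega> = nu \<and> \<Lambda> (i - 1) j \<omega> = mu)
               = K (d0 mu, d1 mu) (d0 nu, d1 nu) (d0 lam, d1 lam) x))
     \<and> (\<forall>lam nu mu.
          \<P>(\<omega> in M. \<Lambda> (i - 1) (j - 1) \<omega> = lam \<and> \<Lambda> i (j - 1) \<omega> = nu \<and> \<Lambda> (i - 1) j \<omega> = mu) > 0 \<longrightarrow>
          (\<forall>X. \<P>(\<omega> in M. exiting (\<Lambda> i (j - 1) \<omega>) (\<Lambda> (i - 1) j \<omega>) (\<Lambda> i j \<omega>) = X \<bar>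
                 \<Lambda> (i - 1) (j - 1) \<omega> = lam \<and> \<Lambda> i (j - 1) \<omega> = nu \<and> \<Lambda> (i - 1) j \<omega> = mu)
               = vertex_prob t (a i * b j) (d1 lam) (entering lam nu mu) X))
     \<and> (AE \<omega> in M. \<forall>h \<in> {h0, h1}.
          h (\<Lambda> (i - 1) j \<omega>) \<in> {h (\<Lambda> (i - 1) (j - 1) \<omega>), h (\<Lambda> (i - 1) (j - 1) \<omega>) + 1} \<and>
          h (\<Lambda> i j \<omega>) \<in> {h (\<Lambda> i (j - 1) \<omega>), h (\<Lambda> i (j - 1) \<omega>) + 1} \<and>
          h (\<Lambda> (i - 1) (j - 1) \<omega>) \<in> {h (\<Lambda> i (j - 1) \<omega>), h (\<Lambda> i (j - 1) \<omega>) + 1} \<and>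
          h (\<Lambda> (i - 1) j \<omega>) \<in> {h (\<Lambda> i j \<omega>), h (\<Lambda> i j \<omega>) + 1})
     \<and> (AE \<omega> in M.
          (let E = entering (\<Lambda> (i - 1) (j - 1) \<omega>) (\<Lambda> i (j - 1) \<omega>) (\<Lambda> (i - 1) j \<omega>);
               X = exiting (\<Lambda> i (j - 1) \<omega>) (\<Lambda> (i - 1) j \<omega>) (\<Lambda> i j \<omega>)
           in card (E \<inter> {BL, BB}) = card (X \<inter> {BU, BR}) \<and>
              card (E \<inter> {RL, RB}) = card (X \<inter> {RU, RR})))"
proof -
  interpret rsk_field t a b M r \<Lambda>
    by (intro rsk_field.intro rsk_field_axioms.intro assms)
  have ij: "1 \<le> i" "1 \<le> j" using assms by auto
  note block = block_def[OF ij]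
  \<comment> \<open>The value of the pair is computed from \<open>mu\<close> and the exiting arrows alone.\<close>
  define K where "K m n l x = (\<Sum>A\<in>{A. pair_out m A = x}. vertex_prob t (a i * b j) (snd l) (arrows_in m n l) A)"
    for m n l x
  have pair: "\<P>(\<omega> in M. (d0 (\<Lambda> i j \<omega>), d1 (\<Lambda> i j \<omega>)) = x \<bar>
      \<Lambda> (i - 1) (j - 1) \<omega> = lam \<and> \<Lambda> i (j - 1) \<omega> = nu \<and> \<Lambda> (i - 1) j \<omega> = mu) =
      K (d0 mu, d1 mu) (d0 nu, d1 nu) (d0 lam, d1 lam) x"
    if pos: "0 < prob (block i j lam nu mu)" for lam nu mu x
  proof -
    have "{\<omega> \<in> space M. (d0 (\<Lambda> i j \<omega>), d1 (\<Lambda> i j \<omega>)) = x \<and>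
        \<Lambda> (i - 1) (j - 1) \<omega> = lam \<and> \<Lambda> i (j - 1) \<omega> = nu \<and> \<Lambda> (i - 1) j \<omega> = mu} =
        block i j lam nu mu \<inter> {\<omega> \<in> space M. (d0 (\<Lambda> i j \<omega>), d1 (\<Lambda> i j \<omega>)) = x}"
      unfolding block by blast
    then show ?thesis
      unfolding cond_prob_def block[symmetric] K_def arrows_in_eq snd_conv
      using block_pair_law[OF ij pos, of x] pos by simp
  qed
  have exit: "\<P>(\<omega> in M. exiting (\<Lambda> i (j - 1) \<omega>) (\<Lambda> (i - 1) j \<omega>) (\<Lambda> i j \<omega>) = X \<bar>
      \<Lambda> (i - 1) (j - 1) \<omega> = lam \<and> \<Lambda> i (j - 1) \<omega> = nu \<and> \<Lambda> (i - 1) j \<omega> = mu) =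
      vertex_prob t (a i * b j) (d1 lam) (entering lam nu mu) X"
    if pos: "0 < prob (block i j lam nu mu)" for lam nu mu X
  proof -
    have "{\<omega> \<in> space M. exiting (\<Lambda> i (j - 1) \<omega>) (\<Lambda> (i - 1) j \<omega>) (\<Lambda> i j \<omega>) = X \<and>
        \<Lambda> (i - 1) (j - 1) \<omega> = lam \<and> \<Lambda> i (j - 1) \<omega> = nu \<and> \<Lambda> (i - 1) j \<omega> = mu} =
        block i j lam nu mu \<inter> {\<omega> \<in> space M. exiting nu mu (\<Lambda> i j \<omega>) = X}"
      unfolding block by auto
    then show ?thesis
      unfolding cond_prob_def block[symmetric]
      using block_exit_law[OF ij pos, of X] pos by simp
  qed
  show ?thesis
  proof (intro conjI)
    show "\<exists>K :: nat \<times> nat \<Rightarrow> nat \<times> nat \<Rightarrow> nat \<times> nat \<Rightarrow> nat \<times> nat \<Rightarrow> real.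
        \<forall>lam nu mu.
          \<P>(\<omega> in M. \<Lambda> (i - 1) (j - 1) \<omega> = lam \<and> \<Lambda> i (j - 1) \<omega> = nu \<and> \<Lambda> (i - 1) j \<omega> = mu) > 0 \<longrightarrow>
          (\<forall>x. \<P>(\<omega> in M. (d0 (\<Lambda> i j \<omega>), d1 (\<Lambda> i j \<omega>)) = x \<bar>
                 \<Lambda> (i - 1) (j - 1) \<omega> = lam \<and> \<Lambda> i (j - 1) \<omega> = nu \<and> \<Lambda> (i - 1) j \<omega> = mu)
               = K (d0 mu, d1 mu) (d0 nu, d1 nu) (d0 lam, d1 lam) x)"
      by (intro exI[of _ K] allI impI pair) (simp only: block)
    show "\<forall>lam nu mu.
          \<P>(\<omega> in M. \<Lambda> (i - 1) (j - 1) \<omega> = lam \<and> \<Lambda> i (j - 1) \<omega> = nu \<and> \<Lambda> (i - 1) j \<omega> = mu) > 0 \<longrightarrow>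
          (\<forall>X. \<P>(\<omega> in M. exiting (\<Lambda> i (j - 1) \<omega>) (\<Lambda> (i - 1) j \<omega>) (\<Lambda> i j \<omega>) = X \<bar>
                 \<Lambda> (i - 1) (j - 1) \<omega> = lam \<and> \<Lambda> i (j - 1) \<omega> = nu \<and> \<Lambda> (i - 1) j \<omega> = mu)
               = vertex_prob t (a i * b j) (d1 lam) (entering lam nu mu) X)"
      by (intro allI impI exit) (simp only: block)
  qed (use AE_heights[OF ij] AE_arrow_counts[OF ij] in blast)+
qed

end
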